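(* Let $k\ge2$, $p=\lfloor k/2\rfloor$, and let $x\in\mathcal A=\{x\in V:1+x_k>x_1>\cdots>x_k\}$, where $V=\mathbb{R}^k$ or $V=\{x\in\mathbb{R}^k:\sum_ix_i=0\}$. Let $X$ be standard Brownian motion in $V$ started at $x$, and let $\widetilde T$ be its first exit time from $\mathcal A$. Then $$\mathbb{E}_x(\widetilde T)=\sum_{\pi\in P_2(k)}(-1)^{c(\pi)}\widetilde F_p(x_\pi),$$ where $x_\pi=(x_i-x_j)_{\{i<j\}\in\pi}\in\mathbb{R}^p_+$ and $$\widetilde F_p(y_1,\dots,y_p)=\frac{2^{2p}}{\pi^{p+2}}\sum_{l\in\mathbb{O}^p\setminus\{0\}}\frac{1}{l_1^2+\cdots+l_p^2}\prod_{s=1}^p\frac1{l_s}\sin(\pi l_sy_s),$$ with $\mathbb{O}=2\mathbb{N}+1$ if $k$ is even and $\mathbb{O}=2\mathbb{N}$ if $k$ is odd, and with the convention that $\frac1{l_s}\sin(\pi l_sy_s)$ means $\frac12\pi y_s$ when $l_s=0$.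
   Context: $\mathbb{N}=\{0,1,2,\dots\}$. $P_2(k)$ is the set of partitions of $\{1,\dots,k\}$ into $k/2$ pairs if $k$ is even, and into $(k-1)/2$ pairs and one singlet if $k$ is odd. The notation $\{i<j\}\in\pi$ means $\{i,j\}\in\pi$ and $i<j$. $c(\pi)$ is the number of crossings of $\pi$, i.e. of pairs of blocks $\{i<j\},\{i'<j'\}$ with $i<i'<j<j'$; if $k$ is odd, one adds an extra pair consisting of the singlet and an additional point labelled $0$, and uses this pair in computing the number of crossings. The constant $\pi$ in $\widetilde F_p$ is the usual number. $\widetilde F_p$ is symmetric in its arguments, so the order of the components of $x_\pi$ is immaterial. *)

theory Defs
  imports "HOL-Probability.Probability" "HOL-Library.Disjoint_Sets"
begin

text \<open>Vectors of \<open>\<real>\<^sup>k\<close> are extensional functions on \<open>{1..k}\<close>, so coordinates carry the labels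
  \<open>1, \<dots>, k\<close> that are also the points being partitioned.\<close>

definition full_space :: "nat \<Rightarrow> (nat \<Rightarrow> real) set" where
  "full_space k = ({1..k} \<rightarrow>\<^sub>E UNIV)"

definition zero_sum_space :: "nat \<Rightarrow> (nat \<Rightarrow> real) set" where
  "zero_sum_space k = {x \<in> full_space k. (\<Sum>i=1..k. x i) = 0}"

definition alcove :: "nat \<Rightarrow> (nat \<Rightarrow> real) set \<Rightarrow> (nat \<Rightarrow> real) set" where
  "alcove k V = {x \<in> V. 1 + x k > x 1 \<and> (\<forall>i\<in>{1..<k}. x i > x (Suc i))}"

text \<open>Standard Brownian motion started at \<open>x\<close> in a linear subspace \<open>V\<close> of \<open>\<real>\<^sup>k\<close>, with the
  Euclidean inner product inherited from \<open>\<real>\<^sup>k\<close>. The last assumption says that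
  \<open>X t - X s\<close> is a centred Gaussian vector of \<open>V\<close> with covariance \<open>(t - s)\<close> times the identity
  of \<open>V\<close>: its inner product with each nonzero \<open>v \<in> V\<close> is normal with variance
  \<open>(t - s) * \<bar>v\<bar>\<^sup>2\<close>.\<close>

locale brownian_motion = prob_space M
  for M :: "'w measure" and k :: nat and V :: "(nat \<Rightarrow> real) set"
    and x :: "nat \<Rightarrow> real" and X :: "real \<Rightarrow> 'w \<Rightarrow> nat \<Rightarrow> real" +
  assumes state_space: "\<And>t \<omega>. t \<ge> 0 \<Longrightarrow> \<omega> \<in> space M \<Longrightarrow> X t \<omega> \<in> V"
    and random_vector: "\<And>t. t \<ge> 0 \<Longrightarrow> X t \<in> measurable M (\<Pi>\<^sub>M i\<in>{1..k}. borel)"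
    and start: "AE \<omega> in M. X 0 \<omega> = x"
    and continuous_paths: "AE \<omega> in M. \<forall>i\<in>{1..k}. continuous_on {0..} (\<lambda>t. X t \<omega> i)"
    and independent_increments:
      "\<And>(n::nat) \<tau>. 0 \<le> \<tau> 0 \<Longrightarrow> (\<And>j. j < n \<Longrightarrow> \<tau> j \<le> \<tau> (Suc j)) \<Longrightarrow>
         indep_vars (\<lambda>_. \<Pi>\<^sub>M i\<in>{1..k}. borel)
           (\<lambda>j \<omega>. \<lambda>i\<in>{1..k}. X (\<tau> (Suc j)) \<omega> i - X (\<tau> j) \<omega> i) {..<n}"
    and gaussian_increments:
      "\<And>s t v. 0 \<le> s \<Longrightarrow> s < t \<Longrightarrow> v \<in> V \<Longrightarrow> (\<Sum>i=1..k. (v i)\<^sup>2) \<noteq> 0 \<Longrightarrow>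
         distributed M lborel (\<lambda>\<omega>. \<Sum>i=1..k. v i * (X t \<omega> i - X s \<omega> i))
           (normal_density 0 (sqrt ((t - s) * (\<Sum>i=1..k. (v i)\<^sup>2))))"

text \<open>Infinite if the path never leaves \<open>A\<close>.\<close>

definition exit_time :: "'s set \<Rightarrow> (real \<Rightarrow> 'w \<Rightarrow> 's) \<Rightarrow> 'w \<Rightarrow> ennreal" where
  "exit_time A X \<omega> = (INF t\<in>{t. 0 \<le> t \<and> X t \<omega> \<notin> A}. ennreal t)"

definition P2 :: "nat \<Rightarrow> nat set set set" where
  "P2 k = {\<pi>. partition_on {1..k} \<pi> \<and> (\<forall>B\<in>\<pi>. card B = 1 \<or> card B = 2) \<and>
              card {B \<in> \<pi>. card B = 1} = (if even k then 0 else 1)}"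

definition pairs :: "nat set set \<Rightarrow> (nat \<times> nat) set" where
  "pairs \<pi> = {(i, j). i < j \<and> {i, j} \<in> \<pi>}"

text \<open>For the crossing number a singlet \<open>{s}\<close> is replaced by the pair of \<open>s\<close> and the additional point
  \<open>0\<close>; there is no singlet when \<open>k\<close> is even. Requiring \<open>i < i'\<close> counts each unordered pair of
  crossing blocks once.\<close>

definition arcs :: "nat set set \<Rightarrow> (nat \<times> nat) set" where
  "arcs \<pi> = pairs \<pi> \<union> {(0, s) |s. {s} \<in> \<pi>}"

definition crossings :: "nat set set \<Rightarrow> nat" where
  "crossings \<pi> = card {((i, j), (i', j')). (i, j) \<in> arcs \<pi> \<and> (i', j') \<in> arcs \<pi> \<and>
                        i < i' \<and> i' < j \<and> j < j'}"

definition frequencies :: "nat \<Rightarrow> nat set" where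
  "frequencies k = (if even k then {l. odd l} else {l. even l})"

definition sine_factor :: "nat \<Rightarrow> real \<Rightarrow> real" where
  "sine_factor l y = (if l = 0 then pi * y / 2 else 1 / real l * sin (pi * real l * y))"

text \<open>The arguments \<open>y\<close> form a family over a finite set \<open>S\<close> of \<open>p = card S\<close> elements rather than over
  \<open>{1..p}\<close>; the function is symmetric, so no enumeration of \<open>S\<close> is needed. The parity of \<open>k\<close> selects
  the frequency set.\<close>

definition F_tilde :: "nat \<Rightarrow> 'i set \<Rightarrow> ('i \<Rightarrow> real) \<Rightarrow> real" where
  "F_tilde k S y = 2 ^ (2 * card S) / pi ^ (card S + 2) *
     (\<Sum>\<^sub>\<infinity>l\<in>(S \<rightarrow>\<^sub>E frequencies k) - {\<lambda>s\<in>S. 0}.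
        1 / (\<Sum>s\<in>S. (real (l s))\<^sup>2) * (\<Prod>s\<in>S. sine_factor (l s) (y s)))"

end

theory Submission
  imports Defs
begin

text \<open>Let \<open>h t\<close> be the solution of the heat equation on \<open>\<real>\<close> started from the square wave that is \<open>1\<close>
  on \<open>(0, 1)\<close> and changes sign at each integer (for even \<open>k\<close>), or from the sawtooth \<open>1 - 2y\<close> of
  period \<open>1\<close> (for odd \<open>k\<close>). The signed sum of \<open>\<Prod> h t (x\<^sub>i - x\<^sub>j)\<close> over \<open>P\<^sub>2(k)\<close> is a Pfaffian, bordered by
  a row of ones when \<open>k\<close> is odd. It vanishes on the walls of the alcove, where two of its rows are
  proportional, and tends to \<open>1\<close> inside the alcove as \<open>t \<rightarrow> 0\<close>. Run backwards in time along the
  Brownian path it is a martingale, so by optional stopping it equals the probability that the path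
  has not left the alcove by time \<open>t\<close>. Integrating over \<open>t\<close> gives the expected exit time. For odd
  \<open>k\<close> the terms of the series in which some but not all frequencies are \<open>0\<close> come from replacing the
  sawtooth by the constant \<open>1\<close>; this adds a multiple of the border row to each row and leaves the
  Pfaffian unchanged.

  Optional stopping is only needed in discrete time: the path is observed on a grid and stopped as
  soon as a gap is at most \<open>\<delta>\<close>, where the value is \<open>O(\<delta>)\<close>. Only the laws of the increments
  in single directions are available, so the martingale property is checked on products of
  sines, which are combinations of plane waves.\<close>

section \<open>Pfaffians of lists\<close>

text \<open>A product over disjoint pairs of modes \<open>sin (pi * n * (x i - x j))\<close> is
  damped as a whole: its pairs have orthogonal frequency vectors, and a difference of two
  coordinates has variance \<open>2 * t\<close>, so each mode decays like
  \<open>exp (- (pi^2 * n^2 * t))\<close>. All these vectors have coordinate sum 0, hence belong to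
  either choice of \<open>V\<close>, and both spaces are treated at once. The constant of
  \<open>F_tilde\<close> is made of one Fourier coefficient \<open>4 / pi\<close> per pair and the
  time integral of the decay. The zero tuple would be constant in time and not integrable; its
  signed sum over \<open>P2 k\<close> vanishes, because it is a shift of the zero matrix.

  The initial wave jumps at the integers, so no Lipschitz bound is uniform down to time 0. Optional
  stopping therefore ends with time \<open>e > 0\<close> still to go, and the limits are taken in
  the order grid, \<open>\<delta>\<close>, \<open>e\<close>. The last limit needs a bound on the
  wave that is uniform in time; absolute convergence does not give it, summation by parts
  does.\<close>

definition del :: "nat \<Rightarrow> 'a list \<Rightarrow> 'a list" where
  "del j xs = take j xs @ drop (Suc j) xs"

lemma length_del: "j < length xs \<Longrightarrow> length (del j xs) = length xs - 1"
  by (simp add: del_def)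

lemma length_del_le: "length (del j xs) \<le> length xs"
  by (simp add: del_def)

lemma nth_del: "j < length xs \<Longrightarrow> i < length xs - 1 \<Longrightarrow> del j xs ! i = (if i < j then xs ! i else xs ! Suc i)"
  by (auto simp: del_def nth_append min_def)

lemma set_del_subset: "set (del j xs) \<subseteq> set xs"
  by (auto simp: del_def dest: in_set_takeD in_set_dropD)

lemma del_del:
  assumes "m < i" "i < length xs"
  shows "del m (del i xs) = del (i - 1) (del m xs)"
  using assms by (intro nth_equalityI) (auto simp: length_del nth_del)

lemma del_append: "del j (us @ vs) = (if j < length us then del j us @ vs else us @ del (j - length us) vs)"
  by (auto simp: del_def Suc_diff_le)

lemma del_Cons_0 [simp]: "del 0 (x # xs) = xs"
  by (simp add: del_def)

lemma del_Cons_Suc [simp]: "del (Suc j) (x # xs) = x # del j xs"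
  by (simp add: del_def)

function pf :: "('a \<Rightarrow> 'a \<Rightarrow> real) \<Rightarrow> 'a list \<Rightarrow> real" where
  "pf a [] = 1"
| "pf a (x # xs) = (\<Sum>j<length xs. (- 1) ^ j * a x (xs ! j) * pf a (del j xs))"
  by pat_completeness auto
termination
  by (relation "Wellfounded.measure (\<lambda>(a, xs). length xs)") (auto simp: le_imp_less_Suc length_del_le)

lemma pf_cong:
  assumes "\<And>x y. x \<in> set xs \<Longrightarrow> y \<in> set xs \<Longrightarrow> a x y = b x y"
  shows "pf a xs = pf b xs"
  using assms
proof (induction xs rule: length_induct)
  case (1 xs)
  show ?case
  proof (cases xs)
    case (Cons x ys)
    have "pf a (del j ys) = pf b (del j ys)" for j
      using 1 set_del_subset[of j ys] length_del_le[of j ys] by (auto simp: Cons less_Suc_eq_le)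
    with 1(2) show ?thesis by (auto simp: Cons intro!: sum.cong)
  qed simp
qed

context
  fixes a :: "'a \<Rightarrow> 'a \<Rightarrow> real"
  assumes antisym: "\<And>x y. a x y = - a y x"
begin

text \<open>Expanding along \<open>x\<close> and then along \<open>y\<close> gives one term for each
  ordered pair of partners in \<open>vs\<close>. Exchanging \<open>x\<close> and \<open>y\<close>
  means choosing the same two partners in the other order, and the index shift caused by the first
  deletion flips the sign.\<close>

lemma pf_swap_front: "pf a (x # y # vs) = - pf a (y # x # vs)"
proof -
  define n where "n = length vs"
  define Q where "Q x y i m = (- 1) ^ (i + m) * a x (vs ! i) * a y (del i vs ! m) * pf a (del m (del i vs))"
    for x y i m
  have expand: "pf a (x # y # vs) =
      a x y * pf a vs - (\<Sum>(i, m)\<in>{..<n} \<times> {..<n - 1}. Q x y i m)" for x y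
  proof -
    have "pf a (x # y # vs) = a x y * pf a vs + (\<Sum>i<n. (- 1) ^ Suc i * a x (vs ! i) * pf a (y # del i vs))"
      by (subst pf.simps(2)) (simp add: n_def sum.lessThan_Suc_shift del: pf.simps sum.lessThan_Suc)
    also have "(\<Sum>i<n. (- 1) ^ Suc i * a x (vs ! i) * pf a (y # del i vs))
      = - (\<Sum>i<n. \<Sum>m<n - 1. Q x y i m)"
      by (auto simp: sum_negf[symmetric] sum_distrib_left Q_def length_del n_def power_add algebra_simps
           intro!: sum.cong)
    finally show ?thesis by (simp add: sum.cartesian_product)
  qed
  \<comment> \<open>\<open>(i, m)\<close> means: delete position \<open>i\<close>, then position
    \<open>m\<close> of what is left. \<open>?s\<close> names the same two entries deleted in the
    opposite order; it is an involution that changes the parity of \<open>i + m\<close>.\<close>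
  let ?s = "\<lambda>(i :: nat, m :: nat). if m < i then (m, i - 1) else (m + 1, i)"
  have "(\<Sum>(i, m)\<in>{..<n} \<times> {..<n - 1}. Q x y i m) = (\<Sum>(i, m)\<in>{..<n} \<times> {..<n - 1}. - Q y x i m)"
  proof (rule sum.reindex_bij_witness[of _ ?s ?s], goal_cases)
    case (5 b)
    obtain i m where b: "b = (i, m)" by (cases b)
    with 5 have im: "i < length vs" "m < length vs - 1" by (auto simp: n_def)
    show ?case
    proof (cases "m < i")
      case True
      then obtain i' where i': "i = Suc i'" by (cases i) auto
      have "Q x y i m = - Q y x m (i - 1)"
        using im True del_del[of m i vs] by (simp add: Q_def nth_del i' add.commute[of m])
      then show ?thesis using True by (simp add: b)
    next
      case False
      have "Q x y i m = - Q y x (m + 1) i"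
        using im False del_del[of i "Suc m" vs] by (simp add: Q_def nth_del add.commute[of m])
      then show ?thesis using False by (simp add: b)
    qed
  qed (auto split: if_splits)
  then show ?thesis
    unfolding expand using antisym[of x y] by (simp add: sum_negf case_prod_unfold)
qed

text \<open>By expansion along the first entry of \<open>us\<close>: the terms whose partner is
  \<open>x\<close> or \<open>y\<close> exchange places and have adjacent signs, all other terms keep
  both entries and change sign by induction.\<close>

lemma pf_swap: "pf a (us @ x # y # vs) = - pf a (us @ y # x # vs)"
proof (induction "length us + length vs" arbitrary: us vs rule: less_induct)
  case less
  show ?case
  proof (cases us)
    case Nil
    then show ?thesis by (simp add: pf_swap_front[of x y vs] del: pf.simps)
  next
    case (Cons u us')
    let ?q = "length us'"
    let ?f = "\<lambda>x y j. (- 1) ^ j * a u ((us' @ x # y # vs) ! j) * pf a (del j (us' @ x # y # vs))"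
    let ?s = "\<lambda>j. if j = ?q then Suc ?q else if j = Suc ?q then ?q else j"
    let ?n = "Suc (Suc (?q + length vs))"
    have "sum (?f x y) {..<?n} = (\<Sum>j<?n. - ?f y x j)"
    proof (rule sum.reindex_bij_witness[of _ ?s ?s], goal_cases)
      case (5 j)
      consider "j < ?q" | "j = ?q" | "j = Suc ?q" | "j > Suc ?q" by linarith
      then show ?case
      proof cases
        case 1
        have "pf a (del j us' @ x # y # vs) = - pf a (del j us' @ y # x # vs)"
          using 1 by (intro less) (simp add: length_del Cons)
        with 1 show ?thesis by (simp add: del_append nth_append)
      next
        case 4
        then obtain r where r: "j = ?q + Suc (Suc r)" by (metis add_Suc_right less_imp_Suc_add add_Suc)
        with 5 have "r < length vs" by auto
        have "pf a (us' @ x # y # del r vs) = - pf a (us' @ y # x # del r vs)"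
          using \<open>r < length vs\<close> by (intro less) (simp add: length_del Cons)
        then show ?thesis by (simp add: r del_append nth_append)
      qed (simp_all add: del_append nth_append)
    qed (auto split: if_splits)
    then show ?thesis by (simp add: Cons sum_negf)
  qed
qed

text \<open>Swaps bring the two equal entries next to each other, where one more swap shows that the
  Pfaffian is its own negative.\<close>

lemma pf_repeated: "pf a (us @ x # ws @ x # vs) = 0"
proof (induction ws arbitrary: us)
  case Nil
  then show ?case using pf_swap[of us x x vs] by simp
next
  case (Cons w ws)
  then show ?case using pf_swap[of us x w "ws @ x # vs"] Cons[of "us @ [w]"] by simp
qed

lemma pf_move_front: "pf a (us @ x # vs) = (- 1) ^ length us * pf a (x # us @ vs)"
proof (induction us arbitrary: vs rule: rev_induct)
  case (snoc u us)
  then show ?case using pf_swap[of us u x vs] snoc[of "u # vs"] by simp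
qed simp

lemma pf_Cons_mem: "x \<in> set xs \<Longrightarrow> pf a (x # xs) = 0"
  using pf_repeated[of "[]" x] by (metis append_Nil in_set_conv_decomp)

end

text \<open>Once \<open>p\<close> stands first, expansion along it gives \<open>c\<close> times the
  Pfaffian with \<open>q\<close> in its place, and \<open>q\<close> then occurs twice. As
  \<open>z\<close> may be \<open>q\<close>, the hypothesis includes
  \<open>a p q = c * a q q = 0\<close>; on the walls of the alcove this holds because the wave
  vanishes at integers.\<close>

lemma pf_proportional_rows:
  assumes antisym: "\<And>x y. a x y = - a y x"
    and "p \<in> set xs" "q \<in> set xs" "p \<noteq> q" and rows: "\<And>z. z \<in> set xs \<Longrightarrow> a p z = c * a q z"
  shows "pf a xs = 0"
proof -
  obtain us vs where xs: "xs = us @ p # vs" using assms(2) by (auto simp: in_set_conv_decomp)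
  define r where "r = us @ vs"
  have q: "q \<in> set r" using assms(3,4) xs by (auto simp: r_def)
  have r: "set r \<subseteq> set xs" by (auto simp: r_def xs)
  have "pf a (p # r) = (\<Sum>j<length r. c * ((- 1) ^ j * a q (r ! j) * pf a (del j r)))"
  proof (unfold pf.simps, intro sum.cong refl, goal_cases)
    case (1 j)
    then have "r ! j \<in> set xs" using r nth_mem[of j r] by auto
    then show ?case by (simp add: rows)
  qed
  also have "\<dots> = c * pf a (q # r)" by (simp add: sum_distrib_left)
  also have "pf a (q # r) = 0" by (rule pf_Cons_mem[OF antisym q])
  finally show ?thesis
    unfolding xs pf_move_front[of a us p vs, OF antisym] by (simp add: r_def)
qed

text \<open>Only the entries paired with \<open>u\<close> change. With \<open>u\<close> in front
  they appear in the first expansion alone, and the extra part is \<open>c\<close> times a Pfaffian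
  containing \<open>w\<close> twice.\<close>

lemma pf_add_row:
  assumes antisym: "\<And>x y. b x y = - b y x"
    and "distinct xs" "u \<in> set xs" "w \<in> set xs" "u \<noteq> w"
    and b': "b' = (\<lambda>i j. b i j + (if i = u then c * b w j else 0) - (if j = u then c * b w i else 0))"
  shows "pf b' xs = pf b xs"
proof -
  have antisym': "b' x y = - b' y x" for x y
    using antisym[of x y] by (simp add: b')
  obtain us vs where xs: "xs = us @ u # vs"
    using assms(3) by (auto simp: in_set_conv_decomp)
  define r where "r = us @ vs"
  have u: "u \<notin> set r" and w: "w \<in> set r" using assms(2-5) xs by (auto simp: r_def)
  have "pf b' (u # r) = (\<Sum>j<length r. (- 1) ^ j * b u (r ! j) * pf b (del j r)
      + c * ((- 1) ^ j * b w (r ! j) * pf b (del j r)))"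
  proof (unfold pf.simps, intro sum.cong refl, goal_cases)
    case (1 j)
    have "r ! j \<noteq> u" using u 1 by (metis lessThan_iff nth_mem)
    moreover have "pf b' (del j r) = pf b (del j r)"
      using u set_del_subset[of j r] by (intro pf_cong) (auto simp: b')
    ultimately show ?case by (simp add: b' algebra_simps)
  qed
  also have "\<dots> = pf b (u # r) + c * pf b (w # r)"
    by (simp add: sum.distrib sum_distrib_left)
  also have "pf b (w # r) = 0"
    by (rule pf_Cons_mem[OF antisym w])
  finally show ?thesis
    unfolding xs pf_move_front[of b us u vs, OF antisym] pf_move_front[of b' us u vs, OF antisym']
    by (simp add: r_def del: pf.simps)
qed

text \<open>Iterates \<open>pf_add_row\<close>. When row \<open>w\<close> is a border of ones, the
  shift is by \<open>z i - z j\<close>, so any such term can be absorbed.\<close>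

lemma pf_shift:
  assumes antisym: "\<And>x y. a x y = - a y x"
    and xs: "distinct xs" "w \<in> set xs" and z: "z w = 0"
  shows "pf (\<lambda>i j. a i j + z i * a w j - z j * a w i) xs = pf a xs"
proof -
  \<comment> \<open>Rows are treated one at a time, \<open>U\<close> being those done so far. Row
    \<open>w\<close> is the same at every stage, because \<open>w\<close> is never in
    \<open>U\<close> and \<open>a w w = 0\<close>.\<close>
  define zz where "zz U i = (if i \<in> U then z i else 0)" for U i
  have aww: "a w w = 0" using antisym[of w w] by simp
  have "pf (\<lambda>i j. a i j + zz U i * a w j - zz U j * a w i) xs = pf a xs"
    if "finite U" "U \<subseteq> set xs - {w}" for U
    using that
  proof (induction U rule: finite_induct)
    case empty
    then show ?case by (simp add: zz_def)
  next
    case (insert u U)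
    have "pf (\<lambda>i j. a i j + zz (insert u U) i * a w j - zz (insert u U) j * a w i) xs
      = pf (\<lambda>i j. a i j + zz U i * a w j - zz U j * a w i) xs"
    proof (rule pf_add_row[where u = u and w = w and c = "z u"])
      show "a x y + zz U x * a w y - zz U y * a w x = - (a y x + zz U y * a w x - zz U x * a w y)" for x y
        using antisym[of x y] by simp
    qed (use insert xs aww in \<open>auto simp: zz_def fun_eq_iff\<close>)
    with insert show ?case by simp
  qed
  from this[of "set xs - {w}"]
  have "pf (\<lambda>i j. a i j + zz (set xs - {w}) i * a w j - zz (set xs - {w}) j * a w i) xs = pf a xs"
    by simp
  moreover have "pf (\<lambda>i j. a i j + zz (set xs - {w}) i * a w j - zz (set xs - {w}) j * a w i) xs
      = pf (\<lambda>i j. a i j + z i * a w j - z j * a w i) xs"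
    using z by (intro pf_cong) (auto simp: zz_def)
  ultimately show ?thesis by simp
qed

lemma sorted_wrt_del: "sorted_wrt P xs \<Longrightarrow> sorted_wrt P (del j xs)"
proof (induction xs arbitrary: j)
  case (Cons x xs)
  then show ?case using set_del_subset[of _ xs] by (cases j) auto
qed (simp add: del_def)

lemma alternating_sum_odd: "(\<Sum>j<Suc (2 * n). (- 1) ^ j) = (1 :: real)"
  by (induction n) auto

text \<open>Every expansion is an alternating sum of an odd number of ones.\<close>

lemma pf_ones:
  assumes "sorted_wrt (\<lambda>i j. a i j = 1) xs" "even (length xs)"
  shows "pf a xs = 1"
  using assms
proof (induction xs rule: length_induct)
  case (1 xs)
  show ?case
  proof (cases xs)
    case (Cons x ys)
    then obtain n where n: "length ys = Suc (2 * n)"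
      using 1(3) by (auto elim!: oddE)
    have "pf a (del j ys) = 1" if "j < length ys" for j
      using 1(1)[rule_format, of "del j ys"] 1(2) that n by (simp add: Cons length_del sorted_wrt_del)
    then have "pf a xs = (\<Sum>j<length ys. (- 1) ^ j)"
      using 1(2) by (simp add: Cons)
    then show ?thesis by (simp only: n alternating_sum_odd)
  qed simp
qed

section \<open>Pairings and Pfaffians\<close>

text \<open>Arcs are stored as increasing pairs, so that the point \<open>0\<close> attached to a
  singlet is an ordinary end point and both parities of \<open>k\<close> lead to perfect
  matchings.\<close>

definition matchings :: "nat set \<Rightarrow> (nat \<times> nat) set set" where
  "matchings S = {m. m \<subseteq> {(i, j). i \<in> S \<and> j \<in> S \<and> i < j} \<and> (\<forall>s\<in>S. \<exists>!p. p \<in> m \<and> (s = fst p \<or> s = snd p))}"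

definition crossing_pairs :: "(nat \<times> nat) set \<Rightarrow> ((nat \<times> nat) \<times> (nat \<times> nat)) set" where
  "crossing_pairs m = {((i, j), (i', j')). (i, j) \<in> m \<and> (i', j') \<in> m \<and> i < i' \<and> i' < j \<and> j < j'}"

lemma matchingsD:
  assumes "m \<in> matchings S" "(i, j) \<in> m"
  shows "i \<in> S" "j \<in> S" "i < j"
  using assms by (auto simp: matchings_def)

lemma matchings_ex: "m \<in> matchings S \<Longrightarrow> s \<in> S \<Longrightarrow> \<exists>p\<in>m. s = fst p \<or> s = snd p"
  unfolding matchings_def by blast

lemma matchings_unique:
  assumes "m \<in> matchings S" "p \<in> m" "q \<in> m" "{fst p, snd p} \<inter> {fst q, snd q} \<noteq> {}"
  shows "p = q"
proof -
  from assms(4) obtain s where s: "s = fst p \<or> s = snd p" "s = fst q \<or> s = snd q" by auto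
  have "s \<in> S" using s matchingsD[OF assms(1), of "fst p" "snd p"] assms(2) by auto
  then have "\<exists>!p. p \<in> m \<and> (s = fst p \<or> s = snd p)"
    using assms(1) by (simp add: matchings_def)
  then show ?thesis using s assms(2,3) by blast
qed

lemma finite_matching: "finite S \<Longrightarrow> m \<in> matchings S \<Longrightarrow> finite m"
  by (rule finite_subset[of _ "S \<times> S"]) (auto simp: matchings_def)

lemma finite_matchings: "finite S \<Longrightarrow> finite (matchings S)"
  by (rule finite_subset[of _ "Pow (S \<times> S)"]) (auto simp: matchings_def)

lemma matchings_empty: "matchings {} = {{}}"
  by (auto simp: matchings_def)

lemma matchingsI:
  assumes "\<And>i j. (i, j) \<in> m \<Longrightarrow> i \<in> S \<and> j \<in> S \<and> i < j"
    and "\<And>s. s \<in> S \<Longrightarrow> \<exists>p\<in>m. s = fst p \<or> s = snd p"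
    and "\<And>p q. p \<in> m \<Longrightarrow> q \<in> m \<Longrightarrow> {fst p, snd p} \<inter> {fst q, snd q} \<noteq> {} \<Longrightarrow> p = q"
  shows "m \<in> matchings S"
proof -
  have "\<exists>!p. p \<in> m \<and> (s = fst p \<or> s = snd p)" if s: "s \<in> S" for s
  proof -
    obtain p where p: "p \<in> m" "s = fst p \<or> s = snd p" using assms(2)[OF s] by blast
    show ?thesis
    proof (rule ex1I[of _ p])
      fix q assume "q \<in> m \<and> (s = fst q \<or> s = snd q)"
      then show "q = p" using p by (intro assms(3)) auto
    qed (use p in simp)
  qed
  then show ?thesis using assms(1) by (auto simp: matchings_def)
qed

text \<open>Splitting off the arc of the least point is the recursion that \<open>pf\<close>
  performs when it expands along the first row.\<close>

lemma matchings_insert_min: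
  assumes i0: "i0 \<notin> R" "\<And>r. r \<in> R \<Longrightarrow> i0 < r"
  shows "bij_betw (\<lambda>(y, m). insert (i0, y) m) (SIGMA y:R. matchings (R - {y})) (matchings (insert i0 R))"
    (is "bij_betw ?f ?A ?B")
proof (rule bij_betw_imageI)
  show "inj_on ?f ?A"
  proof (rule inj_onI, clarify)
    fix y m y' m'
    assume *: "y \<in> R" "m \<in> matchings (R - {y})" "y' \<in> R" "m' \<in> matchings (R - {y'})"
      and eq: "insert (i0, y) m = insert (i0, y') m'"
    have n: "(i0, z) \<notin> m" "(i0, z) \<notin> m'" for z
      using matchingsD(1)[OF *(2)] matchingsD(1)[OF *(4)] i0 by blast+
    have "y = y'" using eq n by (metis insertE insertI1 prod.inject)
    moreover have "m = m'" using eq n \<open>y = y'\<close> by (simp add: insert_ident)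
    ultimately show "y = y' \<and> m = m'" by simp
  qed
  show "?f ` ?A = ?B"
  proof (intro equalityI subsetI)
    fix n assume "n \<in> ?f ` ?A"
    then obtain y m where ym: "y \<in> R" "m \<in> matchings (R - {y})" "n = insert (i0, y) m" by auto
    have D: "fst p \<in> R" "snd p \<in> R" "fst p \<noteq> y" "snd p \<noteq> y" "fst p \<noteq> i0" "snd p \<noteq> i0" if "p \<in> m" for p
      using matchingsD[OF ym(2), of "fst p" "snd p"] that i0 by auto
    show "n \<in> ?B"
      unfolding ym(3)
    proof (rule matchingsI, goal_cases)
      case (1 i j)
      then show ?case using ym(1) i0 matchingsD[OF ym(2), of i j] by auto
    next
      case (2 s)
      show ?case
      proof (cases "s = i0 \<or> s = y")
        case False
        then have "s \<in> R - {y}" using 2 by auto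
        from matchings_ex[OF ym(2) this] show ?thesis by auto
      qed auto
    next
      case (3 p q)
      then show ?case using D[of p] D[of q] matchings_unique[OF ym(2), of p q] by auto
    qed
  next
    fix n assume n: "n \<in> ?B"
    from matchings_ex[OF n, of i0] obtain p where p: "p \<in> n" "i0 = fst p \<or> i0 = snd p" by auto
    have pR: "fst p < snd p" "fst p \<in> insert i0 R" "snd p \<in> insert i0 R"
      using matchingsD[OF n, of "fst p" "snd p"] p by auto
    have fp: "fst p = i0" using p pR i0(2)[of "fst p"] by auto
    define y where "y = snd p"
    have py: "p = (i0, y)" using fp by (auto simp: y_def)
    have y: "y \<in> R" using pR fp by (auto simp: y_def)
    have "n - {p} \<in> matchings (R - {y})"
    proof (rule matchingsI, goal_cases)
      case (1 i j)
      then have "{fst p, snd p} \<inter> {fst (i, j), snd (i, j)} = {}"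
        using matchings_unique[OF n p(1), of "(i, j)"] by blast
      then have "i \<noteq> i0 \<and> j \<noteq> i0 \<and> i \<noteq> y \<and> j \<noteq> y" by (auto simp: py)
      then show ?case using matchingsD[OF n, of i j] 1 by auto
    next
      case (2 s)
      then obtain q where q: "q \<in> n" "s = fst q \<or> s = snd q" using matchings_ex[OF n, of s] by auto
      moreover have "q \<noteq> p" using q 2 i0 by (auto simp: py)
      ultimately show ?case by auto
    next
      case (3 p q)
      then show ?case using matchings_unique[OF n, of p q] by auto
    qed
    then have "(y, n - {p}) \<in> ?A" using y by auto
    moreover have "n = ?f (y, n - {p})" using p(1) by (auto simp: py)
    ultimately show "n \<in> ?f ` ?A" by blast
  qed
qed

text \<open>The arcs separating \<open>y\<close> from infinity contribute one endpoint below \<open>y\<close>, all others none or two.\<close>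

lemma crossing_sign_insert_min:
  assumes m: "m \<in> matchings (R - {y})" and R: "finite R" "y \<in> R" "\<And>r. r \<in> R \<Longrightarrow> i0 < r"
  shows "(- 1 :: real) ^ card (crossing_pairs (insert (i0, y) m))
    = (- 1) ^ card {s \<in> R. s < y} * (- 1) ^ card (crossing_pairs m)"
proof -
  have fm: "finite m" using R m by (intro finite_matching[of "R - {y}"]) auto
  have D: "fst p \<in> R" "snd p \<in> R" "fst p \<noteq> y" "snd p \<noteq> y" "i0 < fst p" "fst p < snd p" if "p \<in> m" for p
    using matchingsD[OF m, of "fst p" "snd p"] that R by auto
  define C where "C = {p \<in> m. fst p < y \<and> y < snd p}"
  define L where "L = {p \<in> m. snd p < y}"
  have fin: "finite C" "finite L" "finite (crossing_pairs m)"
    using fm by (auto simp: C_def L_def crossing_pairs_def intro: finite_subset[of _ "m \<times> m"])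
  have "crossing_pairs (insert (i0, y) m) = crossing_pairs m \<union> Pair (i0, y) ` C"
    using D by (fastforce simp: crossing_pairs_def C_def)
  moreover have "crossing_pairs m \<inter> Pair (i0, y) ` C = {}"
    using D by (fastforce simp: crossing_pairs_def C_def)
  ultimately have c1: "card (crossing_pairs (insert (i0, y) m)) = card (crossing_pairs m) + card C"
    using fin by (simp add: card_Un_disjoint card_image inj_on_def)
  have "{s \<in> R. s < y} = fst ` (C \<union> L) \<union> snd ` L" (is "?l = ?r")
  proof (intro equalityI subsetI)
    fix s assume s: "s \<in> ?l"
    then obtain p where p: "p \<in> m" "s = fst p \<or> s = snd p" using matchings_ex[OF m, of s] by auto
    with s D[OF p(1)] show "s \<in> ?r"
      by (cases "snd p < y") (auto simp: C_def L_def)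
  next
    fix s assume "s \<in> ?r"
    then obtain p where p: "p \<in> m" "p \<in> C \<and> s = fst p \<or> p \<in> L \<and> (s = fst p \<or> s = snd p)"
      by (auto simp: C_def L_def)
    with D[OF p(1)] show "s \<in> ?l" by (auto simp: C_def L_def)
  qed
  moreover have "fst ` (C \<union> L) \<inter> snd ` L = {}"
  proof (rule ccontr)
    assume "fst ` (C \<union> L) \<inter> snd ` L \<noteq> {}"
    then obtain p q where "p \<in> C \<union> L" "q \<in> L" "fst p = snd q" by auto
    then have "p \<in> m" "q \<in> m" "{fst p, snd p} \<inter> {fst q, snd q} \<noteq> {}" by (auto simp: C_def L_def)
    then have "p = q" by (rule matchings_unique[OF m])
    with \<open>fst p = snd q\<close> D(6)[OF \<open>p \<in> m\<close>] show False by simp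
  qed
  moreover have "inj_on fst (C \<union> L)"
    by (rule inj_onI, rule matchings_unique[OF m]) (auto simp: C_def L_def)
  moreover have "inj_on snd L"
    by (rule inj_onI, rule matchings_unique[OF m]) (auto simp: L_def)
  moreover have "C \<inter> L = {}" by (auto simp: C_def L_def)
  ultimately have "card {s \<in> R. s < y} = card C + 2 * card L"
    using fin by (simp add: card_Un_disjoint card_image)
  then show ?thesis by (simp add: c1 power_add power_mult)
qed

lemma card_less_nth_sorted:
  fixes xs :: "nat list"
  assumes "sorted_wrt (<) xs" "j < length xs"
  shows "card {s \<in> set xs. s < xs ! j} = j"
proof -
  have "{s \<in> set xs. s < xs ! j} = (!) xs ` {..<j}"
  proof (intro equalityI subsetI)
    fix s assume "s \<in> {s \<in> set xs. s < xs ! j}"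
    then obtain i where i: "i < length xs" "s = xs ! i" "xs ! i < xs ! j" by (auto simp: in_set_conv_nth)
    have "i < j"
    proof (rule ccontr)
      assume "\<not> i < j"
      then have "i = j \<or> j < i" by auto
      then show False using i assms sorted_wrt_nth_less[OF assms(1), of j i] by auto
    qed
    then show "s \<in> (!) xs ` {..<j}" using i by auto
  next
    fix s assume "s \<in> (!) xs ` {..<j}"
    then show "s \<in> {s \<in> set xs. s < xs ! j}"
      using assms sorted_wrt_nth_less[OF assms(1), of _ j] by auto
  qed
  moreover have "inj_on ((!) xs) {..<j}"
    using assms strict_sorted_imp_sorted by (intro inj_on_nth) (auto simp: strict_sorted_iff)
  ultimately show ?thesis by (simp add: card_image)
qed

lemma set_del_distinct: "distinct xs \<Longrightarrow> j < length xs \<Longrightarrow> set (del j xs) = set xs - {xs ! j}"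
proof -
  assume *: "distinct xs" "j < length xs"
  have xs: "xs = take j xs @ xs ! j # drop (Suc j) xs" using * by (simp add: id_take_nth_drop)
  then have "set xs = set (take j xs) \<union> {xs ! j} \<union> set (drop (Suc j) xs)"
    by (metis Un_insert_left Un_insert_right list.simps(15) set_append sup_bot.right_neutral)
  moreover have "xs ! j \<notin> set (take j xs) \<union> set (drop (Suc j) xs)"
    using * by (metis Un_iff distinct_append distinct.simps(2) disjoint_iff list.set_intros(1) xs)
  ultimately show ?thesis by (auto simp: del_def)
qed

text \<open>In the sorted list of the remaining points the partner of the least point has position
  \<open>j\<close> exactly when \<open>j\<close> of them lie below it. So the sign
  \<open>(- 1) ^ j\<close> of the expansion is the one split off by
  \<open>crossing_sign_insert_min\<close>.\<close>

lemma sum_matchings_eq_pf: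
  assumes "finite S"
  shows "(\<Sum>m\<in>matchings S. (- 1) ^ card (crossing_pairs m) * (\<Prod>(i, j)\<in>m. a i j)) = pf a (sorted_list_of_set S)"
  using assms
proof (induction "card S" arbitrary: S rule: less_induct)
  case less
  show ?case
  proof (cases "S = {}")
    case True
    have "crossing_pairs {} = {}" by (auto simp: crossing_pairs_def)
    with True show ?thesis by (simp add: matchings_empty)
  next
    case False
    define i0 where "i0 = Min S"
    define R where "R = S - {i0}"
    define xs where "xs = sorted_list_of_set R"
    have fR: "finite R" using less by (simp add: R_def)
    have S: "S = insert i0 R" using Min_in[OF less(2) False] by (auto simp: R_def i0_def)
    have i0: "i0 \<notin> R" "\<And>r. r \<in> R \<Longrightarrow> i0 < r" 
      using less(2) False by (auto simp: R_def i0_def order.strict_iff_order)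
    have xs: "sorted_wrt (<) xs" "distinct xs" "set xs = R" "length xs = card R"
      using fR by (simp_all add: xs_def)
    let ?w = "\<lambda>m. (- 1) ^ card (crossing_pairs m) * (\<Prod>(i, j)\<in>m. a i j)"
    have "(\<Sum>m\<in>matchings S. ?w m) = (\<Sum>(y, m)\<in>(SIGMA y:R. matchings (R - {y})). ?w (insert (i0, y) m))"
      unfolding S by (subst sum.reindex_bij_betw[OF matchings_insert_min[OF i0], symmetric])
        (auto simp: case_prod_unfold)
    also have "\<dots> = (\<Sum>y\<in>R. \<Sum>m\<in>matchings (R - {y}). ?w (insert (i0, y) m))"
      using fR by (subst sum.Sigma) (auto intro: finite_matchings)
    also have "\<dots> = (\<Sum>y\<in>R. (- 1) ^ card {s \<in> R. s < y} * a i0 y * (\<Sum>m\<in>matchings (R - {y}). ?w m))"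
    proof (unfold sum_distrib_left, intro sum.cong refl, goal_cases)
      case (1 y m)
      have "(i0, y) \<notin> m" using matchingsD(1)[OF 1(2), of i0 y] i0 by auto
      moreover have "finite m" using 1 fR by (intro finite_matching[of "R - {y}"]) auto
      ultimately show ?case using crossing_sign_insert_min[OF 1(2) fR 1(1) i0(2)] by simp
    qed
    also have "\<dots> = (\<Sum>y\<in>R. (- 1) ^ card {s \<in> R. s < y} * a i0 y * pf a (sorted_list_of_set (R - {y})))"
      using fR by (intro sum.cong refl arg_cong2[where f = "(*)"] less)
        (auto simp: S i0 card_insert_if intro!: psubset_card_mono)
    also have "\<dots> = (\<Sum>j<length xs. (- 1) ^ j * a i0 (xs ! j) * pf a (del j xs))"
    proof -
      have b: "bij_betw ((!) xs) {..<length xs} R" using xs by (intro bij_betw_nth) auto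
      have d: "sorted_list_of_set (R - {xs ! j}) = del j xs" if j: "j < length xs" for j
      proof -
        have "set (del j xs) = R - {xs ! j}" using set_del_distinct[OF xs(2) j] xs by simp
        moreover have "length (del j xs) = card (R - {xs ! j})"
          using j xs fR nth_mem[OF j] by (simp add: length_del)
        ultimately show ?thesis
          using sorted_wrt_del[OF xs(1)] fR sorted_list_of_set_unique[of "R - {xs ! j}" "del j xs"] by simp
      qed
      show ?thesis
        unfolding sum.reindex_bij_betw[OF b, symmetric]
        using card_less_nth_sorted[OF xs(1)] xs(3) d by (intro sum.cong refl) simp
    qed
    also have "\<dots> = pf a (i0 # xs)" by simp
    also have "i0 # xs = sorted_list_of_set S"
      using less(2) False by (simp add: sorted_list_of_set_nonempty xs_def i0_def R_def)
    finally show ?thesis .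
  qed
qed

section \<open>Pair partitions as perfect matchings of the arc points\<close>

definition arc_points :: "nat \<Rightarrow> nat set" where
  "arc_points k = (if even k then {1..k} else {0..k})"

lemma P2_blockE:
  assumes "\<pi> \<in> P2 k" "B \<in> \<pi>"
  obtains s where "B = {s}" "1 \<le> s" "s \<le> k" "odd k"
  | i j where "B = {i, j}" "i < j" "1 \<le> i" "j \<le> k"
proof -
  have p: "partition_on {1..k} \<pi>" and c: "card B = 1 \<or> card B = 2" 
    and o: "card {B \<in> \<pi>. card B = 1} = (if even k then 0 else 1)" using assms by (auto simp: P2_def)
  have f: "finite \<pi>" using p by (rule finite_elements[rotated]) simp
  have B: "B \<subseteq> {1..k}" using p assms(2) by (auto simp: partition_on_def)
  from c show thesis
  proof
    assume B1: "card B = 1"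
    then obtain s where s: "B = {s}" by (auto simp: card_1_singleton_iff)
    have "odd k"
    proof
      assume "even k"
      with o f have "{B \<in> \<pi>. card B = 1} = {}" by simp
      with B1 assms(2) show False by auto
    qed
    with s B show thesis using that(1) by auto
  next
    assume "card B = 2"
    then obtain i j where "B = {i, j}" "i \<noteq> j" by (auto simp: card_2_iff)
    with B show thesis using that(2)[of i j] that(2)[of j i] by (cases "i < j") (auto simp: insert_commute)
  qed
qed

lemma P2_disjoint: "\<pi> \<in> P2 k \<Longrightarrow> B \<in> \<pi> \<Longrightarrow> C \<in> \<pi> \<Longrightarrow> s \<in> B \<Longrightarrow> s \<in> C \<Longrightarrow> B = C"
  unfolding P2_def partition_on_def disjoint_def by blast

lemma arcs_iff:
  assumes "\<pi> \<in> P2 k"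
  shows "(i, j) \<in> arcs \<pi> \<longleftrightarrow> i < j \<and> {i, j} - {0} \<in> \<pi>"
proof -
  have n0: "0 \<notin> B" if "B \<in> \<pi>" for B
    by (rule P2_blockE[OF assms that]) auto
  have "i \<noteq> 0" if "{i, j} \<in> \<pi>" for i j using n0[OF that] by auto
  moreover have "j \<noteq> 0" if "{j} \<in> \<pi>" for j using n0[OF that] by auto
  ultimately show ?thesis by (cases "i = 0") (auto simp: arcs_def pairs_def)
qed

lemma arc_block: "i < j \<Longrightarrow> {i, j} - {0} = (if i = 0 then {j} else {i, j})" for i j :: nat
  by auto

text \<open>The inverse takes the end points of each arc and drops \<open>0\<close>, so the arc at
  \<open>0\<close> gives back the singlet.\<close>

lemma bij_betw_arcs: "bij_betw arcs (P2 k) (matchings (arc_points k))"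
proof (rule bij_betw_imageI)
  let ?b = "\<lambda>(i :: nat, j). {i, j} - {0}"
  have rec: "\<pi> = ?b ` arcs \<pi>" if \<pi>: "\<pi> \<in> P2 k" for \<pi>
  proof (intro equalityI subsetI)
    fix B assume B: "B \<in> \<pi>"
    from P2_blockE[OF \<pi> B] show "B \<in> ?b ` arcs \<pi>"
    proof cases
      case (1 s)
      then have "(0, s) \<in> arcs \<pi>" using B by (simp add: arcs_iff[OF \<pi>])
      moreover have "B = ?b (0, s)" using 1 by auto
      ultimately show ?thesis by (rule rev_image_eqI)
    next
      case (2 i j)
      then have "(i, j) \<in> arcs \<pi>" using B by (simp add: arcs_iff[OF \<pi>])
      moreover have "B = ?b (i, j)" using 2 by auto
      ultimately show ?thesis by (rule rev_image_eqI)
    qed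
  next
    fix B assume "B \<in> ?b ` arcs \<pi>"
    then obtain i j where "(i, j) \<in> arcs \<pi>" "B = {i, j} - {0}" by auto
    then show "B \<in> \<pi>" by (simp add: arcs_iff[OF \<pi>])
  qed
  show "inj_on arcs (P2 k)" by (rule inj_on_inverseI[where g = "\<lambda>m. ?b ` m"]) (rule rec[symmetric])
  show "arcs ` P2 k = matchings (arc_points k)"
  proof (intro equalityI subsetI)
    fix m assume "m \<in> arcs ` P2 k"
    then obtain \<pi> where \<pi>: "\<pi> \<in> P2 k" "m = arcs \<pi>" by auto
    have o: "card {B \<in> \<pi>. card B = 1} = (if even k then 0 else 1)"
      using \<pi>(1) unfolding P2_def by blast
    have U: "\<Union>\<pi> = {1..k}"
      using \<pi>(1) unfolding P2_def partition_on_def by blast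
    show "m \<in> matchings (arc_points k)"
      unfolding \<pi>(2)
    proof (rule matchingsI, goal_cases)
      case (1 i j)
      then have ij: "i < j" "{i, j} - {0} \<in> \<pi>" by (auto simp: arcs_iff[OF \<pi>(1)])
      from P2_blockE[OF \<pi>(1) ij(2)] show ?case
      proof cases
        case (1 s)
        then have "i = 0" "j = s" using ij(1) by (auto simp: arc_block[OF ij(1)] split: if_splits)
        then show ?thesis using 1 by (auto simp: arc_points_def)
      next
        case (2 r s)
        then have "i = r" "j = s" using ij(1)
          by (auto simp: arc_block[OF ij(1)] doubleton_eq_iff split: if_splits)
        then show ?thesis using 2 by (auto simp: arc_points_def)
      qed
    next
      case (2 s)
      show ?case
      proof (cases "s = 0")
        case True
        then have "odd k" using 2 by (auto simp: arc_points_def split: if_splits)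
        with o have "card {B \<in> \<pi>. card B = 1} = 1" by simp
        then have "{B \<in> \<pi>. card B = 1} \<noteq> {}" by (metis card.empty zero_neq_one)
        then obtain B where B: "B \<in> \<pi>" "card B = 1" by blast
        then obtain r where r: "B = {r}" by (auto simp: card_1_singleton_iff)
        then have "r \<in> \<Union>\<pi>" using B by blast
        then have "r \<noteq> 0" by (simp add: U)
        then have "(0, r) \<in> arcs \<pi>" using B r by (simp add: arcs_iff[OF \<pi>(1)])
        then show ?thesis using True by (intro bexI) auto
      next
        case False
        then have "s \<in> {1..k}" using 2 by (auto simp: arc_points_def split: if_splits)
        then obtain B where B: "B \<in> \<pi>" "s \<in> B" using U by blast
        have "B \<in> ?b ` arcs \<pi>" using B(1) by (subst rec[OF \<pi>(1), symmetric])
        then obtain i j where "(i, j) \<in> arcs \<pi>" "B = {i, j} - {0}" by auto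
        then show ?thesis using B(2) by (intro bexI[of _ "(i, j)"]) auto
      qed
    next
      case (3 p q)
      obtain i j i' j' where pq: "p = (i, j)" "q = (i', j')" by (metis surj_pair)
      have ij: "i < j" "{i, j} - {0} \<in> \<pi>" "i' < j'" "{i', j'} - {0} \<in> \<pi>"
        using 3 by (auto simp: arcs_iff[OF \<pi>(1)] pq)
      show ?case
      proof (cases "i = 0 \<and> i' = 0")
        \<comment> \<open>Two arcs at \<open>0\<close> come from two singlets, and \<open>P2\<close>
          allows at most one.\<close>
        case True
        with ij have s: "{j} \<in> \<pi>" "{j'} \<in> \<pi>" by auto
        have "finite \<pi>" by (rule finite_UnionD) (simp add: U)
        then have fin: "finite {B \<in> \<pi>. card B = 1}" by simp
        have "{{j}, {j'}} \<subseteq> {B \<in> \<pi>. card B = 1}" using s by auto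
        from card_mono[OF fin this] have "card {{j}, {j'}} \<le> 1" using o by (auto split: if_splits)
        then have "j = j'" by (cases "j = j'") auto
        then show ?thesis using True pq by simp
      next
        case False
        have "\<exists>s. s \<in> {i, j} - {0} \<and> s \<in> {i', j'} - {0}" using 3(3) False ij by (auto simp: pq)
        then have "{i, j} - {0} = {i', j'} - {0}" using P2_disjoint[OF \<pi>(1) ij(2) ij(4)] by blast
        then show ?thesis using ij(1,3) False unfolding pq arc_block[OF ij(1)] arc_block[OF ij(3)]
          by (auto simp: doubleton_eq_iff split: if_splits)
      qed
    qed
  next
    fix m assume m: "m \<in> matchings (arc_points k)"
    define \<pi> where "\<pi> = ?b ` m"
    have D: "i < j" "j \<le> k" "1 \<le> j" "i = 0 \<Longrightarrow> odd k" if "(i, j) \<in> m" for i j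
      using matchingsD[OF m that] by (auto simp: arc_points_def split: if_splits)
    have uniq: "p = q" if "p \<in> m" "q \<in> m" "s \<in> ?b p" "s \<in> ?b q" for p q s
      using that by (intro matchings_unique[OF m]) (auto simp: case_prod_unfold)
    have part: "partition_on {1..k} \<pi>"
    proof (rule partition_onI)
      show "\<Union>\<pi> = {1..k}"
      proof (intro equalityI subsetI)
        fix s assume "s \<in> {1..k}"
        then have "s \<in> arc_points k" "s \<noteq> 0" by (auto simp: arc_points_def)
        moreover obtain p where p: "p \<in> m" "s = fst p \<or> s = snd p"
          using matchings_ex[OF m \<open>s \<in> arc_points k\<close>] by blast
        ultimately have "s \<in> ?b p" by (simp add: case_prod_unfold)
        then show "s \<in> \<Union>\<pi>" unfolding \<pi>_def using p(1) by blast
      next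
        fix s assume "s \<in> \<Union>\<pi>"
        then obtain p where "p \<in> m" "s \<in> ?b p" unfolding \<pi>_def by blast
        then show "s \<in> {1..k}" using D[of "fst p" "snd p"] by (auto simp: case_prod_unfold)
      qed
      show "disjnt B C" if "B \<in> \<pi>" "C \<in> \<pi>" "B \<noteq> C" for B C
      proof -
        obtain p q where pq: "p \<in> m" "q \<in> m" "B = ?b p" "C = ?b q" using \<open>B \<in> \<pi>\<close> \<open>C \<in> \<pi>\<close> unfolding \<pi>_def by blast
        then have "p \<noteq> q" using \<open>B \<noteq> C\<close> by auto
        then have "s \<notin> B \<or> s \<notin> C" for s using uniq[OF pq(1,2), of s] unfolding pq(3,4) by blast
        then show ?thesis unfolding disjnt_def by blast
      qed
      show "{} \<notin> \<pi>"
      proof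
        assume "{} \<in> \<pi>"
        then obtain p where "p \<in> m" "{} = ?b p" unfolding \<pi>_def by blast
        then show False using D(1)[of "fst p" "snd p"] by (auto simp: case_prod_unfold arc_block split: if_splits)
      qed
    qed
    have card_b: "card (?b (i, j)) = (if i = 0 then 1 else 2)" if "(i, j) \<in> m" for i j
      using D(1)[OF that] by (simp only: prod.case arc_block) simp
    have \<pi>E: "\<exists>i j. (i, j) \<in> m \<and> B = ?b (i, j)" if "B \<in> \<pi>" for B
      using that unfolding \<pi>_def by fast
    moreover have "card {B \<in> \<pi>. card B = 1} = (if even k then 0 else 1)"
    proof (cases "even k")
      case True
      then have "card B \<noteq> 1" if "B \<in> \<pi>" for B
      proof -
        obtain i j where ij: "(i, j) \<in> m" "B = ?b (i, j)" using \<pi>E[OF \<open>B \<in> \<pi>\<close>] by blast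
        then have "i \<noteq> 0" using D(4) True by blast
        then show ?thesis using card_b[OF ij(1)] unfolding ij(2) by simp
      qed
      then have "{B \<in> \<pi>. card B = 1} = {}" by blast
      then have "card {B \<in> \<pi>. card B = 1} = 0" by (simp only: card.empty)
      with True show ?thesis by simp
    next
      case False
      then obtain p where p: "p \<in> m" "0 = fst p \<or> 0 = snd p"
        using matchings_ex[OF m, of 0] by (auto simp: arc_points_def)
      have "fst p < snd p" using D(1)[of "fst p" "snd p"] p(1) by simp
      with p(2) obtain j where j: "p = (0, j)" by (cases p) auto
      have "{B \<in> \<pi>. card B = 1} = {?b p}"
      proof (intro equalityI subsetI)
        fix B assume "B \<in> {B \<in> \<pi>. card B = 1}"
        then have "B \<in> \<pi>" and B1: "card B = 1" by simp_all
        from \<pi>E[OF this(1)] obtain r s where rs: "(r, s) \<in> m" "B = ?b (r, s)" by blast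
        then have "r = 0" using card_b[OF rs(1)] B1 unfolding rs(2) by (cases "r = 0") auto
        then have "(r, s) = p" using rs(1) p(1) unfolding j by (intro matchings_unique[OF m]) auto
        then show "B \<in> {?b p}" using rs(2) by blast
      next
        fix B assume "B \<in> {?b p}"
        then have "B = ?b p" by blast
        moreover have "?b p \<in> \<pi>" unfolding \<pi>_def using p(1) by (rule imageI)
        moreover have "card (?b p) = 1" using card_b[of 0 j] p(1) unfolding j by simp
        ultimately show "B \<in> {B \<in> \<pi>. card B = 1}" by blast
      qed
      then have "card {B \<in> \<pi>. card B = 1} = card {?b p}" by (rule arg_cong)
      with False show ?thesis by simp
    qed
    moreover have "card B = 1 \<or> card B = 2" if "B \<in> \<pi>" for B
    proof -
      obtain i j where ij: "(i, j) \<in> m" "B = ?b (i, j)" using \<pi>E[OF \<open>B \<in> \<pi>\<close>] by blast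
      then show ?thesis using card_b[OF ij(1)] unfolding ij(2) by (cases "i = 0") auto
    qed
    ultimately have P: "\<pi> \<in> P2 k" using part by (simp add: P2_def)
    have "arcs \<pi> = m"
    proof (intro equalityI subrelI)
      fix i j assume "(i, j) \<in> m"
      then have "i < j" "?b (i, j) \<in> \<pi>" using D(1) unfolding \<pi>_def by blast+
      then show "(i, j) \<in> arcs \<pi>" by (simp add: arcs_iff[OF P])
    next
      fix i j assume "(i, j) \<in> arcs \<pi>"
      then have ij: "i < j" and "{i, j} - {0} \<in> \<pi>" by (simp_all add: arcs_iff[OF P])
      from \<pi>E[OF this(2)] obtain r s where rs: "(r, s) \<in> m" "{i, j} - {0} = {r, s} - {0}" by auto
      have "(i, j) = (r, s)"
        using ij D(1)[OF rs(1)] rs(2) unfolding arc_block[OF ij] arc_block[OF D(1)[OF rs(1)]]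
        by (auto simp: doubleton_eq_iff split: if_splits)
      with rs show "(i, j) \<in> m" by simp
    qed
    with P show "m \<in> arcs ` P2 k" by blast
  qed
qed

lemma finite_pairs: "\<pi> \<in> P2 k \<Longrightarrow> finite (pairs \<pi>)"
  using finite_matching[of "arc_points k" "arcs \<pi>"] bij_betw_apply[OF bij_betw_arcs[of k]]
  by (auto simp: arc_points_def arcs_def)

text \<open>The arc at \<open>0\<close> contributes the factor 1 by hypothesis, so the product over
  \<open>pairs \<pi>\<close> may be taken over all arcs.\<close>

lemma sum_P2_eq_pf:
  assumes "\<And>j. j > 0 \<Longrightarrow> a 0 j = 1"
  shows "(\<Sum>\<pi>\<in>P2 k. (- 1) ^ crossings \<pi> * (\<Prod>(i, j)\<in>pairs \<pi>. a i j)) = pf a (sorted_list_of_set (arc_points k))"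
proof -
  have "(\<Prod>(i, j)\<in>pairs \<pi>. a i j) = (\<Prod>(i, j)\<in>arcs \<pi>. a i j)" if \<pi>: "\<pi> \<in> P2 k" for \<pi>
  proof (rule prod.mono_neutral_left)
    have m: "arcs \<pi> \<in> matchings (arc_points k)" using bij_betw_apply[OF bij_betw_arcs \<pi>] .
    then show "finite (arcs \<pi>)" by (intro finite_matching[of "arc_points k"]) (auto simp: arc_points_def)
    show "pairs \<pi> \<subseteq> arcs \<pi>" by (auto simp: arcs_def)
    show "\<forall>p\<in>arcs \<pi> - pairs \<pi>. (case p of (i, j) \<Rightarrow> a i j) = 1"
    proof
      fix p assume p: "p \<in> arcs \<pi> - pairs \<pi>"
      then obtain j where j: "p = (0, j)" by (auto simp: arcs_def)
      with p have "0 < j" using matchingsD(3)[OF m, of 0 j] by simp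
      then show "(case p of (i, j) \<Rightarrow> a i j) = 1" using assms j by simp
    qed
  qed
  moreover have "crossings \<pi> = card (crossing_pairs (arcs \<pi>))" for \<pi>
    by (simp add: crossings_def crossing_pairs_def)
  ultimately have "(\<Sum>\<pi>\<in>P2 k. (- 1) ^ crossings \<pi> * (\<Prod>(i, j)\<in>pairs \<pi>. a i j))
      = (\<Sum>\<pi>\<in>P2 k. (- 1) ^ card (crossing_pairs (arcs \<pi>)) * (\<Prod>(i, j)\<in>arcs \<pi>. a i j))"
    by simp
  also have "\<dots> = (\<Sum>m\<in>matchings (arc_points k). (- 1) ^ card (crossing_pairs m) * (\<Prod>(i, j)\<in>m. a i j))"
    by (rule sum.reindex_bij_betw[OF bij_betw_arcs])
  also have "\<dots> = pf a (sorted_list_of_set (arc_points k))"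
    by (rule sum_matchings_eq_pf) (simp add: arc_points_def)
  finally show ?thesis .
qed

section \<open>The heat equation with square wave initial data\<close>

lemma sum_sin_telescope:
  fixes \<theta> :: real
  shows "2 * sin (\<theta> / 2) * (\<Sum>i<n. sin (real (m + i) * \<theta>))
    = cos ((real m - 1 / 2) * \<theta>) - cos ((real (m + n) - 1 / 2) * \<theta>)"
proof (induction n)
  case (Suc n)
  have "2 * sin (\<theta> / 2) * sin (real (m + n) * \<theta>)
      = cos (real (m + n) * \<theta> - \<theta> / 2) - cos (real (m + n) * \<theta> + \<theta> / 2)"
    by (simp add: cos_add cos_diff)
  also have "\<dots> = cos ((real (m + n) - 1 / 2) * \<theta>) - cos ((real (m + Suc n) - 1 / 2) * \<theta>)"
    by (simp add: algebra_simps)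
  finally show ?case using Suc by (simp add: algebra_simps)
qed simp

lemma sum_sin_bound:
  fixes \<theta> :: real
  assumes "sin (\<theta> / 2) > 0"
  shows "\<bar>\<Sum>i<n. sin (real (m + i) * \<theta>)\<bar> \<le> 1 / sin (\<theta> / 2)"
proof -
  have "\<bar>2 * sin (\<theta> / 2) * (\<Sum>i<n. sin (real (m + i) * \<theta>))\<bar> \<le> 2"
    unfolding sum_sin_telescope
    using abs_cos_le_one[of "(real m - 1 / 2) * \<theta>"] abs_cos_le_one[of "(real (m + n) - 1 / 2) * \<theta>"] by linarith
  then show ?thesis using assms by (simp add: abs_mult field_simps)
qed

text \<open>Summation by parts: the bound sees the weights only through \<open>c 0\<close>, however
  slowly they decrease.\<close>

lemma sum_by_parts_bound:
  fixes c s :: "nat \<Rightarrow> real"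
  assumes c: "\<And>i. c (Suc i) \<le> c i" "\<And>i. 0 \<le> c i" and B: "\<And>n. \<bar>\<Sum>i<n. s i\<bar> \<le> C"
  shows "\<bar>\<Sum>i<n. c i * s i\<bar> \<le> C * c 0"
proof -
  have eq: "(\<Sum>i<n. c i * s i) = c n * (\<Sum>i<n. s i) + (\<Sum>i<n. (c i - c (Suc i)) * (\<Sum>j<Suc i. s j))" for n
    by (induction n) (simp_all add: algebra_simps)
  have "\<bar>\<Sum>i<n. c i * s i\<bar> \<le> \<bar>c n * (\<Sum>i<n. s i)\<bar> + \<bar>\<Sum>i<n. (c i - c (Suc i)) * (\<Sum>j<Suc i. s j)\<bar>"
    unfolding eq[of n] by (rule abs_triangle_ineq)
  also have "\<dots> \<le> c n * C + (\<Sum>i<n. (c i - c (Suc i)) * C)"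
  proof (rule add_mono)
    show "\<bar>c n * (\<Sum>i<n. s i)\<bar> \<le> c n * C" using c B by (simp add: abs_mult mult_left_mono)
    show "\<bar>\<Sum>i<n. (c i - c (Suc i)) * (\<Sum>j<Suc i. s j)\<bar> \<le> (\<Sum>i<n. (c i - c (Suc i)) * C)"
    proof (rule order_trans[OF sum_abs], rule sum_mono)
      fix i
      show "\<bar>(c i - c (Suc i)) * (\<Sum>j<Suc i. s j)\<bar> \<le> (c i - c (Suc i)) * C"
        using c(1)[of i] B[of "Suc i"] by (simp only: abs_mult) (intro mult_mono, auto)
    qed
  qed
  also have "\<dots> = C * c 0"
  proof -
    have "(\<Sum>i<n. c i - c (Suc i)) = c 0 - c n" by (induction n) auto
    then show ?thesis by (simp only: sum_distrib_right[symmetric]) (simp add: algebra_simps)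
  qed
  finally show ?thesis .
qed

text \<open>The bound on the tail does not depend on the weights. They will be \<open>r ^ n\<close>
  and \<open>exp (- (a * n^2))\<close>, and the uniformity permits the limits \<open>r\<close> to 1
  and \<open>a\<close> to 0, although the unweighted series converges only conditionally.\<close>

lemma weighted_sine_series_tail:
  fixes \<theta> :: real and w :: "nat \<Rightarrow> real"
  assumes \<theta>: "sin (\<theta> / 2) > 0" and N: "N \<ge> 1"
    and w: "\<And>i. w (Suc i) \<le> w i" "\<And>i. 0 \<le> w i" "\<And>i. w i \<le> 1"
    and s: "(\<lambda>n. w n * (sin (real n * \<theta>) / real n)) sums S"
  shows "\<bar>S - (\<Sum>n<N. w n * (sin (real n * \<theta>) / real n))\<bar> \<le> 1 / sin (\<theta> / 2) / real N"
proof -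
  let ?f = "\<lambda>n. w n * (sin (real n * \<theta>) / real n)"
  have "(\<lambda>i. ?f (i + N)) sums (S - (\<Sum>n<N. ?f n))"
    using s by (rule sums_split_initial_segment)
  then have "(\<lambda>n. \<bar>\<Sum>i<n. ?f (i + N)\<bar>) \<longlonglongrightarrow> \<bar>S - (\<Sum>n<N. ?f n)\<bar>"
    unfolding sums_def by (rule tendsto_rabs)
  moreover have "\<bar>\<Sum>i<n. ?f (i + N)\<bar> \<le> 1 / sin (\<theta> / 2) / real N" for n
  proof -
    let ?c = "\<lambda>i. w (N + i) / real (N + i)"
    have "(\<Sum>i<n. ?f (i + N)) = (\<Sum>i<n. ?c i * sin (real (N + i) * \<theta>))"
      by (intro sum.cong) (simp_all add: add.commute)
    also have "\<bar>\<dots>\<bar> \<le> 1 / sin (\<theta> / 2) * ?c 0"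
    proof (rule sum_by_parts_bound)
      show "?c (Suc i) \<le> ?c i" for i
        using w(1)[of "N + i"] w(2)[of "N + i"] N by (intro frac_le) auto
    qed (use w(2) N sum_sin_bound[OF \<theta>] in auto)
    also have "\<dots> \<le> 1 / sin (\<theta> / 2) * (1 / real N)"
      using w(3)[of N] \<theta> by (intro mult_left_mono) (simp_all add: divide_right_mono)
    finally show ?thesis by simp
  qed
  ultimately show ?thesis by (intro LIMSEQ_le_const2[of _ "\<bar>S - (\<Sum>n<N. ?f n)\<bar>"]) auto
qed

text \<open>The imaginary part of the power series of \<open>- Ln (1 - z)\<close> at
  \<open>z = r * cis \<theta>\<close>.\<close>

lemma sine_Abel_sums:
  fixes \<theta> r :: real
  assumes "0 \<le> r" "r < 1"
  shows "(\<lambda>n. r ^ n * (sin (real n * \<theta>) / real n)) sums (- Im (Ln (1 - r *\<^sub>R cis \<theta>)))"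
proof -
  let ?z = "- (r *\<^sub>R cis \<theta>)"
  have "(\<lambda>n. (- 1) ^ Suc n / of_nat n * ?z ^ n) sums ln (1 + ?z)"
    using assms by (intro Ln_series) simp
  then have "(\<lambda>n. Im ((- 1) ^ Suc n / of_nat n * ?z ^ n)) sums Im (ln (1 + ?z))"
    by (rule sums_Im)
  then have "(\<lambda>n. - Im ((- 1) ^ Suc n / of_nat n * ?z ^ n)) sums (- Im (ln (1 + ?z)))"
    by (rule sums_minus)
  moreover have "- Im ((- 1) ^ Suc n / of_nat n * ?z ^ n) = r ^ n * (sin (real n * \<theta>) / real n)" for n
  proof -
    have "(- 1) ^ Suc n / of_nat n * (- w) ^ n = - (w ^ n / of_nat n)" for w :: complex
      by (subst power_minus) (cases "even n"; simp)
    then have "(- 1) ^ Suc n / of_nat n * ?z ^ n = - ((r *\<^sub>R cis \<theta>) ^ n / of_nat n)" .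
    moreover have "(r *\<^sub>R cis \<theta>) ^ n = r ^ n *\<^sub>R cis (real n * \<theta>)"
      by (simp add: scaleR_power Complex.DeMoivre)
    ultimately have "(- 1) ^ Suc n / of_nat n * ?z ^ n = - (r ^ n *\<^sub>R cis (real n * \<theta>) / of_nat n)"
      by (simp only:)
    then show ?thesis by (simp only: uminus_complex.sel Im_divide_of_nat scaleR_complex.sel cis.sel) simp
  qed
  ultimately show ?thesis by (simp only: diff_conv_add_uminus[of 1])
qed

lemma sin_half_pos: "0 < \<theta> \<Longrightarrow> \<theta> < 2 * pi \<Longrightarrow> sin (\<theta> / 2) > 0"
  by (intro sin_gt_zero) auto

text \<open>From \<open>1 - cis \<theta> = 2 * sin (\<theta> / 2) * cis ((\<theta> - pi) /
  2)\<close>, whose angle lies strictly between \<open>- pi / 2\<close> and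
  \<open>pi / 2\<close>.\<close>

lemma Ln_one_minus_cis:
  assumes "0 < \<theta>" "\<theta> < 2 * pi"
  shows "Im (Ln (1 - cis \<theta>)) = (\<theta> - pi) / 2"
proof -
  have s: "sin (\<theta> / 2) > 0" using assms by (rule sin_half_pos)
  have 1: "1 - cos \<theta> = 2 * sin (\<theta> / 2) * cos ((\<theta> - pi) / 2)"
    using cos_double_sin[of "\<theta> / 2"] sin_cos_eq[of "\<theta> / 2"] cos_minus[of "(\<theta> - pi) / 2"]
    by (simp add: power2_eq_square diff_divide_distrib)
  have 2: "- sin \<theta> = 2 * sin (\<theta> / 2) * sin ((\<theta> - pi) / 2)"
    using sin_double[of "\<theta> / 2"] cos_sin_eq[of "\<theta> / 2"] sin_minus[of "(\<theta> - pi) / 2"]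
    by (simp add: diff_divide_distrib)
  have "exp (Complex (ln (2 * sin (\<theta> / 2))) ((\<theta> - pi) / 2)) = 1 - cis \<theta>"
    using 1 2 s by (auto simp: complex_eq_iff Re_exp Im_exp)
  then have "Ln (1 - cis \<theta>) = Complex (ln (2 * sin (\<theta> / 2))) ((\<theta> - pi) / 2)"
    using assms by (intro Ln_unique) (auto simp: field_simps)
  then show ?thesis by simp
qed

text \<open>Abel's limit \<open>r\<close> to 1 with \<open>N\<close> fixed: the tail bound survives
  it, and the sum is read off from the logarithm, which is continuous at
  \<open>1 - cis \<theta>\<close> because the real part there is positive.\<close>

lemma sine_series_partial_sums:
  assumes \<theta>: "0 < \<theta>" "\<theta> < 2 * pi" and N: "N \<ge> 1"
  shows "\<bar>(pi - \<theta>) / 2 - (\<Sum>n<N. sin (real n * \<theta>) / real n)\<bar> \<le> 1 / sin (\<theta> / 2) / real N"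
proof -
  have "cos \<theta> \<noteq> 1"
    using cos_double_sin[of "\<theta> / 2"] sin_half_pos[OF \<theta>] by auto
  then have "Re (1 - cis \<theta>) > 0" using cos_le_one[of \<theta>] by (simp add: order.not_eq_order_implies_strict)
  then have "1 - cis \<theta> \<notin> \<real>\<^sub>\<le>\<^sub>0" by (auto simp: complex_nonpos_Reals_iff)
  then have "((\<lambda>r. - Im (Ln (1 - r *\<^sub>R cis \<theta>))) \<longlongrightarrow> - Im (Ln (1 - 1 *\<^sub>R cis \<theta>))) (at_left 1)"
    by (intro tendsto_intros) auto
  then have "((\<lambda>r. - Im (Ln (1 - r *\<^sub>R cis \<theta>))) \<longlongrightarrow> (pi - \<theta>) / 2) (at_left 1)"
    using Ln_one_minus_cis[OF \<theta>] by (simp add: minus_divide_left)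
  moreover have "((\<lambda>r::real. \<Sum>n<N. r ^ n * (sin (real n * \<theta>) / real n)) \<longlongrightarrow>
      (\<Sum>n<N. 1 ^ n * (sin (real n * \<theta>) / real n))) (at_left 1)"
    by (intro tendsto_intros)
  ultimately have "((\<lambda>r. \<bar>- Im (Ln (1 - r *\<^sub>R cis \<theta>)) - (\<Sum>n<N. r ^ n * (sin (real n * \<theta>) / real n))\<bar>) \<longlongrightarrow>
      \<bar>(pi - \<theta>) / 2 - (\<Sum>n<N. 1 ^ n * (sin (real n * \<theta>) / real n))\<bar>) (at_left 1)"
    by (intro tendsto_intros)
  moreover have "eventually (\<lambda>r :: real. r \<in> {0<..<1}) (at_left 1)"
    by (rule eventually_at_left_real) simp
  then have "eventually (\<lambda>r. \<bar>- Im (Ln (1 - r *\<^sub>R cis \<theta>)) - (\<Sum>n<N. r ^ n * (sin (real n * \<theta>) / real n))\<bar>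
      \<le> 1 / sin (\<theta> / 2) / real N) (at_left 1)"
  proof eventually_elim
    case (elim r)
    then show ?case
      using sine_Abel_sums[of r \<theta>] sin_half_pos[OF \<theta>] N
      by (intro weighted_sine_series_tail) (auto intro: power_le_one mult_left_le_one_le)
  qed
  ultimately have "\<bar>(pi - \<theta>) / 2 - (\<Sum>n<N. 1 ^ n * (sin (real n * \<theta>) / real n))\<bar> \<le> 1 / sin (\<theta> / 2) / real N"
    by (intro tendsto_upperbound) auto
  then show ?thesis by simp
qed

lemma summable_gauss:
  fixes a :: real
  assumes "a > 0"
  shows "summable (\<lambda>n. exp (- (a * (real n)\<^sup>2)))"
proof (rule summable_comparison_test')
  show "summable (\<lambda>n. exp (- a) ^ n)" using assms by (intro summable_geometric) simp
  show "norm (exp (- (a * (real n)\<^sup>2))) \<le> exp (- a) ^ n" for n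
  proof -
    have "real n \<le> (real n)\<^sup>2" by (simp add: power2_eq_square le_square flip: of_nat_mult)
    then have "a * real n \<le> a * (real n)\<^sup>2" using assms by simp
    then show ?thesis by (simp add: exp_of_nat_mult[symmetric] mult.commute)
  qed
qed

definition gauss_sine :: "real \<Rightarrow> real \<Rightarrow> real" where
  "gauss_sine a \<theta> = (\<Sum>n. exp (- (a * (real n)\<^sup>2)) * (sin (real n * \<theta>) / real n))"

lemma abs_sin_div_le_one: "\<bar>sin x / real n\<bar> \<le> 1"
  by (cases "n = 0") (auto simp: divide_le_eq intro: order_trans[OF abs_sin_le_one])

lemma gauss_sine_sums:
  assumes "a > 0"
  shows "(\<lambda>n. exp (- (a * (real n)\<^sup>2)) * (sin (real n * \<theta>) / real n)) sums gauss_sine a \<theta>"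
  unfolding gauss_sine_def
proof (intro summable_sums summable_comparison_test'[OF summable_gauss[OF assms]])
  fix n
  show "norm (exp (- (a * (real n)\<^sup>2)) * (sin (real n * \<theta>) / real n)) \<le> exp (- (a * (real n)\<^sup>2))"
    using mult_left_mono[OF abs_sin_div_le_one[of "real n * \<theta>" n], of "exp (- (a * (real n)\<^sup>2))"]
    by (simp add: abs_mult)
qed

lemma gauss_sine_tail:
  assumes "a > 0" "0 < \<theta>" "\<theta> < 2 * pi" "N \<ge> 1"
  shows "\<bar>gauss_sine a \<theta> - (\<Sum>n<N. exp (- (a * (real n)\<^sup>2)) * (sin (real n * \<theta>) / real n))\<bar>
    \<le> 1 / sin (\<theta> / 2) / real N"
  using assms gauss_sine_sums[OF assms(1)] sin_half_pos[OF assms(2,3)]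
  by (intro weighted_sine_series_tail) (auto simp: power2_eq_square intro!: mult_mono)

lemma tendsto_gauss_sine:
  assumes \<theta>: "0 < \<theta>" "\<theta> < 2 * pi"
  shows "((\<lambda>a. gauss_sine a \<theta>) \<longlongrightarrow> (pi - \<theta>) / 2) (at_right 0)"
proof (rule tendstoI)
  fix e :: real assume e: "e > 0"
  define C where "C = 1 / sin (\<theta> / 2)"
  have C: "C > 0" using sin_half_pos[OF \<theta>] by (simp add: C_def)
  \<comment> \<open>The tail at \<open>a\<close>, the tail of the unweighted series and the
    difference of the two heads get a third of \<open>e\<close> each.\<close>
  obtain N where N: "real N > 3 * C / e" using reals_Archimedean2 by blast
  have "3 * C / e > 0" using C e by simp
  with N have N1: "N \<ge> 1" by (cases N) auto
  have CN: "C / real N < e / 3" using N N1 C e by (simp add: field_simps)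
  let ?P = "\<lambda>a. \<Sum>n<N. exp (- (a * (real n)\<^sup>2)) * (sin (real n * \<theta>) / real n)"
  have "(?P \<longlongrightarrow> (\<Sum>n<N. exp (- (0 * (real n)\<^sup>2)) * (sin (real n * \<theta>) / real n))) (at_right 0)"
    by (intro tendsto_intros)
  then have "eventually (\<lambda>a. dist (?P a) (\<Sum>n<N. sin (real n * \<theta>) / real n) < e / 3) (at_right 0)"
    using e by (intro tendstoD) auto
  moreover have "eventually (\<lambda>a::real. a > 0) (at_right 0)" by (rule eventually_at_right_less)
  ultimately show "eventually (\<lambda>a. dist (gauss_sine a \<theta>) ((pi - \<theta>) / 2) < e) (at_right 0)"
  proof eventually_elim
    case (elim a)
    have "\<bar>gauss_sine a \<theta> - ?P a\<bar> \<le> C / real N"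
      using gauss_sine_tail[OF elim(2) \<theta> N1] by (simp add: C_def)
    moreover have "\<bar>(pi - \<theta>) / 2 - (\<Sum>n<N. sin (real n * \<theta>) / real n)\<bar> \<le> C / real N"
      using sine_series_partial_sums[OF \<theta> N1] by (simp add: C_def)
    ultimately show ?case using elim(1) CN unfolding dist_real_def by argo
  qed
qed

lemma sin_ge_quarter:
  fixes x :: real
  assumes "0 \<le> x" "x \<le> pi / 2"
  shows "x / 4 \<le> sin x"
proof -
  have c: "cos (x / 2) \<ge> 1 / 2"
  proof -
    have "cos (pi / 3) \<le> cos (x / 2)" using assms by (intro cos_monotone_0_pi_le) auto
    then show ?thesis by (simp add: cos_60)
  qed
  have "x / 2 \<le> tan (x / 2)"
  proof -
    have "x < pi" using assms pi_gt_zero by linarith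
    then have "\<bar>x / 2\<bar> \<le> \<bar>tan (x / 2)\<bar>" using assms by (intro abs_tan_ge) simp
    moreover have "tan (x / 2) \<ge> 0"
      using assms c by (auto simp: tan_def intro!: divide_nonneg_nonneg sin_ge_zero)
    ultimately show ?thesis using assms by simp
  qed
  then have "x / 2 * cos (x / 2) \<le> sin (x / 2)" using c by (simp add: tan_def field_simps)
  moreover have "x / 2 * (1 / 2) \<le> x / 2 * cos (x / 2)" using c assms by (intro mult_left_mono) auto
  ultimately have "x / 4 \<le> sin (x / 2)" by linarith
  then have "2 * (x / 4) * (1 / 2) \<le> 2 * sin (x / 2) * cos (x / 2)"
    using c assms by (intro mult_mono) auto
  then show ?thesis using sin_double[of "x / 2"] by simp
qed

text \<open>The series is cut at \<open>N\<close> about \<open>1 / \<theta>\<close>. The head has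
  \<open>N\<close> terms of size at most \<open>\<theta>\<close>, in total at most
  \<open>1 + \<theta> < 5\<close>; the tail is at most
  \<open>1 / (N * sin (\<theta> / 2)) \<le> 8\<close>. Together this makes 13.\<close>

lemma gauss_sine_bounded_aux:
  assumes a: "a > 0" and \<theta>: "0 < \<theta>" "\<theta> \<le> pi"
  shows "\<bar>gauss_sine a \<theta>\<bar> \<le> 13"
proof -
  define N where "N = nat \<lceil>1 / \<theta>\<rceil>"
  have N: "1 / \<theta> \<le> real N" "real N < 1 / \<theta> + 1" using \<theta> by (auto simp: N_def) linarith+
  have N1: "N \<ge> 1" using N \<theta> by (cases N) (auto simp: field_simps)
  have N\<theta>: "1 \<le> real N * \<theta>" "real N * \<theta> \<le> 1 + \<theta>" using N \<theta> by (simp_all add: field_simps)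
  let ?P = "\<Sum>n<N. exp (- (a * (real n)\<^sup>2)) * (sin (real n * \<theta>) / real n)"
  have "\<bar>?P\<bar> \<le> (\<Sum>n<N. \<theta>)"
  proof (rule order_trans[OF sum_abs], rule sum_mono)
    fix n
    have "\<bar>sin (real n * \<theta>) / real n\<bar> \<le> \<theta>"
      using abs_sin_x_le_abs_x[of "real n * \<theta>"] \<theta> by (cases "n = 0") (auto simp: field_simps abs_mult)
    then have "exp (- (a * (real n)\<^sup>2)) * \<bar>sin (real n * \<theta>) / real n\<bar> \<le> 1 * \<theta>"
      using a by (intro mult_mono) auto
    then show "\<bar>exp (- (a * (real n)\<^sup>2)) * (sin (real n * \<theta>) / real n)\<bar> \<le> \<theta>" by (simp add: abs_mult)
  qed
  then have P: "\<bar>?P\<bar> \<le> 1 + \<theta>" using N\<theta> by simp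
  have "\<theta> / 8 \<le> sin (\<theta> / 2)" using sin_ge_quarter[of "\<theta> / 2"] \<theta> by simp
  then have "1 / sin (\<theta> / 2) / real N \<le> 1 / (\<theta> / 8) / real N"
    using \<theta> by (intro divide_right_mono divide_left_mono mult_pos_pos) auto
  also have "\<dots> \<le> 8" using N\<theta> \<theta> N1 by (simp add: field_simps)
  finally have "\<bar>gauss_sine a \<theta> - ?P\<bar> \<le> 8"
    using gauss_sine_tail[OF a \<theta>(1) _ N1] \<theta> by (auto intro: order_trans)
  with P show ?thesis using \<theta> pi_less_4 by argo
qed

text \<open>The reflection of \<open>\<theta>\<close> to \<open>2 * pi - \<theta>\<close> only
  changes the sign and leads back to the first half of the period, where
  \<open>sin (\<theta> / 2)\<close> is at least a multiple of \<open>\<theta>\<close>.\<close>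

lemma gauss_sine_bounded:
  assumes a: "a > 0" and \<theta>: "0 < \<theta>" "\<theta> < 2 * pi"
  shows "\<bar>gauss_sine a \<theta>\<bar> \<le> 13"
proof (cases "\<theta> \<le> pi")
  case False
  have "sin (real n * (2 * pi - \<theta>)) = - sin (real n * \<theta>)" for n
    using sin_diff[of "2 * real n * pi" "real n * \<theta>"] sin_2npi[of n] cos_2npi[of n] by (simp add: algebra_simps)
  then have "gauss_sine a (2 * pi - \<theta>) = - gauss_sine a \<theta>"
    using sums_minus[OF gauss_sine_sums[OF a, of \<theta>]] unfolding gauss_sine_def[of a "2 * pi - \<theta>"]
    by (intro sums_unique[symmetric]) simp
  moreover have "\<bar>gauss_sine a (2 * pi - \<theta>)\<bar> \<le> 13"
    using False \<theta> by (intro gauss_sine_bounded_aux[OF a]) auto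
  ultimately show ?thesis by simp
qed (use gauss_sine_bounded_aux[OF a \<theta>(1)] in simp)

section \<open>The heat solution: estimates, symmetries and initial values\<close>

definition fourier_weight :: "nat \<Rightarrow> nat \<Rightarrow> real" where
  "fourier_weight k n = (if n \<in> frequencies k then 4 / pi else 0)"

text \<open>On \<open>(0, 1)\<close> the square wave is \<open>4 / pi\<close> times the sum of
  \<open>sin (pi * n * y) / n\<close> over odd \<open>n\<close>, and \<open>1 - 2 * y\<close> is the
  same sum over even \<open>n > 0\<close>; this explains the weight. The mode \<open>n = 0\<close>,
  which belongs to \<open>frequencies k\<close> for odd \<open>k\<close>, is 0 because division by
  zero gives zero. The rate \<open>pi^2 * n^2\<close> fits a variable of variance
  \<open>2 * t\<close>, such as a difference of two coordinates.\<close>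

abbreviation heat_mode :: "nat \<Rightarrow> real \<Rightarrow> real \<Rightarrow> nat \<Rightarrow> real" where
  "heat_mode k t y n \<equiv> fourier_weight k n * exp (- (pi\<^sup>2 * t * (real n)\<^sup>2)) * (sin (pi * real n * y) / real n)"

definition heat :: "nat \<Rightarrow> real \<Rightarrow> real \<Rightarrow> real" where
  "heat k t y = (\<Sum>n. heat_mode k t y n)"

definition heat_partial :: "nat \<Rightarrow> nat \<Rightarrow> real \<Rightarrow> real \<Rightarrow> real" where
  "heat_partial N k t y =
    (\<Sum>n<N. heat_mode k t y n)"

text \<open>The factor 4 bounds \<open>4 / pi\<close> as well as \<open>4 / pi * pi\<close>.
  Differentiating a mode in \<open>y\<close> gains \<open>pi * n\<close>, and the \<open>n\<close>
  cancels, so this one sum controls the values, the truncations and the Lipschitz constant.\<close>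

definition heat_bound :: "real \<Rightarrow> real" where
  "heat_bound t = (\<Sum>n. 4 * exp (- (pi\<^sup>2 * t * (real n)\<^sup>2)))"

lemma fourier_weight_nonneg: "0 \<le> fourier_weight k n"
  by (simp add: fourier_weight_def)

lemma fourier_weight_le: "fourier_weight k n * pi \<le> 4"
  by (simp add: fourier_weight_def)

lemma fourier_weight_le_4: "fourier_weight k n \<le> 4"
  using pi_gt3 by (simp add: fourier_weight_def divide_le_eq)

lemma summable_heat_bound: "t > 0 \<Longrightarrow> summable (\<lambda>n. 4 * exp (- (pi\<^sup>2 * t * (real n)\<^sup>2)))"
  using summable_gauss[of "pi\<^sup>2 * t"] by (intro summable_mult) simp

lemma heat_bound_nonneg: "t > 0 \<Longrightarrow> 0 \<le> heat_bound t"
  unfolding heat_bound_def by (intro suminf_nonneg summable_heat_bound) auto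

lemma heat_term_le:
  assumes "e \<le> t"
  shows "\<bar>fourier_weight k n * exp (- (pi\<^sup>2 * t * (real n)\<^sup>2)) * (sin x / real n)\<bar> \<le> 4 * exp (- (pi\<^sup>2 * e * (real n)\<^sup>2))"
proof -
  have "pi\<^sup>2 * e * (real n)\<^sup>2 \<le> pi\<^sup>2 * t * (real n)\<^sup>2"
    using assms by (intro mult_right_mono mult_left_mono) auto
  then have "fourier_weight k n * exp (- (pi\<^sup>2 * t * (real n)\<^sup>2)) * \<bar>sin x / real n\<bar>
      \<le> 4 * exp (- (pi\<^sup>2 * e * (real n)\<^sup>2)) * 1"
    by (intro mult_mono fourier_weight_le_4 abs_sin_div_le_one) (auto simp: fourier_weight_nonneg)
  then show ?thesis by (simp only: abs_mult abs_of_nonneg[OF fourier_weight_nonneg] abs_exp_cancel mult_1_right)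
qed

lemma summable_heat:
  assumes "t > 0"
  shows "summable (heat_mode k t y)"
  by (rule summable_comparison_test'[OF summable_heat_bound[OF assms]])
    (simp only: real_norm_def, rule heat_term_le, simp)

lemma heat_partial_tendsto: "t > 0 \<Longrightarrow> (\<lambda>N. heat_partial N k t y) \<longlonglongrightarrow> heat k t y"
  unfolding heat_partial_def heat_def using summable_sums[OF summable_heat] by (simp add: sums_def)

lemma abs_heat_partial_le:
  assumes "0 < e" "e \<le> t"
  shows "\<bar>heat_partial N k t y\<bar> \<le> heat_bound e"
proof -
  have "\<bar>heat_partial N k t y\<bar> \<le> (\<Sum>n<N. 4 * exp (- (pi\<^sup>2 * e * (real n)\<^sup>2)))"
    unfolding heat_partial_def by (rule order_trans[OF sum_abs sum_mono]) (rule heat_term_le[OF assms(2)])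
  also have "\<dots> \<le> heat_bound e"
    unfolding heat_bound_def by (rule sum_le_suminf[OF summable_heat_bound]) (use assms in auto)
  finally show ?thesis .
qed

lemma abs_heat_le:
  assumes "0 < e" "e \<le> t"
  shows "\<bar>heat k t y\<bar> \<le> heat_bound e"
  using assms by (intro LIMSEQ_le_const2[OF tendsto_rabs[OF heat_partial_tendsto]] exI[of _ 0])
    (auto intro: abs_heat_partial_le)

lemma heat_lipschitz:
  assumes "0 < e" "e \<le> t"
  shows "\<bar>heat k t y - heat k t z\<bar> \<le> heat_bound e * \<bar>y - z\<bar>"
proof -
  have "\<bar>heat_partial N k t y - heat_partial N k t z\<bar> \<le> heat_bound e * \<bar>y - z\<bar>" for N
  proof -
    have "\<bar>heat_partial N k t y - heat_partial N k t z\<bar> \<le> (\<Sum>n<N. 4 * exp (- (pi\<^sup>2 * e * (real n)\<^sup>2)) * \<bar>y - z\<bar>)"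
      unfolding heat_partial_def sum_subtractf[symmetric]
    proof (rule order_trans[OF sum_abs sum_mono])
      fix n
      let ?c = "fourier_weight k n" and ?x = "exp (- (pi\<^sup>2 * t * (real n)\<^sup>2))"
      have "\<bar>sin (pi * real n * y) - sin (pi * real n * z)\<bar> \<le> \<bar>pi * real n * y - pi * real n * z\<bar>"
      proof -
        let ?u = "(pi * real n * y - pi * real n * z) / 2"
        have "\<bar>sin (pi * real n * y) - sin (pi * real n * z)\<bar> = 2 * (\<bar>sin ?u\<bar> * \<bar>cos ((pi * real n * y + pi * real n * z) / 2)\<bar>)"
          unfolding sin_diff_sin by (simp add: abs_mult)
        also have "\<dots> \<le> 2 * (\<bar>?u\<bar> * 1)"
          by (intro mult_left_mono mult_mono abs_sin_x_le_abs_x) auto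
        finally show ?thesis by simp
      qed
      also have "\<dots> = pi * real n * \<bar>y - z\<bar>"
        unfolding right_diff_distrib[symmetric] by (simp add: abs_mult)
      finally have s: "\<bar>sin (pi * real n * y) / real n - sin (pi * real n * z) / real n\<bar> \<le> pi * \<bar>y - z\<bar>"
        by (cases "n = 0") (auto simp: diff_divide_distrib[symmetric] field_simps)
      have "pi\<^sup>2 * e * (real n)\<^sup>2 \<le> pi\<^sup>2 * t * (real n)\<^sup>2"
        using assms by (intro mult_right_mono mult_left_mono) auto
      then have x: "?x \<le> exp (- (pi\<^sup>2 * e * (real n)\<^sup>2))" by simp
      have "\<bar>?c * ?x * (sin (pi * real n * y) / real n) - ?c * ?x * (sin (pi * real n * z) / real n)\<bar>
          = ?c * ?x * \<bar>sin (pi * real n * y) / real n - sin (pi * real n * z) / real n\<bar>"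
        unfolding right_diff_distrib[symmetric]
        by (simp only: abs_mult abs_of_nonneg[OF fourier_weight_nonneg] abs_exp_cancel)
      also have "\<dots> \<le> ?c * ?x * (pi * \<bar>y - z\<bar>)"
        using s by (intro mult_left_mono) (auto simp: fourier_weight_nonneg)
      also have "\<dots> = (?c * pi) * (?x * \<bar>y - z\<bar>)" by simp
      also have "\<dots> \<le> 4 * (exp (- (pi\<^sup>2 * e * (real n)\<^sup>2)) * \<bar>y - z\<bar>)"
        by (intro mult_mono fourier_weight_le mult_right_mono x) auto
      finally show "\<bar>?c * ?x * (sin (pi * real n * y) / real n) - ?c * ?x * (sin (pi * real n * z) / real n)\<bar>
          \<le> 4 * exp (- (pi\<^sup>2 * e * (real n)\<^sup>2)) * \<bar>y - z\<bar>" by simp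
    qed
    also have "\<dots> \<le> heat_bound e * \<bar>y - z\<bar>"
      unfolding sum_distrib_right[symmetric] heat_bound_def using assms
      by (intro mult_right_mono sum_le_suminf[OF summable_heat_bound]) auto
    finally show ?thesis .
  qed
  moreover have "(\<lambda>N. \<bar>heat_partial N k t y - heat_partial N k t z\<bar>) \<longlonglongrightarrow> \<bar>heat k t y - heat k t z\<bar>"
    using assms by (intro tendsto_intros heat_partial_tendsto) auto
  ultimately show ?thesis by (intro LIMSEQ_le_const2) auto
qed

lemma heat_minus: "t > 0 \<Longrightarrow> heat k t (- y) = - heat k t y"
  unfolding heat_def by (subst suminf_minus[OF summable_heat, symmetric]) simp_all

text \<open>All frequencies in use have one parity, odd for even \<open>k\<close> and even for odd
  \<open>k\<close>, and the shift multiplies the sine by \<open>(- 1) ^ n\<close>. This makes rows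
  \<open>1\<close> and \<open>k\<close> of the Pfaffian proportional on the affine wall.\<close>

lemma heat_plus_one:
  assumes "t > 0"
  shows "heat k t (y + 1) = (if even k then - heat k t y else heat k t y)"
proof -
  have *: "fourier_weight k n * sin (pi * real n * (y + 1))
      = (if even k then -1 else 1) * (fourier_weight k n * sin (pi * real n * y))" for n
    by (auto simp: fourier_weight_def frequencies_def ring_distribs sin_add mult.commute[of pi "real n"] elim!: evenE oddE)
  have "heat k t (y + 1) = (\<Sum>n. (if even k then -1 else 1) *
     (heat_mode k t y n))"
    unfolding heat_def
  proof (intro suminf_cong)
    fix n
    have "fourier_weight k n * exp (- (pi\<^sup>2 * t * (real n)\<^sup>2)) * (sin (pi * real n * (y + 1)) / real n)
       = (fourier_weight k n * sin (pi * real n * (y + 1))) * (exp (- (pi\<^sup>2 * t * (real n)\<^sup>2)) / real n)" by simp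
    also have "\<dots> = (if even k then -1 else 1) *
     (heat_mode k t y n)"
      unfolding * by simp
    finally show "fourier_weight k n * exp (- (pi\<^sup>2 * t * (real n)\<^sup>2)) * (sin (pi * real n * (y + 1)) / real n)
       = (if even k then -1 else 1) *
     (heat_mode k t y n)" .
  qed
  also have "\<dots> = (if even k then -1 else 1) * heat k t y"
    unfolding heat_def by (rule suminf_mult[OF summable_heat[OF assms]])
  finally show ?thesis by simp
qed

text \<open>With \<open>n = 2 * m\<close> the even frequencies form the full series at the double
  angle, with \<open>a\<close> replaced by \<open>4 * a\<close> and a factor \<open>1 / 2\<close>;
  the odd frequencies are the rest.\<close>

lemma heat_eq_gauss_sine:
  assumes t: "t > 0"
  shows "heat k t y = (if even k
    then 4 / pi * (gauss_sine (pi\<^sup>2 * t) (pi * y) - gauss_sine (4 * (pi\<^sup>2 * t)) (2 * (pi * y)) / 2)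
    else 4 / pi * (gauss_sine (4 * (pi\<^sup>2 * t)) (2 * (pi * y)) / 2))"
proof -
  let ?f = "\<lambda>n. exp (- (pi\<^sup>2 * t * (real n)\<^sup>2)) * (sin (real n * (pi * y)) / real n)"
  have all: "?f sums gauss_sine (pi\<^sup>2 * t) (pi * y)"
    using t by (intro gauss_sine_sums) simp
  have "(\<lambda>m. exp (- (4 * (pi\<^sup>2 * t) * (real m)\<^sup>2)) * (sin (real m * (2 * (pi * y))) / real m) / 2) sums
      (gauss_sine (4 * (pi\<^sup>2 * t)) (2 * (pi * y)) / 2)"
    using t by (intro sums_divide gauss_sine_sums) simp
  also have "(\<lambda>m. exp (- (4 * (pi\<^sup>2 * t) * (real m)\<^sup>2)) * (sin (real m * (2 * (pi * y))) / real m) / 2)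
      = (\<lambda>m. if even (2 * m) then ?f (2 * m) else 0)"
    by (auto simp: fun_eq_iff power_mult_distrib algebra_simps)
  finally have even: "(\<lambda>n. if even n then ?f n else 0) sums (gauss_sine (4 * (pi\<^sup>2 * t)) (2 * (pi * y)) / 2)"
    by (subst (asm) sums_mono_reindex[where f = "\<lambda>n. if even n then ?f n else 0" and g = "\<lambda>m. 2 * m"])
      (auto simp: strict_mono_def elim!: evenE)
  show ?thesis
  proof (cases "even k")
    case True
    have "(\<lambda>n. 4 / pi * (?f n - (if even n then ?f n else 0))) sums
      (4 / pi * (gauss_sine (pi\<^sup>2 * t) (pi * y) - gauss_sine (4 * (pi\<^sup>2 * t)) (2 * (pi * y)) / 2))"
      by (intro sums_mult sums_diff all even)
    moreover have "4 / pi * (?f n - (if even n then ?f n else 0)) =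
        heat_mode k t y n" for n
      using True by (auto simp: fourier_weight_def frequencies_def mult_ac)
    ultimately show ?thesis using True by (simp add: heat_def sums_iff)
  next
    case False
    have "(\<lambda>n. 4 / pi * (if even n then ?f n else 0)) sums
      (4 / pi * (gauss_sine (4 * (pi\<^sup>2 * t)) (2 * (pi * y)) / 2))"
      by (intro sums_mult even)
    moreover have "4 / pi * (if even n then ?f n else 0) =
        heat_mode k t y n" for n
      using False by (auto simp: fourier_weight_def frequencies_def mult_ac)
    ultimately show ?thesis using False by (simp add: heat_def sums_iff)
  qed
qed

lemma tendsto_heat:
  assumes y: "0 < y" "y < 1"
  shows "((\<lambda>t. heat k t y) \<longlongrightarrow> (if even k then 1 else 1 - 2 * y)) (at_right 0)"
proof -
  have f: "filterlim (\<lambda>t. c * t) (at_right 0) (at_right 0)" if "c > 0" for c :: real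
    using that by (intro filterlim_at_withinI tendsto_eq_intros)
      (auto simp: eventually_at_filter)
  have 1: "((\<lambda>t. gauss_sine (pi\<^sup>2 * t) (pi * y)) \<longlongrightarrow> (pi - pi * y) / 2) (at_right 0)"
    using y by (intro filterlim_compose[OF tendsto_gauss_sine f]) auto
  have 2: "((\<lambda>t. gauss_sine ((4 * pi\<^sup>2) * t) (2 * (pi * y))) \<longlongrightarrow> (pi - 2 * (pi * y)) / 2) (at_right 0)"
    using y by (intro filterlim_compose[OF tendsto_gauss_sine f]) auto
  have "((\<lambda>t. if even k
    then 4 / pi * (gauss_sine (pi\<^sup>2 * t) (pi * y) - gauss_sine ((4 * pi\<^sup>2) * t) (2 * (pi * y)) / 2)
    else 4 / pi * (gauss_sine ((4 * pi\<^sup>2) * t) (2 * (pi * y)) / 2)) \<longlongrightarrow>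
    (if even k then 4 / pi * ((pi - pi * y) / 2 - (pi - 2 * (pi * y)) / 2 / 2)
      else 4 / pi * ((pi - 2 * (pi * y)) / 2 / 2))) (at_right 0)"
    by (cases "even k") (simp_all only: if_True if_False, (intro tendsto_intros 1 2; simp)+)
  also have "(if even k then 4 / pi * ((pi - pi * y) / 2 - (pi - 2 * (pi * y)) / 2 / 2)
      else 4 / pi * ((pi - 2 * (pi * y)) / 2 / 2)) = (if even k then 1 else 1 - 2 * y)"
    by (simp add: field_simps)
  finally show ?thesis
    by (rule Lim_transform_eventually)
      (auto simp: eventually_at_filter heat_eq_gauss_sine mult.assoc)
qed

text \<open>Unlike \<open>heat_bound t\<close>, this bound does not grow as \<open>t\<close> tends
  to 0. The constant is \<open>4 / 3 * (13 + 13 / 2) = 26\<close>, where \<open>4 / 3\<close> comes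
  from \<open>pi > 3\<close>.\<close>

lemma heat_bounded:
  assumes "t > 0" "0 < y" "y < 1"
  shows "\<bar>heat k t y\<bar> \<le> 26"
proof -
  have 1: "\<bar>gauss_sine (pi\<^sup>2 * t) (pi * y)\<bar> \<le> 13"
    using assms pi_gt_zero by (intro gauss_sine_bounded) (auto intro: less_trans[of _ "pi * 1"])
  have 2: "\<bar>gauss_sine (4 * (pi\<^sup>2 * t)) (2 * (pi * y))\<bar> \<le> 13"
    using assms by (intro gauss_sine_bounded) auto
  have c: "4 / pi \<le> 4 / 3" using pi_gt3 by (intro divide_left_mono) auto
  have "\<bar>4 / pi * u\<bar> \<le> 26" if "\<bar>u\<bar> \<le> 39 / 2" for u
  proof -
    have "\<bar>4 / pi * u\<bar> = 4 / pi * \<bar>u\<bar>" by (simp add: abs_mult)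
    also have "\<dots> \<le> 4 / 3 * (39 / 2)" using that c by (intro mult_mono) auto
    finally show ?thesis by simp
  qed
  moreover have "\<bar>gauss_sine (pi\<^sup>2 * t) (pi * y) - gauss_sine (4 * (pi\<^sup>2 * t)) (2 * (pi * y)) / 2\<bar> \<le> 39 / 2"
    using 1 2 by argo
  moreover have "\<bar>gauss_sine (4 * (pi\<^sup>2 * t)) (2 * (pi * y)) / 2\<bar> \<le> 39 / 2" using 2 by argo
  ultimately show ?thesis unfolding heat_eq_gauss_sine[OF assms(1)] by presburger
qed

section \<open>Conditioning on the past\<close>

lemma pairs_bounds:
  assumes "\<pi> \<in> P2 k" "(i, j) \<in> pairs \<pi>"
  shows "1 \<le> i \<and> i < j \<and> j \<le> k"
proof -
  have ij: "i < j" "{i, j} \<in> \<pi>" using assms(2) by (auto simp: pairs_def)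
  have "\<Union>\<pi> = {1..k}" using assms(1) unfolding P2_def partition_on_def by blast
  then have "{i, j} \<subseteq> {1..k}" using ij(2) by blast
  with ij(1) show ?thesis by simp
qed

definition disjoint_pairs :: "nat \<Rightarrow> (nat \<times> nat) set \<Rightarrow> bool" where
  "disjoint_pairs k S \<longleftrightarrow> finite S \<and> (\<forall>(i, j)\<in>S. i \<in> {1..k} \<and> j \<in> {1..k} \<and> i \<noteq> j) \<and>
     (\<forall>p\<in>S. \<forall>q\<in>S. {fst p, snd p} \<inter> {fst q, snd q} \<noteq> {} \<longrightarrow> p = q)"

lemma disjoint_pairs_pairs:
  assumes "\<pi> \<in> P2 k"
  shows "disjoint_pairs k (pairs \<pi>)"
proof -
  have "arcs \<pi> \<in> matchings (arc_points k)" using bij_betw_apply[OF bij_betw_arcs assms] .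
  then have "p = q" if "p \<in> pairs \<pi>" "q \<in> pairs \<pi>" "{fst p, snd p} \<inter> {fst q, snd q} \<noteq> {}" for p q
    using that by (intro matchings_unique[of "arcs \<pi>"]) (auto simp: arcs_def)
  moreover have "i \<in> {1..k} \<and> j \<in> {1..k} \<and> i \<noteq> j" if "(i, j) \<in> pairs \<pi>" for i j
    using pairs_bounds[OF assms that] by auto
  ultimately show ?thesis using finite_pairs[OF assms] unfolding disjoint_pairs_def by blast
qed

lemma disjoint_pairs_insertD:
  assumes "disjoint_pairs k (insert (a, b) S)" "(a, b) \<notin> S"
  shows "disjoint_pairs k S" "a \<in> {1..k}" "b \<in> {1..k}" "a \<noteq> b"
    "\<And>i j. (i, j) \<in> S \<Longrightarrow> i \<noteq> a \<and> i \<noteq> b \<and> j \<noteq> a \<and> j \<noteq> b"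
proof -
  show "disjoint_pairs k S" "a \<in> {1..k}" "b \<in> {1..k}" "a \<noteq> b"
    using assms unfolding disjoint_pairs_def by auto
  fix i j assume "(i, j) \<in> S"
  then have "{fst (a, b), snd (a, b)} \<inter> {fst (i, j), snd (i, j)} = {}"
    using assms unfolding disjoint_pairs_def by blast
  then show "i \<noteq> a \<and> i \<noteq> b \<and> j \<noteq> a \<and> j \<noteq> b" by auto
qed

abbreviation coordinate_measure :: "nat \<Rightarrow> (nat \<Rightarrow> real) measure" where
  "coordinate_measure k \<equiv> \<Pi>\<^sub>M i\<in>{1..k}. borel"

abbreviation pair_prod :: "(nat \<times> nat) set \<Rightarrow> (real \<Rightarrow> real) \<Rightarrow> (nat \<Rightarrow> real) \<Rightarrow> real" where
  "pair_prod S h y \<equiv> \<Prod>(i, j)\<in>S. h (y i - y j)"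

lemma measurable_pair_prod:
  fixes h :: "nat \<times> nat \<Rightarrow> real \<Rightarrow> real"
  assumes S: "disjoint_pairs k S" and h: "\<And>p. h p \<in> borel_measurable borel"
  shows "(\<lambda>y. \<Prod>(i, j)\<in>S. h (i, j) (y i - y j :: real)) \<in> borel_measurable (coordinate_measure k)"
  unfolding case_prod_unfold
proof (rule borel_measurable_prod)
  fix p assume "p \<in> S"
  then have "fst p \<in> {1..k}" "snd p \<in> {1..k}" using S by (auto simp: disjoint_pairs_def)
  then have "(\<lambda>y. y (fst p) - y (snd p) :: real) \<in> borel_measurable (coordinate_measure k)"
    by (intro borel_measurable_diff measurable_component_singleton)
  from measurable_compose[OF this h]
  show "(\<lambda>y. h (fst p, snd p) (y (fst p) - y (snd p))) \<in> borel_measurable (coordinate_measure k)" .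
qed

text \<open>The parameter \<open>s\<close> is the time still to go. For a start in the alcove,
  \<open>prob_survives\<close> identifies the value with the probability of staying there that
  long.\<close>

definition alcove_value :: "nat \<Rightarrow> real \<Rightarrow> (nat \<Rightarrow> real) \<Rightarrow> real" where
  "alcove_value k s y = (\<Sum>\<pi>\<in>P2 k. (- 1) ^ crossings \<pi> * pair_prod (pairs \<pi>) (heat k s) y)"

lemma (in prob_space) expectation_cos_sin_normal:
  assumes D: "distributed M lborel Z (normal_density 0 \<sigma>)" and \<sigma>: "\<sigma> > 0"
  shows "expectation (\<lambda>\<omega>. cos (Z \<omega>)) = exp (- \<sigma>\<^sup>2 / 2)" "expectation (\<lambda>\<omega>. sin (Z \<omega>)) = 0"
proof -
  have D': "distributed M lborel (\<lambda>\<omega>. Z \<omega> / \<sigma>) std_normal_density"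
    using D normal_standard_normal_convert[OF \<sigma>, of Z 0] by simp
  then have m: "(\<lambda>\<omega>. Z \<omega> / \<sigma>) \<in> borel_measurable M"
    by (auto simp: distributed_def)
  have mZ: "Z \<in> borel_measurable M" using D by (auto simp: distributed_def)
  have "distr M lborel (\<lambda>\<omega>. Z \<omega> / \<sigma>) = std_normal_distribution"
    using D' by (auto simp: distributed_def)
  moreover have "char (distr M lborel (\<lambda>\<omega>. Z \<omega> / \<sigma>)) \<sigma> = (CLINT \<omega>|M. iexp (\<sigma> * (Z \<omega> / \<sigma>)))"
    unfolding char_def using m by (subst integral_distr) auto
  ultimately have *: "(CLINT \<omega>|M. iexp (Z \<omega>)) = complex_of_real (exp (- \<sigma>\<^sup>2 / 2))"
    using \<sigma> by (simp add: char_std_normal_distribution)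
  have int: "integrable M (\<lambda>\<omega>. iexp (Z \<omega>))"
    using mZ by (intro integrable_const_bound[of _ 1]) auto
  have "expectation (\<lambda>\<omega>. Re (iexp (Z \<omega>))) = exp (- \<sigma>\<^sup>2 / 2)"
    using integral_Re[OF int] * by (simp only: Re_complex_of_real)
  then show "expectation (\<lambda>\<omega>. cos (Z \<omega>)) = exp (- \<sigma>\<^sup>2 / 2)" by (simp add: Re_exp)
  have "expectation (\<lambda>\<omega>. Im (iexp (Z \<omega>))) = 0"
    using integral_Im[OF int] * by (simp only: Im_complex_of_real)
  then show "expectation (\<lambda>\<omega>. sin (Z \<omega>)) = 0" by (simp add: Im_exp)
qed

lemma borel_measurable_heat [measurable]: "(\<lambda>y. heat k t y) \<in> borel_measurable borel"
  unfolding heat_def by measurable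

lemma abs_prod_le_power:
  assumes "\<And>p. p \<in> S \<Longrightarrow> \<bar>f p :: real\<bar> \<le> B"
  shows "\<bar>prod f S\<bar> \<le> B ^ card S"
proof -
  have "(\<Prod>p\<in>S. \<bar>f p\<bar>) \<le> (\<Prod>p\<in>S. B)" using assms by (intro prod_mono conjI abs_ge_zero)
  then show ?thesis by (simp add: abs_prod)
qed

locale brownian_alcove = brownian_motion +
  assumes V: "V = full_space k \<or> V = zero_sum_space k"
begin

lemma X_extensional: "t \<ge> 0 \<Longrightarrow> \<omega> \<in> space M \<Longrightarrow> X t \<omega> \<in> extensional {1..k}"
  using state_space[of t \<omega>] V by (auto simp: full_space_def zero_sum_space_def PiE_def)

lemma measurable_X [measurable]: "t \<ge> 0 \<Longrightarrow> i \<in> {1..k} \<Longrightarrow> (\<lambda>\<omega>. X t \<omega> i) \<in> borel_measurable M"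
  using measurable_compose[OF random_vector measurable_component_singleton] by blast

text \<open>A vector with coordinate sum 0 belongs to both choices of \<open>V\<close>, so the
  Gaussian law of the increments is available in either case. That law is given for nonzero vectors,
  hence the case split.\<close>

lemma increment_cos_sin:
  assumes "0 \<le> s" "s < t" and \<xi>: "(\<Sum>i=1..k. \<xi> i) = 0"
  shows "expectation (\<lambda>\<omega>. cos (\<Sum>i=1..k. \<xi> i * (X t \<omega> i - X s \<omega> i))) = exp (- ((t - s) * (\<Sum>i=1..k. (\<xi> i)\<^sup>2)) / 2)"
    "expectation (\<lambda>\<omega>. sin (\<Sum>i=1..k. \<xi> i * (X t \<omega> i - X s \<omega> i))) = 0"
proof -
  have "expectation (\<lambda>\<omega>. cos (\<Sum>i=1..k. \<xi> i * (X t \<omega> i - X s \<omega> i))) = exp (- ((t - s) * (\<Sum>i=1..k. (\<xi> i)\<^sup>2)) / 2) \<and>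
    expectation (\<lambda>\<omega>. sin (\<Sum>i=1..k. \<xi> i * (X t \<omega> i - X s \<omega> i))) = 0"
  proof (cases "(\<Sum>i=1..k. (\<xi> i)\<^sup>2) = 0")
    case True
    then have "\<xi> i = 0" if "i \<in> {1..k}" for i
      using that by (subst (asm) sum_nonneg_eq_0_iff) auto
    then have "(\<Sum>i=1..k. \<xi> i * (X t \<omega> i - X s \<omega> i)) = 0" for \<omega>
      by (intro sum.neutral) auto
    then show ?thesis using True by (simp add: prob_space)
  next
    case False
    let ?v = "restrict \<xi> {1..k}"
    have v: "?v \<in> V" using V \<xi> by (auto simp: full_space_def zero_sum_space_def)
    have n: "(\<Sum>i=1..k. (?v i)\<^sup>2) = (\<Sum>i=1..k. (\<xi> i)\<^sup>2)" by (intro sum.cong) auto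
    have pos: "(\<Sum>i=1..k. (\<xi> i)\<^sup>2) > 0" using False by (simp add: order.not_eq_order_implies_strict sum_nonneg)
    have "distributed M lborel (\<lambda>\<omega>. \<Sum>i=1..k. ?v i * (X t \<omega> i - X s \<omega> i))
        (normal_density 0 (sqrt ((t - s) * (\<Sum>i=1..k. (?v i)\<^sup>2))))"
      using False assms n by (intro gaussian_increments v) auto
    moreover have "(\<Sum>i=1..k. ?v i * (X t \<omega> i - X s \<omega> i)) = (\<Sum>i=1..k. \<xi> i * (X t \<omega> i - X s \<omega> i))" for \<omega>
      by (intro sum.cong) auto
    ultimately have "distributed M lborel (\<lambda>\<omega>. \<Sum>i=1..k. \<xi> i * (X t \<omega> i - X s \<omega> i))
        (normal_density 0 (sqrt ((t - s) * (\<Sum>i=1..k. (\<xi> i)\<^sup>2))))"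
      unfolding n by simp
    from expectation_cos_sin_normal[OF this] show ?thesis using assms pos by simp
  qed
  then show "expectation (\<lambda>\<omega>. cos (\<Sum>i=1..k. \<xi> i * (X t \<omega> i - X s \<omega> i))) = exp (- ((t - s) * (\<Sum>i=1..k. (\<xi> i)\<^sup>2)) / 2)"
    "expectation (\<lambda>\<omega>. sin (\<Sum>i=1..k. \<xi> i * (X t \<omega> i - X s \<omega> i))) = 0" by blast+
qed

section \<open>The martingale property on a time grid\<close>

context
  fixes \<tau> :: "nat \<Rightarrow> real" and g :: "nat \<Rightarrow> (nat \<Rightarrow> real) \<Rightarrow> real" and n :: nat
  assumes \<tau>0: "\<tau> 0 = 0" and \<tau>: "\<And>j. \<tau> j < \<tau> (Suc j)"
    and g_meas [measurable]: "\<And>j. g j \<in> borel_measurable (coordinate_measure k)" and g_bound: "\<And>j y. \<bar>g j y\<bar> \<le> 1"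
begin

text \<open>Conditional expectations are replaced by integrals against these bounded functions of
  the positions up to grid time \<open>n\<close>. In the stopping argument every \<open>g j\<close>
  is the indicator that the gap still exceeds \<open>\<delta>\<close>.\<close>

definition past :: "'a \<Rightarrow> real" where "past \<omega> = (\<Prod>j\<le>n. g j (X (\<tau> j) \<omega>))"

lemma \<tau>_nonneg: "0 \<le> \<tau> j"
proof (induction j)
  case (Suc j)
  then show ?case using \<tau>[of j] by simp
qed (simp add: \<tau>0)

lemma past_measurable [measurable]: "past \<in> borel_measurable M"
  unfolding past_def using measurable_compose[OF random_vector g_meas] \<tau>_nonneg
  by (intro borel_measurable_prod) auto

lemma past_bound: "\<bar>past \<omega>\<bar> \<le> 1"
  unfolding past_def abs_prod using g_bound by (intro prod_le_1) auto

lemma integrable_past_mult: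
  assumes "f \<in> borel_measurable M" "\<And>\<omega>. \<bar>f \<omega>\<bar> \<le> C"
  shows "integrable M (\<lambda>\<omega>. past \<omega> * f \<omega>)"
proof (rule integrable_const_bound[of _ C])
  show "AE \<omega> in M. norm (past \<omega> * f \<omega>) \<le> C"
    using mult_mono[OF past_bound assms(2)] by (auto simp: abs_mult)
qed (use assms in measurable)

text \<open>Almost surely the path starts at \<open>x\<close>, so every position up to
  \<open>\<tau> n\<close> is \<open>x\<close> plus a sum of increments with index below
  \<open>n\<close>, and these are jointly independent of the increment with index
  \<open>n\<close>.\<close>

lemma past_indep_increment:
  assumes F: "F \<in> borel_measurable (coordinate_measure k)" and H: "H \<in> borel_measurable (coordinate_measure k)" and bd: "\<And>y. \<bar>F y\<bar> \<le> 1" "\<And>y. \<bar>H y\<bar> \<le> 1"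
  shows "expectation (\<lambda>\<omega>. past \<omega> * F (X (\<tau> n) \<omega>) * H (\<lambda>i\<in>{1..k}. X (\<tau> (Suc n)) \<omega> i - X (\<tau> n) \<omega> i))
    = expectation (\<lambda>\<omega>. past \<omega> * F (X (\<tau> n) \<omega>)) *
      expectation (\<lambda>\<omega>. H (\<lambda>i\<in>{1..k}. X (\<tau> (Suc n)) \<omega> i - X (\<tau> n) \<omega> i))"
proof -
  define Inc where "Inc j \<omega> = (\<lambda>i\<in>{1..k}. X (\<tau> (Suc j)) \<omega> i - X (\<tau> j) \<omega> i)" for j \<omega>
  define pos where "pos z j = (\<lambda>i\<in>{1..k}. x i + (\<Sum>m<j. z m i))" for z :: "nat \<Rightarrow> nat \<Rightarrow> real" and j :: nat
  define P where "P z = (\<Prod>j\<le>n. g j (pos z j)) * F (pos z n)" for z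
  define past' where "past' \<omega> = P (restrict (\<lambda>j. Inc j \<omega>) {..<n})" for \<omega>
  have indep: "indep_vars (\<lambda>_. coordinate_measure k) Inc {..<Suc n}"
    unfolding Inc_def using \<tau> \<tau>_nonneg less_imp_le by (intro independent_increments) auto
  have pos_meas: "(\<lambda>z. pos z j) \<in> measurable (PiM {..<n} (\<lambda>_. coordinate_measure k)) (coordinate_measure k)" if "j \<le> n" for j
    unfolding pos_def
  proof (rule measurable_restrict)
    fix i assume "i \<in> {1..k}"
    then show "(\<lambda>z. x i + (\<Sum>m<j. z m i)) \<in> borel_measurable (PiM {..<n} (\<lambda>_. coordinate_measure k))"
      using that by (intro borel_measurable_add borel_measurable_sum borel_measurable_const
          measurable_compose[OF measurable_component_singleton[of _ "{..<n}"] measurable_component_singleton]) auto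
  qed
  have P_meas: "P \<in> borel_measurable (PiM {..<n} (\<lambda>_. coordinate_measure k))"
    unfolding P_def
    by (intro borel_measurable_times borel_measurable_prod measurable_compose[OF pos_meas g_meas]
        measurable_compose[OF pos_meas F]) auto
  have "indep_var (PiM {..<n} (\<lambda>_. coordinate_measure k)) (\<lambda>\<omega>. restrict (\<lambda>j. Inc j \<omega>) {..<n})
      (PiM {n} (\<lambda>_. coordinate_measure k)) (\<lambda>\<omega>. restrict (\<lambda>j. Inc j \<omega>) {n})"
    by (rule indep_var_restrict[OF indep]) auto
  then have iv: "indep_var borel (P \<circ> (\<lambda>\<omega>. restrict (\<lambda>j. Inc j \<omega>) {..<n}))
      borel ((\<lambda>z. H (z n)) \<circ> (\<lambda>\<omega>. restrict (\<lambda>j. Inc j \<omega>) {n}))"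
    by (rule indep_var_compose[OF _ P_meas])
      (rule measurable_compose[OF measurable_component_singleton[of n "{n}" "\<lambda>_. (coordinate_measure k)"] H], simp)
  have eq1: "P \<circ> (\<lambda>\<omega>. restrict (\<lambda>j. Inc j \<omega>) {..<n}) = past'"
    by (auto simp: past'_def fun_eq_iff)
  have eq2: "(\<lambda>z. H (z n)) \<circ> (\<lambda>\<omega>. restrict (\<lambda>j. Inc j \<omega>) {n}) = (\<lambda>\<omega>. H (Inc n \<omega>))"
    by (auto simp: fun_eq_iff)
  have iv': "indep_var borel past' borel (\<lambda>\<omega>. H (Inc n \<omega>))"
    using iv unfolding eq1 eq2 .
  have m: "past' \<in> borel_measurable M" "(\<lambda>\<omega>. H (Inc n \<omega>)) \<in> borel_measurable M"
    using indep_var_rv1[OF iv'] indep_var_rv2[OF iv'] by auto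
  have b: "\<bar>past' \<omega>\<bar> \<le> 1" for \<omega>
  proof -
    have "\<bar>\<Prod>j\<le>n. g j (pos z j)\<bar> * \<bar>F (pos z n)\<bar> \<le> 1 * 1" for z
      using bd g_bound unfolding abs_prod by (intro mult_mono prod_le_1) auto
    then show ?thesis by (simp add: past'_def P_def abs_mult)
  qed
  have "integrable M past'" using m b by (intro integrable_const_bound[of _ 1]) auto
  moreover have "integrable M (\<lambda>\<omega>. H (Inc n \<omega>))" using m bd by (intro integrable_const_bound[of _ 1]) auto
  ultimately have eq: "expectation (\<lambda>\<omega>. past' \<omega> * H (Inc n \<omega>)) = expectation past' * expectation (\<lambda>\<omega>. H (Inc n \<omega>))"
    by (rule indep_var_lebesgue_integral[OF iv'])
  have Xpos: "X (\<tau> j) \<omega> = pos (restrict (\<lambda>j. Inc j \<omega>) {..<n}) j"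
    if "X 0 \<omega> = x" "\<omega> \<in> space M" "j \<le> n" for j \<omega>
  proof
    fix i
    show "X (\<tau> j) \<omega> i = pos (restrict (\<lambda>j. Inc j \<omega>) {..<n}) j i"
    proof (cases "i \<in> {1..k}")
      case True
      have "(\<Sum>m<j. X (\<tau> (Suc m)) \<omega> i - X (\<tau> m) \<omega> i) = X (\<tau> j) \<omega> i - X (\<tau> 0) \<omega> i"
        by (rule sum_lessThan_telescope)
      moreover have "(\<Sum>m<j. restrict (\<lambda>j. Inc j \<omega>) {..<n} m i) = (\<Sum>m<j. X (\<tau> (Suc m)) \<omega> i - X (\<tau> m) \<omega> i)"
        using True that by (intro sum.cong) (auto simp: Inc_def)
      ultimately show ?thesis using True that(1) by (simp add: pos_def \<tau>0)
    next
      \<comment> \<open>The functions must also agree outside \<open>{1..k}\<close>, where both are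
        \<open>undefined\<close>.\<close>
      case False
      then show ?thesis using X_extensional[OF \<tau>_nonneg that(2), of j] by (auto simp: pos_def extensional_def)
    qed
  qed
  have ae: "AE \<omega> in M. past \<omega> * F (X (\<tau> n) \<omega>) = past' \<omega>"
    using start
  proof (rule AE_mp, intro AE_I2 impI)
    fix \<omega> assume "\<omega> \<in> space M" "X 0 \<omega> = x"
    then show "past \<omega> * F (X (\<tau> n) \<omega>) = past' \<omega>"
      using Xpos by (auto simp: past_def past'_def P_def intro!: prod.cong)
  qed
  have pm: "(\<lambda>\<omega>. past \<omega> * F (X (\<tau> n) \<omega>)) \<in> borel_measurable M"
    using measurable_compose[OF random_vector F] \<tau>_nonneg by (intro borel_measurable_times past_measurable) auto
  have "expectation (\<lambda>\<omega>. past \<omega> * F (X (\<tau> n) \<omega>) * H (Inc n \<omega>)) = expectation (\<lambda>\<omega>. past' \<omega> * H (Inc n \<omega>))"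
    using ae pm m by (intro integral_cong_AE) (auto elim: AE_mp)
  moreover have "expectation (\<lambda>\<omega>. past \<omega> * F (X (\<tau> n) \<omega>)) = expectation past'"
    using ae pm m by (intro integral_cong_AE) auto
  ultimately show ?thesis using eq by (simp add: Inc_def)
qed

text \<open>The addition formula splits the new phase into the old phase and that of the increment;
  the sine of the latter has mean zero, its cosine gives the factor.\<close>

lemma past_cos_step:
  assumes \<xi>: "(\<Sum>i=1..k. \<xi> i) = 0"
  shows "expectation (\<lambda>\<omega>. past \<omega> * cos ((\<Sum>i=1..k. \<xi> i * X (\<tau> (Suc n)) \<omega> i) + c))
    = exp (- ((\<tau> (Suc n) - \<tau> n) * (\<Sum>i=1..k. (\<xi> i)\<^sup>2)) / 2) *
      expectation (\<lambda>\<omega>. past \<omega> * cos ((\<Sum>i=1..k. \<xi> i * X (\<tau> n) \<omega> i) + c))"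
proof -
  let ?L = "\<lambda>y. \<Sum>i=1..k. \<xi> i * y i"
  let ?I = "\<lambda>\<omega>. \<lambda>i\<in>{1..k}. X (\<tau> (Suc n)) \<omega> i - X (\<tau> n) \<omega> i"
  have L: "?L \<in> borel_measurable (coordinate_measure k)" by (intro borel_measurable_sum borel_measurable_times) auto
  have meas: "(\<lambda>y. cos (?L y + c)) \<in> borel_measurable (coordinate_measure k)" "(\<lambda>y. sin (?L y + c)) \<in> borel_measurable (coordinate_measure k)"
    "(\<lambda>y. cos (?L y)) \<in> borel_measurable (coordinate_measure k)" "(\<lambda>y. sin (?L y)) \<in> borel_measurable (coordinate_measure k)"
    using L by measurable
  have LI: "?L (?I \<omega>) = (\<Sum>i=1..k. \<xi> i * (X (\<tau> (Suc n)) \<omega> i - X (\<tau> n) \<omega> i))" for \<omega>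
    by (intro sum.cong) auto
  have L1: "?L (X (\<tau> (Suc n)) \<omega>) + c = (?L (X (\<tau> n) \<omega>) + c) + ?L (?I \<omega>)" for \<omega>
    unfolding LI by (simp add: right_diff_distrib sum_subtractf)
  have mX: "(\<lambda>\<omega>. ?L (X (\<tau> j) \<omega>)) \<in> borel_measurable M" for j
    by (rule measurable_compose[OF random_vector[OF \<tau>_nonneg] L])
  have mI: "(\<lambda>\<omega>. ?L (?I \<omega>)) \<in> borel_measurable M"
    unfolding LI using \<tau>_nonneg by (intro borel_measurable_sum borel_measurable_times borel_measurable_diff) auto
  have "expectation (\<lambda>\<omega>. past \<omega> * cos (?L (X (\<tau> (Suc n)) \<omega>) + c))
    = expectation (\<lambda>\<omega>. past \<omega> * cos (?L (X (\<tau> n) \<omega>) + c) * cos (?L (?I \<omega>))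
        - past \<omega> * sin (?L (X (\<tau> n) \<omega>) + c) * sin (?L (?I \<omega>)))"
    unfolding L1 cos_add by (simp add: algebra_simps)
  also have "\<dots> = expectation (\<lambda>\<omega>. past \<omega> * cos (?L (X (\<tau> n) \<omega>) + c) * cos (?L (?I \<omega>)))
        - expectation (\<lambda>\<omega>. past \<omega> * sin (?L (X (\<tau> n) \<omega>) + c) * sin (?L (?I \<omega>)))"
  proof (rule Bochner_Integration.integral_diff)
    have "integrable M (\<lambda>\<omega>. past \<omega> * (cos (?L (X (\<tau> n) \<omega>) + c) * cos (?L (?I \<omega>))))"
      "integrable M (\<lambda>\<omega>. past \<omega> * (sin (?L (X (\<tau> n) \<omega>) + c) * sin (?L (?I \<omega>))))"
      by (rule integrable_past_mult[of _ 1], use mX mI in measurable, use mult_mono[OF abs_cos_le_one abs_cos_le_one]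
          mult_mono[OF abs_sin_le_one abs_sin_le_one] in \<open>simp add: abs_mult\<close>)+
    then show "integrable M (\<lambda>\<omega>. past \<omega> * cos (?L (X (\<tau> n) \<omega>) + c) * cos (?L (?I \<omega>)))"
      "integrable M (\<lambda>\<omega>. past \<omega> * sin (?L (X (\<tau> n) \<omega>) + c) * sin (?L (?I \<omega>)))"
      by (simp_all only: mult.assoc)
  qed
  also have "expectation (\<lambda>\<omega>. past \<omega> * cos (?L (X (\<tau> n) \<omega>) + c) * cos (?L (?I \<omega>)))
      = expectation (\<lambda>\<omega>. past \<omega> * cos (?L (X (\<tau> n) \<omega>) + c)) * expectation (\<lambda>\<omega>. cos (?L (?I \<omega>)))"
    by (rule past_indep_increment[OF meas(1,3)]) auto
  also have "expectation (\<lambda>\<omega>. past \<omega> * sin (?L (X (\<tau> n) \<omega>) + c) * sin (?L (?I \<omega>)))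
      = expectation (\<lambda>\<omega>. past \<omega> * sin (?L (X (\<tau> n) \<omega>) + c)) * expectation (\<lambda>\<omega>. sin (?L (?I \<omega>)))"
    by (rule past_indep_increment[OF meas(2,4)]) auto
  finally show ?thesis
    unfolding LI increment_cos_sin[OF \<tau>_nonneg \<tau> \<xi>] by simp
qed

text \<open>The cosine factor makes the induction over the pairs go through: \<open>sin a cos b\<close> is half a sum
  of two shifted cosines, and disjoint pairs have orthogonal frequency vectors.\<close>

lemma past_sin_prod_step:
  assumes S: "disjoint_pairs k S" and \<xi>: "(\<Sum>i=1..k. \<xi> i) = 0" "\<And>i j. (i, j) \<in> S \<Longrightarrow> \<xi> i = 0 \<and> \<xi> j = 0"
  shows "expectation (\<lambda>\<omega>. past \<omega> * ((\<Prod>(i, j)\<in>S. sin (pi * real (l (i, j)) * (X (\<tau> (Suc n)) \<omega> i - X (\<tau> (Suc n)) \<omega> j)))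
        * cos ((\<Sum>i=1..k. \<xi> i * X (\<tau> (Suc n)) \<omega> i) + c)))
    = exp (- ((\<tau> (Suc n) - \<tau> n) * ((\<Sum>i=1..k. (\<xi> i)\<^sup>2) + (\<Sum>p\<in>S. 2 * (pi * real (l p))\<^sup>2))) / 2) *
      expectation (\<lambda>\<omega>. past \<omega> * ((\<Prod>(i, j)\<in>S. sin (pi * real (l (i, j)) * (X (\<tau> n) \<omega> i - X (\<tau> n) \<omega> j)))
        * cos ((\<Sum>i=1..k. \<xi> i * X (\<tau> n) \<omega> i) + c)))"
proof -
  have "finite S" using S by (simp add: disjoint_pairs_def)
  then show ?thesis using assms
  proof (induction S arbitrary: \<xi> c rule: finite_induct)
    case empty
    then show ?case using past_cos_step[of \<xi> c] by simp
  next
    case (insert p S)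
    obtain a b where p: "p = (a, b)" by (cases p)
    note D = disjoint_pairs_insertD[OF insert.prems(1)[unfolded p] insert.hyps(2)[unfolded p]]
    define \<alpha> where "\<alpha> = pi * real (l (a, b))"
    define e where "e i = (if i = a then \<alpha> else 0) - (if i = b then \<alpha> else 0)" for i
    let ?P = "\<lambda>y. \<Prod>(i, j)\<in>S. sin (pi * real (l (i, j)) * (y i - y j))"
    let ?L = "\<lambda>\<xi> y. \<Sum>i=1..k. \<xi> i * (y i :: real)"
    let ?f = "\<lambda>\<omega>. \<lambda>y. past \<omega> * ((\<Prod>(i, j)\<in>insert p S. sin (pi * real (l (i, j)) * (y i - y j))) * cos (?L \<xi> y + c))"
    define \<xi>1 where "\<xi>1 i = \<xi> i + e i" for i
    define \<xi>2 where "\<xi>2 i = e i - \<xi> i" for i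
    let ?f1 = "\<lambda>\<omega> y. past \<omega> * (?P y * cos (?L \<xi>1 y + (c - pi / 2)))"
    let ?f2 = "\<lambda>\<omega> y. past \<omega> * (?P y * cos (?L \<xi>2 y + (- c - pi / 2)))"
    have Le: "(\<Sum>i=1..k. e i * y i) = \<alpha> * (y a - y b)" for y
    proof -
      have "(\<Sum>i=1..k. e i * y i) = (\<Sum>i=1..k. (if i = a then \<alpha> * y i else 0)) - (\<Sum>i=1..k. (if i = b then \<alpha> * y i else 0))"
        unfolding sum_subtractf[symmetric] by (intro sum.cong) (auto simp: e_def algebra_simps)
      then show ?thesis using D(2,3) by (simp add: right_diff_distrib)
    qed
    have e0: "(\<Sum>i=1..k. e i) = 0" using Le[of "\<lambda>_. 1"] by simp
    have e2: "(\<Sum>i=1..k. (e i)\<^sup>2) = 2 * \<alpha>\<^sup>2"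
      using Le[of e] D(4) by (simp add: power2_eq_square) (simp add: e_def)
    have \<xi>ab: "\<xi> a = 0" "\<xi> b = 0" using insert.prems(3)[of a b] by (simp_all add: p)
    have \<xi>e: "\<xi> i * e i = 0" for i using \<xi>ab by (auto simp: e_def)
    have half: "?f \<omega> y = (?f1 \<omega> y + ?f2 \<omega> y) / 2" for \<omega> y
    proof -
      have 1: "?L \<xi>1 y = \<alpha> * (y a - y b) + ?L \<xi> y" "?L \<xi>2 y = \<alpha> * (y a - y b) - ?L \<xi> y"
        using Le[of y] by (simp_all add: \<xi>1_def \<xi>2_def ring_distribs sum.distrib sum_subtractf)
      have 2: "sin A * cos B = (cos (A + B - pi / 2) + cos (A - B - pi / 2)) / 2" for A B :: real
        by (simp add: cos_diff sin_add sin_diff)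
      have "(\<Prod>(i, j)\<in>insert p S. sin (pi * real (l (i, j)) * (y i - y j))) = sin (\<alpha> * (y a - y b)) * ?P y"
        using insert.hyps by (simp add: p \<alpha>_def)
      then have "?f \<omega> y = past \<omega> * ?P y * (sin (\<alpha> * (y a - y b)) * cos (?L \<xi> y + c))" by (simp add: mult_ac)
      also have "\<dots> = (?f1 \<omega> y + ?f2 \<omega> y) / 2"
        unfolding 2 1 by (simp add: algebra_simps add_divide_distrib)
      finally show ?thesis .
    qed
    have P_meas: "?P \<in> borel_measurable (coordinate_measure k)"
      by (rule measurable_pair_prod[OF D(1)]) measurable
    have P_bound: "\<bar>?P y\<bar> \<le> 1" for y
      unfolding abs_prod by (intro prod_le_1) (auto split: prod.splits)
    have int: "integrable M (\<lambda>\<omega>. past \<omega> * (?P (X (\<tau> j) \<omega>) * cos (?L \<zeta> (X (\<tau> j) \<omega>) + d)))" for j \<zeta> d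
    proof (rule integrable_past_mult)
      have "(\<lambda>y. ?P y * cos (?L \<zeta> y + d)) \<in> borel_measurable (coordinate_measure k)"
        using P_meas by measurable
      from measurable_compose[OF random_vector[OF \<tau>_nonneg[of j]] this]
      show "(\<lambda>\<omega>. ?P (X (\<tau> j) \<omega>) * cos (?L \<zeta> (X (\<tau> j) \<omega>) + d)) \<in> borel_measurable M" .
      show "\<bar>?P (X (\<tau> j) \<omega>) * cos (?L \<zeta> (X (\<tau> j) \<omega>) + d)\<bar> \<le> 1" for \<omega>
        using mult_mono[OF P_bound[of "X (\<tau> j) \<omega>"] abs_cos_le_one] by (simp only: abs_mult) auto
    qed
    have split: "expectation (\<lambda>\<omega>. ?f \<omega> (X (\<tau> j) \<omega>)) =
        (expectation (\<lambda>\<omega>. ?f1 \<omega> (X (\<tau> j) \<omega>)) + expectation (\<lambda>\<omega>. ?f2 \<omega> (X (\<tau> j) \<omega>))) / 2" for j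
      unfolding half using int by simp
    have \<xi>12: "(\<Sum>i=1..k. \<xi>1 i) = 0" "(\<Sum>i=1..k. \<xi>2 i) = 0"
      using e0 insert.prems(2) by (simp_all add: \<xi>1_def \<xi>2_def sum.distrib sum_subtractf)
    have \<xi>S: "\<xi>1 i = 0 \<and> \<xi>1 j = 0" "\<xi>2 i = 0 \<and> \<xi>2 j = 0" if "(i, j) \<in> S" for i j
      using insert.prems(3)[of i j] D(5)[OF that] that by (auto simp: \<xi>1_def \<xi>2_def e_def)
    have sq': "(\<xi>1 i)\<^sup>2 = (\<xi> i)\<^sup>2 + (e i)\<^sup>2" "(\<xi>2 i)\<^sup>2 = (\<xi> i)\<^sup>2 + (e i)\<^sup>2" for i
    proof -
      have "(\<xi>1 i)\<^sup>2 = (\<xi> i)\<^sup>2 + (e i)\<^sup>2 + 2 * (\<xi> i * e i)" "(\<xi>2 i)\<^sup>2 = (\<xi> i)\<^sup>2 + (e i)\<^sup>2 - 2 * (\<xi> i * e i)"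
        by (simp_all add: \<xi>1_def \<xi>2_def power2_eq_square algebra_simps)
      then show "(\<xi>1 i)\<^sup>2 = (\<xi> i)\<^sup>2 + (e i)\<^sup>2" "(\<xi>2 i)\<^sup>2 = (\<xi> i)\<^sup>2 + (e i)\<^sup>2"
        unfolding \<xi>e by simp_all
    qed
    have sq: "(\<Sum>i=1..k. (\<xi>1 i)\<^sup>2) = (\<Sum>i=1..k. (\<xi> i)\<^sup>2) + 2 * \<alpha>\<^sup>2"
      "(\<Sum>i=1..k. (\<xi>2 i)\<^sup>2) = (\<Sum>i=1..k. (\<xi> i)\<^sup>2) + 2 * \<alpha>\<^sup>2"
      unfolding e2[symmetric] sum.distrib[symmetric] sq' by (rule refl)+
    have exps: "(\<Sum>p\<in>insert p S. 2 * (pi * real (l p))\<^sup>2) = 2 * \<alpha>\<^sup>2 + (\<Sum>p\<in>S. 2 * (pi * real (l p))\<^sup>2)"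
      using insert.hyps by (simp add: p \<alpha>_def)
    let ?E = "exp (- ((\<tau> (Suc n) - \<tau> n) * ((\<Sum>i=1..k. (\<xi> i)\<^sup>2) + 2 * \<alpha>\<^sup>2 + (\<Sum>p\<in>S. 2 * (pi * real (l p))\<^sup>2))) / 2)"
    have IH1: "expectation (\<lambda>\<omega>. ?f1 \<omega> (X (\<tau> (Suc n)) \<omega>)) = ?E * expectation (\<lambda>\<omega>. ?f1 \<omega> (X (\<tau> n) \<omega>))"
      using insert.IH[OF D(1) \<xi>12(1) \<xi>S(1), of "c - pi / 2"] unfolding sq .
    have IH2: "expectation (\<lambda>\<omega>. ?f2 \<omega> (X (\<tau> (Suc n)) \<omega>)) = ?E * expectation (\<lambda>\<omega>. ?f2 \<omega> (X (\<tau> n) \<omega>))"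
      using insert.IH[OF D(1) \<xi>12(2) \<xi>S(2), of "- c - pi / 2"] unfolding sq .
    have "expectation (\<lambda>\<omega>. ?f \<omega> (X (\<tau> (Suc n)) \<omega>)) = ?E * expectation (\<lambda>\<omega>. ?f \<omega> (X (\<tau> n) \<omega>))"
      unfolding split IH1 IH2 by (simp add: distrib_left)
    then show ?case unfolding exps by (simp only: add.assoc)
  qed
qed

lemma past_prod_measurable:
  fixes h :: "real \<Rightarrow> real"
  assumes S: "disjoint_pairs k S" and h: "h \<in> borel_measurable borel"
  shows "(\<lambda>\<omega>. pair_prod S h (X (\<tau> m) \<omega>)) \<in> borel_measurable M"
  by (rule measurable_compose[OF random_vector[OF \<tau>_nonneg] measurable_pair_prod[OF S, of "\<lambda>_. h"]]) (rule h)

text \<open>Truncation turns the product of series into a finite sum over frequency tuples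
  \<open>l\<close>. Each product of sines is damped by exactly the factor that carries its
  coefficient \<open>q l s\<close> to the later time.\<close>

lemma past_heat_partial_step:
  assumes S: "disjoint_pairs k S"
  shows "expectation (\<lambda>\<omega>. past \<omega> * pair_prod S (heat_partial N k s) (X (\<tau> (Suc n)) \<omega>))
    = expectation (\<lambda>\<omega>. past \<omega> * pair_prod S (heat_partial N k (s + (\<tau> (Suc n) - \<tau> n))) (X (\<tau> n) \<omega>))"
proof -
  have fin: "finite S" using S by (simp add: disjoint_pairs_def)
  let ?\<Delta> = "\<tau> (Suc n) - \<tau> n"
  define q where "q l s = (\<Prod>p\<in>S. fourier_weight k (l p) * exp (- (pi\<^sup>2 * s * (real (l p))\<^sup>2)) / real (l p))"
    for l :: "nat \<times> nat \<Rightarrow> nat" and s :: real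
  define Q where "Q l y = (\<Prod>(i, j)\<in>S. sin (pi * real (l (i, j)) * (y i - y j)))"
    for l :: "nat \<times> nat \<Rightarrow> nat" and y :: "nat \<Rightarrow> real"
  have expand: "pair_prod S (heat_partial N k s) y = (\<Sum>l\<in>S \<rightarrow>\<^sub>E {..<N}. q l s * Q l y)" for s y
  proof -
    have "pair_prod S (heat_partial N k s) y = (\<Sum>l\<in>S \<rightarrow>\<^sub>E {..<N}. \<Prod>p\<in>S. fourier_weight k (l p) *
        exp (- (pi\<^sup>2 * s * (real (l p))\<^sup>2)) * (sin (pi * real (l p) * (y (fst p) - y (snd p))) / real (l p)))"
      unfolding heat_partial_def case_prod_unfold using fin by (intro prod_sum_PiE) auto
    also have "\<dots> = (\<Sum>l\<in>S \<rightarrow>\<^sub>E {..<N}. q l s * Q l y)"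
      unfolding q_def Q_def case_prod_unfold prod.distrib[symmetric] by (intro sum.cong prod.cong refl) simp
    finally show ?thesis .
  qed
  have fin': "finite (S \<rightarrow>\<^sub>E {..<N})" using fin by (intro finite_PiE) auto
  have int: "integrable M (\<lambda>\<omega>. past \<omega> * Q l (X (\<tau> m) \<omega>))" for l m
  proof (rule integrable_past_mult)
    show "(\<lambda>\<omega>. Q l (X (\<tau> m) \<omega>)) \<in> borel_measurable M"
      unfolding Q_def
      by (rule measurable_compose[OF random_vector[OF \<tau>_nonneg[of m]]
          measurable_pair_prod[OF S, of "\<lambda>p u. sin (pi * real (l p) * u)"]]) measurable
    show "\<bar>Q l (X (\<tau> m) \<omega>)\<bar> \<le> 1" for \<omega>
      unfolding Q_def abs_prod by (intro prod_le_1) (auto split: prod.splits)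
  qed
  have E: "expectation (\<lambda>\<omega>. past \<omega> * (\<Sum>l\<in>S \<rightarrow>\<^sub>E {..<N}. q l s * Q l (X (\<tau> m) \<omega>)))
    = (\<Sum>l\<in>S \<rightarrow>\<^sub>E {..<N}. q l s * expectation (\<lambda>\<omega>. past \<omega> * Q l (X (\<tau> m) \<omega>)))" for s m
  proof -
    have "(\<lambda>\<omega>. past \<omega> * (\<Sum>l\<in>S \<rightarrow>\<^sub>E {..<N}. q l s * Q l (X (\<tau> m) \<omega>)))
      = (\<lambda>\<omega>. \<Sum>l\<in>S \<rightarrow>\<^sub>E {..<N}. q l s * (past \<omega> * Q l (X (\<tau> m) \<omega>)))"
      unfolding sum_distrib_left by (intro ext sum.cong refl) simp
    then show ?thesis using int by (simp add: Bochner_Integration.integral_sum)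
  qed
  have step: "expectation (\<lambda>\<omega>. past \<omega> * Q l (X (\<tau> (Suc n)) \<omega>))
     = exp (- (?\<Delta> * (\<Sum>p\<in>S. 2 * (pi * real (l p))\<^sup>2)) / 2) * expectation (\<lambda>\<omega>. past \<omega> * Q l (X (\<tau> n) \<omega>))" for l
    using past_sin_prod_step[OF S, of "\<lambda>_. 0" l 0] by (simp add: Q_def)
  have q: "q l s * exp (- (?\<Delta> * (\<Sum>p\<in>S. 2 * (pi * real (l p))\<^sup>2)) / 2) = q l (s + ?\<Delta>)" for l
  proof -
    have arith: "- (d * (2 * (u * v)\<^sup>2)) / 2 = - (u\<^sup>2 * d * v\<^sup>2)" for d u v :: real
      by (simp add: power2_eq_square)
    have "- (?\<Delta> * (\<Sum>p\<in>S. 2 * (pi * real (l p))\<^sup>2)) / 2 = (\<Sum>p\<in>S. - (pi\<^sup>2 * ?\<Delta> * (real (l p))\<^sup>2))"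
      unfolding sum_distrib_left sum_negf[symmetric] sum_divide_distrib arith ..
    then have e1: "exp (- (?\<Delta> * (\<Sum>p\<in>S. 2 * (pi * real (l p))\<^sup>2)) / 2) = (\<Prod>p\<in>S. exp (- (pi\<^sup>2 * ?\<Delta> * (real (l p))\<^sup>2)))"
      by (simp only: exp_sum[OF fin])
    have e2: "c * exp (- (pi\<^sup>2 * s * u)) / d * exp (- (pi\<^sup>2 * r * u)) = c * exp (- (pi\<^sup>2 * (s + r) * u)) / d" for u c d r
    proof -
      have "- (pi\<^sup>2 * (s + r) * u) = - (pi\<^sup>2 * s * u) + - (pi\<^sup>2 * r * u)" by (simp add: algebra_simps)
      then have "exp (- (pi\<^sup>2 * (s + r) * u)) = exp (- (pi\<^sup>2 * s * u)) * exp (- (pi\<^sup>2 * r * u))"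
        by (simp only: exp_add)
      then show ?thesis by simp
    qed
    show ?thesis unfolding e1 q_def prod.distrib[symmetric] e2 ..
  qed
  show ?thesis unfolding expand E step by (intro sum.cong refl) (simp only: q mult.assoc[symmetric])
qed

text \<open>Dominated convergence in \<open>N\<close>: the constant
  \<open>heat_bound r ^ card S\<close> bounds all truncated products.\<close>

lemma past_heat_step:
  assumes S: "disjoint_pairs k S" and s: "s > 0"
  shows "expectation (\<lambda>\<omega>. past \<omega> * pair_prod S (heat k s) (X (\<tau> (Suc n)) \<omega>))
    = expectation (\<lambda>\<omega>. past \<omega> * pair_prod S (heat k (s + (\<tau> (Suc n) - \<tau> n))) (X (\<tau> n) \<omega>))"
proof -
  have lim: "(\<lambda>N. expectation (\<lambda>\<omega>. past \<omega> * pair_prod S (heat_partial N k r) (X (\<tau> m) \<omega>)))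
    \<longlonglongrightarrow> expectation (\<lambda>\<omega>. past \<omega> * pair_prod S (heat k r) (X (\<tau> m) \<omega>))"
    if "r > 0" for r m
  proof (rule integral_dominated_convergence[where w = "\<lambda>_. heat_bound r ^ card S"])
    have "heat_partial N k r \<in> borel_measurable borel" for N unfolding heat_partial_def by measurable
    then show "(\<lambda>\<omega>. past \<omega> * pair_prod S (heat_partial N k r) (X (\<tau> m) \<omega>)) \<in> borel_measurable M" for N
      by (intro borel_measurable_times past_measurable past_prod_measurable[OF S])
    show "(\<lambda>\<omega>. past \<omega> * pair_prod S (heat k r) (X (\<tau> m) \<omega>)) \<in> borel_measurable M"
      by (intro borel_measurable_times past_measurable past_prod_measurable[OF S] borel_measurable_heat)
    show "AE \<omega> in M. (\<lambda>N. past \<omega> * pair_prod S (heat_partial N k r) (X (\<tau> m) \<omega>))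
      \<longlonglongrightarrow> past \<omega> * pair_prod S (heat k r) (X (\<tau> m) \<omega>)"
      using that by (intro AE_I2 tendsto_intros) (auto simp: case_prod_unfold intro!: tendsto_prod heat_partial_tendsto)
    show "AE \<omega> in M. norm (past \<omega> * pair_prod S (heat_partial N k r) (X (\<tau> m) \<omega>)) \<le> heat_bound r ^ card S" for N
    proof (rule AE_I2)
      fix \<omega>
      have "\<bar>past \<omega>\<bar> * \<bar>\<Prod>(i, j)\<in>S. heat_partial N k r (X (\<tau> m) \<omega> i - X (\<tau> m) \<omega> j)\<bar> \<le> 1 * heat_bound r ^ card S"
        by (intro mult_mono past_bound abs_prod_le_power) (auto simp: that abs_heat_partial_le split: prod.splits)
      then show "norm (past \<omega> * pair_prod S (heat_partial N k r) (X (\<tau> m) \<omega>)) \<le> heat_bound r ^ card S"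
        by (simp add: abs_mult)
    qed
  qed simp
  have "s + (\<tau> (Suc n) - \<tau> n) > 0" using \<tau>[of n] s by simp
  from LIMSEQ_unique[OF lim[OF s, of "Suc n"]] lim[OF this, of n] show ?thesis
    unfolding past_heat_partial_step[OF S] by blast
qed

text \<open>Stepping back on the grid increases the time to go by the time that has elapsed. So the
  value, taken at the current position with the remaining time, is a discrete martingale.\<close>

lemma past_alcove_value_step:
  assumes s: "s > 0"
  shows "expectation (\<lambda>\<omega>. past \<omega> * alcove_value k s (X (\<tau> (Suc n)) \<omega>))
    = expectation (\<lambda>\<omega>. past \<omega> * alcove_value k (s + (\<tau> (Suc n) - \<tau> n)) (X (\<tau> n) \<omega>))"
proof -
  let ?h = "\<lambda>r m \<pi> \<omega>. \<Prod>(i, j)\<in>pairs \<pi>. heat k r (X (\<tau> m) \<omega> i - X (\<tau> m) \<omega> j)"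
  have int: "integrable M (\<lambda>\<omega>. past \<omega> * ?h r m \<pi> \<omega>)" if "r > 0" "\<pi> \<in> P2 k" for r m \<pi>
  proof (rule integrable_past_mult[of _ "heat_bound r ^ card (pairs \<pi>)"])
    show "?h r m \<pi> \<in> borel_measurable M"
      using past_prod_measurable[OF disjoint_pairs_pairs[OF that(2)] borel_measurable_heat[of k r], of m] .
    show "\<bar>?h r m \<pi> \<omega>\<bar> \<le> heat_bound r ^ card (pairs \<pi>)" for \<omega>
      by (rule abs_prod_le_power) (auto simp: abs_heat_le that split: prod.splits)
  qed
  have E: "expectation (\<lambda>\<omega>. past \<omega> * alcove_value k r (X (\<tau> m) \<omega>)) =
     (\<Sum>\<pi>\<in>P2 k. (- 1) ^ crossings \<pi> * expectation (\<lambda>\<omega>. past \<omega> * ?h r m \<pi> \<omega>))" if "r > 0" for r m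
  proof -
    have "(\<lambda>\<omega>. past \<omega> * alcove_value k r (X (\<tau> m) \<omega>)) = (\<lambda>\<omega>. \<Sum>\<pi>\<in>P2 k. (- 1) ^ crossings \<pi> * (past \<omega> * ?h r m \<pi> \<omega>))"
      unfolding alcove_value_def by (simp add: sum_distrib_left mult.left_commute)
    then show ?thesis using int[OF that] by (simp add: Bochner_Integration.integral_sum)
  qed
  have "s + (\<tau> (Suc n) - \<tau> n) > 0" using \<tau>[of n] s by simp
  then show ?thesis
    unfolding E[OF s] E[OF \<open>s + (\<tau> (Suc n) - \<tau> n) > 0\<close>]
    using past_heat_step[OF disjoint_pairs_pairs s] by (intro sum.cong refl) simp
qed

end

end

section \<open>The Pfaffian on the alcove and on its walls\<close>

text \<open>A recursive minimum rather than the \<open>Min\<close> of a set, so that continuity in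
  time and measurability follow by induction. Index 0 carries the affine wall.\<close>

primrec gap_upto :: "nat \<Rightarrow> nat \<Rightarrow> (nat \<Rightarrow> real) \<Rightarrow> real" where
  "gap_upto k 0 y = 1 + y k - y 1"
| "gap_upto k (Suc j) y = min (gap_upto k j y) (y (Suc j) - y (Suc (Suc j)))"

definition min_gap :: "nat \<Rightarrow> (nat \<Rightarrow> real) \<Rightarrow> real" where
  "min_gap k y = gap_upto k (k - 1) y"

lemma less_gap_upto_iff:
  "c < gap_upto k j y \<longleftrightarrow> c < 1 + y k - y 1 \<and> (\<forall>i\<in>{1..<Suc j}. c < y i - y (Suc i))"
  by (induction j) (auto simp: less_Suc_eq)

lemma less_min_gap_iff:
  assumes "k \<ge> 1"
  shows "c < min_gap k y \<longleftrightarrow> c < 1 + y k - y 1 \<and> (\<forall>i\<in>{1..<k}. c < y i - y (Suc i))"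
  using assms by (simp add: min_gap_def less_gap_upto_iff)

lemma alcove_iff:
  assumes "k \<ge> 1" "y \<in> V"
  shows "y \<in> alcove k V \<longleftrightarrow> 0 < min_gap k y"
  using assms unfolding alcove_def by (subst less_min_gap_iff) (auto simp: algebra_simps)

lemma continuous_on_gap_upto:
  assumes "\<And>i. i \<in> {1..k} \<Longrightarrow> continuous_on S (\<lambda>t. f t i)" "k \<ge> 1" "j < k"
  shows "continuous_on S (\<lambda>t. gap_upto k j (f t))"
  using assms by (induction j) (auto intro!: continuous_intros)

lemma continuous_on_min_gap:
  assumes "\<And>i. i \<in> {1..k} \<Longrightarrow> continuous_on S (\<lambda>t. f t i)" "k \<ge> 1"
  shows "continuous_on S (\<lambda>t. min_gap k (f t))"
  unfolding min_gap_def using assms by (intro continuous_on_gap_upto) auto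

lemma measurable_gap_upto:
  assumes "k \<ge> 1" "j < k"
  shows "gap_upto k j \<in> borel_measurable (coordinate_measure k)"
  using assms
proof (induction j)
  case 0
  have "(\<lambda>y. 1 + y k - y 1 :: real) \<in> borel_measurable (coordinate_measure k)"
    using 0 by (intro borel_measurable_diff borel_measurable_add measurable_component_singleton) auto
  then show ?case by (simp add: fun_eq_iff[symmetric] cong: measurable_cong)
next
  case (Suc j)
  have "(\<lambda>y. y (Suc j) - y (Suc (Suc j)) :: real) \<in> borel_measurable (coordinate_measure k)"
    using Suc by (intro borel_measurable_diff measurable_component_singleton) auto
  then have "(\<lambda>y. min (gap_upto k j y) (y (Suc j) - y (Suc (Suc j)))) \<in> borel_measurable (coordinate_measure k)"
    using Suc by (intro borel_measurable_min) auto
  then show ?case by (simp cong: measurable_cong)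
qed

lemma measurable_min_gap: "k \<ge> 1 \<Longrightarrow> min_gap k \<in> borel_measurable (coordinate_measure k)"
  using measurable_gap_upto[of k "k - 1"] by (simp add: min_gap_def[abs_def])

lemma gap_chain:
  assumes "i < j" "\<And>m. i \<le> m \<Longrightarrow> m < j \<Longrightarrow> y (Suc m) < (y m :: real)"
  shows "y j < y i"
  using assms
proof (induction j)
  case (Suc j)
  show ?case
  proof (cases "i = j")
    case False
    then have "y j < y i" using Suc by auto
    moreover have "y (Suc j) < y j" using Suc.prems by auto
    ultimately show ?thesis by simp
  qed (use Suc in auto)
qed simp

text \<open>Monotonicity gives \<open>y i - y j \<le> y 1 - y k\<close>, and the affine wall keeps
  the latter below 1. So in the alcove every argument lies in the interval where the initial wave is
  constant or linear.\<close>

lemma alcove_differences: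
  assumes "k \<ge> 1" "0 < min_gap k y" "1 \<le> i" "i < j" "j \<le> k"
  shows "0 < y i - y j" "y i - y j < 1"
proof -
  have w: "0 < 1 + y k - y 1" "\<And>m. m \<in> {1..<k} \<Longrightarrow> y (Suc m) < y m"
    using assms(1,2) by (auto simp: less_min_gap_iff)
  have c: "y b < y a" if "1 \<le> a" "a < b" "b \<le> k" for a b
  proof (rule gap_chain[OF that(2)])
    fix m assume "a \<le> m" "m < b"
    then show "y (Suc m) < y m" using that by (intro w(2)) simp
  qed
  show "0 < y i - y j" using c[of i j] assms by simp
  have "y i \<le> y 1" using c[of 1 i] assms(3-5) by (cases "i = 1") (auto simp: less_imp_le)
  moreover have "y k \<le> y j" using c[of j k] assms(3-5) by (cases "j = k") (auto simp: less_imp_le)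
  ultimately show "y i - y j < 1" using w(1) by simp
qed

section \<open>The signed sum as a bordered Pfaffian\<close>

definition bordered :: "(nat \<Rightarrow> nat \<Rightarrow> real) \<Rightarrow> nat \<Rightarrow> nat \<Rightarrow> real" where
  "bordered f i j = (if i = 0 then (if j = 0 then 0 else 1) else if j = 0 then - 1 else f i j)"

lemma bordered_antisym: "f i j = - f j i \<Longrightarrow> bordered f i j = - bordered f j i"
  by (simp add: bordered_def)

text \<open>One matrix serves both parities: whether the border row occurs is decided by
  \<open>arc_points k\<close>, which contains \<open>0\<close> exactly for odd
  \<open>k\<close>.\<close>

lemma sum_P2_eq_pf_bordered:
  "(\<Sum>\<pi>\<in>P2 k. (- 1) ^ crossings \<pi> * (\<Prod>(i, j)\<in>pairs \<pi>. f i j)) = pf (bordered f) (sorted_list_of_set (arc_points k))"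
proof -
  have "(\<Prod>(i, j)\<in>pairs \<pi>. f i j) = (\<Prod>(i, j)\<in>pairs \<pi>. bordered f i j)" if "\<pi> \<in> P2 k" for \<pi>
  proof (intro prod.cong refl)
    fix p assume "p \<in> pairs \<pi>"
    then have "1 \<le> fst p" "fst p < snd p" using pairs_bounds[OF that, of "fst p" "snd p"] by auto
    then show "(case p of (i, j) \<Rightarrow> f i j) = (case p of (i, j) \<Rightarrow> bordered f i j)"
      by (simp add: bordered_def case_prod_unfold)
  qed
  then have "(\<Sum>\<pi>\<in>P2 k. (- 1) ^ crossings \<pi> * (\<Prod>(i, j)\<in>pairs \<pi>. f i j)) =
      (\<Sum>\<pi>\<in>P2 k. (- 1) ^ crossings \<pi> * (\<Prod>(i, j)\<in>pairs \<pi>. bordered f i j))" by simp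
  also have "\<dots> = pf (bordered f) (sorted_list_of_set (arc_points k))"
    by (rule sum_P2_eq_pf) (simp add: bordered_def)
  finally show ?thesis .
qed

lemma set_arc_points: "set (sorted_list_of_set (arc_points k)) = arc_points k"
  by (simp add: arc_points_def)

text \<open>Adding a linear function of the differences is a row and column operation with the border row.\<close>

lemma sum_P2_shift:
  fixes f :: "nat \<Rightarrow> nat \<Rightarrow> real" and z :: "nat \<Rightarrow> real"
  assumes antisym: "\<And>i j. f i j = - f j i" and k: "odd k"
  shows "(\<Sum>\<pi>\<in>P2 k. (- 1) ^ crossings \<pi> * (\<Prod>(i, j)\<in>pairs \<pi>. f i j + (z i - z j)))
    = (\<Sum>\<pi>\<in>P2 k. (- 1) ^ crossings \<pi> * (\<Prod>(i, j)\<in>pairs \<pi>. f i j))"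
proof -
  define z' where "z' i = (if i = 0 then 0 else z i)" for i :: nat
  have "pf (bordered (\<lambda>i j. f i j + (z i - z j))) (sorted_list_of_set (arc_points k))
    = pf (\<lambda>i j. bordered f i j + z' i * bordered f 0 j - z' j * bordered f 0 i) (sorted_list_of_set (arc_points k))"
    by (intro pf_cong) (auto simp: bordered_def z'_def)
  also have "\<dots> = pf (bordered f) (sorted_list_of_set (arc_points k))"
  proof (rule pf_shift)
    show "bordered f i j = - bordered f j i" for i j by (rule bordered_antisym) (rule antisym)
  qed (use k in \<open>simp_all add: arc_points_def z'_def\<close>)
  finally show ?thesis unfolding sum_P2_eq_pf_bordered .
qed

definition sign_matrix :: "nat \<Rightarrow> nat \<Rightarrow> real" where
  "sign_matrix i j = (if i < j then 1 else if i = j then 0 else - 1)"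

lemma prod_pairs_sign_matrix:
  assumes "\<pi> \<in> P2 k"
  shows "(\<Prod>(i, j)\<in>pairs \<pi>. sign_matrix i j) = 1"
  using pairs_bounds[OF assms] by (intro prod.neutral) (fastforce simp: sign_matrix_def)

text \<open>The signed count is the Pfaffian with ones above the diagonal. This is where the limit 1
  at time 0 comes from.\<close>

lemma sum_P2_ones: "(\<Sum>\<pi>\<in>P2 k. (- 1) ^ crossings \<pi>) = (1 :: real)"
proof -
  have "(\<Sum>\<pi>\<in>P2 k. (- 1) ^ crossings \<pi>) = (\<Sum>\<pi>\<in>P2 k. (- 1) ^ crossings \<pi> * (\<Prod>(i, j)\<in>pairs \<pi>. sign_matrix i j))"
    by (simp add: prod_pairs_sign_matrix)
  also have "\<dots> = 1"
    unfolding sum_P2_eq_pf_bordered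
  proof (rule pf_ones)
    show "even (length (sorted_list_of_set (arc_points k)))" by (simp add: arc_points_def)
    have "sorted_wrt (<) (sorted_list_of_set (arc_points k))" by (rule strict_sorted_list_of_set)
    then show "sorted_wrt (\<lambda>i j. bordered sign_matrix i j = 1) (sorted_list_of_set (arc_points k))"
      by (rule sorted_wrt_mono_rel[rotated]) (auto simp: bordered_def sign_matrix_def)
  qed
  finally show ?thesis .
qed

lemma heat_antisym: "s > 0 \<Longrightarrow> heat k s (y i - y j) = - heat k s (y j - y i)"
  using heat_minus[of s k "y i - y j"] by simp

text \<open>Rows \<open>i\<close> and \<open>i + 1\<close> coincide, including their border
  entries.\<close>

lemma alcove_value_wall:
  assumes s: "s > 0" and i: "1 \<le> i" "i < k" and y: "y i = y (Suc i)"
  shows "alcove_value k s y = 0"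
  unfolding alcove_value_def sum_P2_eq_pf_bordered
proof (rule pf_proportional_rows[where p = i and q = "Suc i" and c = 1])
  show "bordered (\<lambda>i j. heat k s (y i - y j)) p q = - bordered (\<lambda>i j. heat k s (y i - y j)) q p" for p q
    by (rule bordered_antisym, rule heat_antisym[OF s])
qed (use i y in \<open>auto simp: set_arc_points arc_points_def bordered_def\<close>)

text \<open>Shifting the argument by 1 turns row \<open>k\<close> into row \<open>1\<close> up to a
  sign. A border row of ones tolerates only the sign plus, and it is present exactly for odd
  \<open>k\<close>, where the sign is plus.\<close>

lemma alcove_value_affine_wall:
  assumes s: "s > 0" and k: "k \<ge> 2" and y: "y 1 = 1 + y k"
  shows "alcove_value k s y = 0"
  unfolding alcove_value_def sum_P2_eq_pf_bordered
proof (rule pf_proportional_rows[where p = 1 and q = k and c = "if even k then - 1 else 1"])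
  show "bordered (\<lambda>i j. heat k s (y i - y j)) p q = - bordered (\<lambda>i j. heat k s (y i - y j)) q p" for p q
    by (rule bordered_antisym, rule heat_antisym[OF s])
  have "heat k s (y 1 - y j) = (if even k then - 1 else 1) * heat k s (y k - y j)" for j
    using heat_plus_one[OF s, of k "y k - y j"] unfolding y by (simp add: algebra_simps)
  then show "bordered (\<lambda>i j. heat k s (y i - y j)) 1 z =
      (if even k then - 1 else 1) * bordered (\<lambda>i j. heat k s (y i - y j)) k z"
    if "z \<in> set (sorted_list_of_set (arc_points k))" for z
    using k that by (auto simp: bordered_def set_arc_points arc_points_def)
qed (use k in \<open>auto simp: set_arc_points arc_points_def\<close>)

lemma abs_sum_P2_le:
  assumes "\<And>\<pi>. \<pi> \<in> P2 k \<Longrightarrow> \<bar>f \<pi>\<bar> \<le> B \<pi>"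
  shows "\<bar>\<Sum>\<pi>\<in>P2 k. (- 1) ^ crossings \<pi> * f \<pi>\<bar> \<le> (\<Sum>\<pi>\<in>P2 k. B \<pi> :: real)"
  using assms by (intro order_trans[OF sum_abs sum_mono]) (auto simp: abs_mult power_abs)

lemma alcove_value_bounded:
  assumes "e > 0"
  obtains K where "\<And>s y. e \<le> s \<Longrightarrow> \<bar>alcove_value k s y\<bar> \<le> K"
proof
  fix s y assume "e \<le> s"
  then show "\<bar>alcove_value k s y\<bar> \<le> (\<Sum>\<pi>\<in>P2 k. heat_bound e ^ card (pairs \<pi>))"
    unfolding alcove_value_def using assms
    by (intro abs_sum_P2_le abs_prod_le_power) (auto intro: abs_heat_le)
qed

text \<open>The bound is uniform in time down to 0, at the price of holding only inside the alcove;
  it dominates the last limit, \<open>e\<close> to 0.\<close>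

lemma alcove_value_bounded_alcove:
  assumes k: "k \<ge> 1"
  obtains K where "\<And>(s :: real) y. 0 < s \<Longrightarrow> 0 < min_gap k y \<Longrightarrow> \<bar>alcove_value k s y\<bar> \<le> K"
proof
  fix s :: real and y assume s: "0 < s" and y: "0 < min_gap k y"
  show "\<bar>alcove_value k s y\<bar> \<le> (\<Sum>\<pi>\<in>P2 k. 26 ^ card (pairs \<pi>))"
    unfolding alcove_value_def
  proof (intro abs_sum_P2_le abs_prod_le_power)
    fix \<pi> p assume "\<pi> \<in> P2 k" "p \<in> pairs \<pi>"
    then have "1 \<le> fst p" "fst p < snd p" "snd p \<le> k" using pairs_bounds[of \<pi> k "fst p" "snd p"] by auto
    then show "\<bar>case p of (i, j) \<Rightarrow> heat k s (y i - y j)\<bar> \<le> 26"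
      using alcove_differences[OF k y, of "fst p" "snd p"] s heat_bounded[of s "y (fst p) - y (snd p)" k]
      by (simp add: case_prod_unfold)
  qed
qed

text \<open>For odd \<open>k\<close> the sawtooth entry \<open>1 - 2 * (y i - y j)\<close> is the
  sign matrix plus \<open>z i - z j\<close> with \<open>z = - 2 * y\<close>, and the border row
  absorbs that part. In both cases the Pfaffian of ones is left.\<close>

lemma tendsto_alcove_value:
  assumes k: "k \<ge> 1" and y: "0 < min_gap k y"
  shows "((\<lambda>s. alcove_value k s y) \<longlongrightarrow> 1) (at_right 0)"
proof -
  let ?l = "\<lambda>i j. if even k then 1 else 1 - 2 * (y i - y j)"
  have "((\<lambda>s. alcove_value k s y) \<longlongrightarrow>
      (\<Sum>\<pi>\<in>P2 k. (- 1) ^ crossings \<pi> * (\<Prod>(i, j)\<in>pairs \<pi>. ?l i j))) (at_right 0)"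
    unfolding alcove_value_def
  proof (intro tendsto_sum tendsto_mult tendsto_const)
    fix \<pi> assume \<pi>: "\<pi> \<in> P2 k"
    show "((\<lambda>s. pair_prod (pairs \<pi>) (heat k s) y) \<longlongrightarrow> (\<Prod>(i, j)\<in>pairs \<pi>. ?l i j)) (at_right 0)"
      unfolding case_prod_unfold
    proof (intro tendsto_prod)
      fix p assume "p \<in> pairs \<pi>"
      then have "1 \<le> fst p" "fst p < snd p" "snd p \<le> k" using pairs_bounds[OF \<pi>, of "fst p" "snd p"] by auto
      from tendsto_heat[OF alcove_differences[OF k y this], of k]
      show "((\<lambda>s. heat k s (y (fst p) - y (snd p))) \<longlongrightarrow> ?l (fst p) (snd p)) (at_right 0)" .
    qed
  qed
  also have "(\<Sum>\<pi>\<in>P2 k. (- 1) ^ crossings \<pi> * (\<Prod>(i, j)\<in>pairs \<pi>. ?l i j)) = 1"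
  proof (cases "even k")
    case True
    then show ?thesis using sum_P2_ones by (simp add: case_prod_unfold)
  next
    case False
    have "(\<Prod>(i, j)\<in>pairs \<pi>. ?l i j) = (\<Prod>(i, j)\<in>pairs \<pi>. sign_matrix i j + (- 2 * y i - - 2 * y j))"
      if "\<pi> \<in> P2 k" for \<pi>
      using pairs_bounds[OF that] False by (intro prod.cong) (auto simp: sign_matrix_def algebra_simps)
    then have "(\<Sum>\<pi>\<in>P2 k. (- 1) ^ crossings \<pi> * (\<Prod>(i, j)\<in>pairs \<pi>. ?l i j))
      = (\<Sum>\<pi>\<in>P2 k. (- 1) ^ crossings \<pi> * (\<Prod>(i, j)\<in>pairs \<pi>. sign_matrix i j + (- 2 * y i - - 2 * y j)))"
      by simp
    also have "\<dots> = (\<Sum>\<pi>\<in>P2 k. (- 1) ^ crossings \<pi> * (\<Prod>(i, j)\<in>pairs \<pi>. sign_matrix i j))"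
      using False by (intro sum_P2_shift) (auto simp: sign_matrix_def)
    also have "\<dots> = (\<Sum>\<pi>\<in>P2 k. (- 1) ^ crossings \<pi>)" by (simp add: prod_pairs_sign_matrix)
    finally show ?thesis by (simp add: sum_P2_ones)
  qed
  finally show ?thesis .
qed

lemma abs_prod_diff_le:
  fixes a b :: "'i \<Rightarrow> real"
  assumes "finite S" "B \<ge> 1" "\<And>i. i \<in> S \<Longrightarrow> \<bar>a i\<bar> \<le> B" "\<And>i. i \<in> S \<Longrightarrow> \<bar>b i\<bar> \<le> B"
  shows "\<bar>prod a S - prod b S\<bar> \<le> B ^ card S * (\<Sum>i\<in>S. \<bar>a i - b i\<bar>)"
  using assms(1,3,4)
proof (induction S rule: finite_induct)
  case (insert i S)
  have "prod a (insert i S) - prod b (insert i S) = a i * (prod a S - prod b S) + (a i - b i) * prod b S"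
    using insert by (simp add: algebra_simps)
  also have "\<bar>\<dots>\<bar> \<le> \<bar>a i\<bar> * \<bar>prod a S - prod b S\<bar> + \<bar>a i - b i\<bar> * \<bar>prod b S\<bar>"
    by (metis abs_mult abs_triangle_ineq)
  also have "\<dots> \<le> B * (B ^ card S * (\<Sum>i\<in>S. \<bar>a i - b i\<bar>)) + \<bar>a i - b i\<bar> * B ^ card S"
    using insert assms(2) by (intro add_mono mult_mono abs_prod_le_power) (auto intro!: sum_nonneg)
  also have "\<dots> \<le> B * (B ^ card S * (\<Sum>i\<in>S. \<bar>a i - b i\<bar>)) + \<bar>a i - b i\<bar> * (B * B ^ card S)"
    using assms(2) by (intro add_mono mult_left_mono order_refl) (auto simp: mult_le_cancel_right1)
  also have "\<dots> = B ^ card (insert i S) * (\<Sum>i\<in>insert i S. \<bar>a i - b i\<bar>)"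
    using insert by (simp add: algebra_simps)
  finally show ?case .
qed simp

text \<open>Moving one coordinate by at most \<open>\<delta>\<close> puts the point on a wall, where
  the value is 0. Every difference changes by at most \<open>2 * \<delta>\<close>, and
  \<open>heat\<close> is uniformly Lipschitz for times from \<open>e\<close> on.\<close>

lemma alcove_value_near_wall:
  assumes e: "e > 0" and k: "k \<ge> 2"
  obtains C where "C \<ge> 0" "\<And>s y \<delta>. e \<le> s \<Longrightarrow> 0 < min_gap k y \<Longrightarrow> min_gap k y \<le> \<delta> \<Longrightarrow> \<bar>alcove_value k s y\<bar> \<le> C * \<delta>"
proof
  define B where "B = max 1 (heat_bound e)"
  define C where "C = (\<Sum>\<pi>\<in>P2 k. B ^ card (pairs \<pi>) * (\<Sum>p\<in>pairs \<pi>. heat_bound e * 2))"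
  have hb: "0 \<le> heat_bound e" by (rule heat_bound_nonneg[OF e])
  then show "C \<ge> 0" unfolding C_def B_def by (intro sum_nonneg mult_nonneg_nonneg) auto
  fix s y \<delta> assume s: "e \<le> s" and y: "0 < min_gap k y" "min_gap k y \<le> \<delta>"
  have s0: "s > 0" using e s by simp
  have hB: "\<bar>heat k s u\<bar> \<le> B" for u
    using abs_heat_le[OF e s, of k u] by (simp add: B_def)
  have lip: "\<bar>alcove_value k s y - alcove_value k s y'\<bar> \<le> C * \<delta>" if d: "\<And>i. \<bar>y i - y' i\<bar> \<le> \<delta>" for y'
  proof -
    have "alcove_value k s y - alcove_value k s y' = (\<Sum>\<pi>\<in>P2 k. (- 1) ^ crossings \<pi> *
      (pair_prod (pairs \<pi>) (heat k s) y - pair_prod (pairs \<pi>) (heat k s) y'))"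
      unfolding alcove_value_def by (simp add: sum_subtractf right_diff_distrib)
    also have "\<bar>\<dots>\<bar> \<le> (\<Sum>\<pi>\<in>P2 k. B ^ card (pairs \<pi>) * (\<Sum>p\<in>pairs \<pi>. heat_bound e * 2) * \<delta>)"
    proof (rule abs_sum_P2_le)
      fix \<pi> assume \<pi>: "\<pi> \<in> P2 k"
      have "\<bar>(\<Prod>p\<in>pairs \<pi>. heat k s (y (fst p) - y (snd p))) - (\<Prod>p\<in>pairs \<pi>. heat k s (y' (fst p) - y' (snd p)))\<bar>
        \<le> B ^ card (pairs \<pi>) * (\<Sum>p\<in>pairs \<pi>. \<bar>heat k s (y (fst p) - y (snd p)) - heat k s (y' (fst p) - y' (snd p))\<bar>)"
        by (intro abs_prod_diff_le finite_pairs[OF \<pi>] hB) (simp add: B_def)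
      also have "\<dots> \<le> B ^ card (pairs \<pi>) * (\<Sum>p\<in>pairs \<pi>. heat_bound e * (2 * \<delta>))"
      proof (intro mult_left_mono sum_mono)
        fix p
        have "\<bar>(y (fst p) - y (snd p)) - (y' (fst p) - y' (snd p))\<bar> \<le> 2 * \<delta>"
          using d[of "fst p"] d[of "snd p"] by linarith
        then show "\<bar>heat k s (y (fst p) - y (snd p)) - heat k s (y' (fst p) - y' (snd p))\<bar> \<le> heat_bound e * (2 * \<delta>)"
          using hb by (intro order_trans[OF heat_lipschitz[OF e s]] mult_left_mono)
      qed (auto simp: B_def)
      finally show "\<bar>pair_prod (pairs \<pi>) (heat k s) y - pair_prod (pairs \<pi>) (heat k s) y'\<bar>
        \<le> B ^ card (pairs \<pi>) * (\<Sum>p\<in>pairs \<pi>. heat_bound e * 2) * \<delta>"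
        by (simp add: case_prod_unfold)
    qed
    also have "\<dots> = C * \<delta>" by (simp add: C_def sum_distrib_right)
    finally show ?thesis .
  qed
  have \<delta>: "\<delta> > 0" using y by simp
  have pos: "0 < 1 + y k - y 1" "\<And>i. i \<in> {1..<k} \<Longrightarrow> 0 < y i - y (Suc i)"
    using y(1) k less_min_gap_iff[of k 0 y] by auto
  have "\<not> \<delta> < min_gap k y" using y by simp
  then consider "1 + y k - y 1 \<le> \<delta>" | i where "i \<in> {1..<k}" "y i - y (Suc i) \<le> \<delta>"
    using k by (subst (asm) less_min_gap_iff) (auto simp: not_less)
  then show "\<bar>alcove_value k s y\<bar> \<le> C * \<delta>"
  proof cases
    case 1
    have "alcove_value k s (y(1 := 1 + y k)) = 0"
      using k by (intro alcove_value_affine_wall s0) auto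
    moreover have "\<bar>y i - (y(1 := 1 + y k)) i\<bar> \<le> \<delta>" for i using 1 \<delta> pos(1) by auto
    ultimately show ?thesis using lip[of "y(1 := 1 + y k)"] by simp
  next
    case 2
    have "alcove_value k s (y(i := y (Suc i))) = 0"
      using 2 by (intro alcove_value_wall[of _ i] s0) auto
    moreover have "\<bar>y j - (y(i := y (Suc i))) j\<bar> \<le> \<delta>" for j using 2 \<delta> pos(2)[of i] by auto
    ultimately show ?thesis using lip[of "y(i := y (Suc i))"] by simp
  qed
qed

lemma continuous_on_heat: "e > 0 \<Longrightarrow> continuous_on {e..} (\<lambda>t. heat k t y)"
proof -
  assume e: "e > 0"
  have "uniform_limit {e..} (\<lambda>N t. heat_partial N k t y) (\<lambda>t. heat k t y) sequentially"
    unfolding heat_partial_def heat_def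
  proof (rule Weierstrass_m_test[OF _ summable_heat_bound[OF e]])
    fix n :: nat and t assume "t \<in> {e..}"
    then show "norm (fourier_weight k n * exp (- (pi\<^sup>2 * t * (real n)\<^sup>2)) * (sin (pi * real n * y) / real n))
        \<le> 4 * exp (- (pi\<^sup>2 * e * (real n)\<^sup>2))"
      unfolding real_norm_def by (intro heat_term_le) simp
  qed
  moreover have "continuous_on {e..} (\<lambda>t. heat_partial N k t y)" for N
    unfolding heat_partial_def
    by (intro continuous_on_sum continuous_on_mult continuous_on_const continuous_on_exp continuous_on_minus continuous_on_id)
  then have "\<forall>\<^sub>F N in sequentially. continuous_on {e..} (\<lambda>t. heat_partial N k t y)"
    by (intro always_eventually allI)
  ultimately show ?thesis by (intro uniform_limit_theorem[of _ "\<lambda>N t. heat_partial N k t y" sequentially]) auto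
qed

lemma alcove_value_right_continuous:
  assumes t: "t > 0"
  shows "((\<lambda>e. alcove_value k (t + e) y) \<longlongrightarrow> alcove_value k t y) (at_right 0)"
proof -
  have "((\<lambda>e. heat k (t + e) z) \<longlongrightarrow> heat k t z) (at_right 0)" for z
  proof -
    have "isCont (\<lambda>s. heat k s z) t"
      using continuous_on_heat[of "t / 2" k z] t by (intro continuous_on_interior[of "{t / 2..}"]) auto
    moreover have "((\<lambda>e. t + e) \<longlongrightarrow> t) (at_right 0)"
      by (rule tendsto_eq_intros refl | simp)+
    ultimately show ?thesis by (rule isCont_tendsto_compose)
  qed
  then show ?thesis
    unfolding alcove_value_def case_prod_unfold by (intro tendsto_sum tendsto_mult tendsto_const tendsto_prod)
qed

section \<open>The distribution of the exit time\<close>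

text \<open>The product of the conditions is 1 until the first failure and 0 from then on, so the
  sum telescopes to \<open>W\<close> at the first failing index below \<open>n\<close>, or at
  \<open>n\<close> if there is none.\<close>

lemma stopped_sum_cases:
  fixes W :: "nat \<Rightarrow> real"
  shows "\<exists>m\<le>n. W 0 + (\<Sum>j<n. (\<Prod>i\<le>j. if P i then 1 else 0) * (W (Suc j) - W j)) = W m \<and>
    (\<forall>i<m. P i) \<and> (m < n \<longrightarrow> \<not> P m)"
proof (induction n)
  case (Suc n)
  then obtain m where m: "m \<le> n" "W 0 + (\<Sum>j<n. (\<Prod>i\<le>j. if P i then 1 else 0) * (W (Suc j) - W j)) = W m"
    "\<forall>i<m. P i" "m < n \<longrightarrow> \<not> P m" by blast
  define G where "G = (\<Prod>i\<le>n. if P i then 1 else 0 :: real)"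
  have sum: "W 0 + (\<Sum>j<Suc n. (\<Prod>i\<le>j. if P i then 1 else 0) * (W (Suc j) - W j)) = W m + G * (W (Suc n) - W n)"
    using m(2) by (simp only: sum.lessThan_Suc G_def add.assoc[symmetric])
  show ?case
  proof (cases "P m")
    case True
    then have "m = n" using m by auto
    then have "G = 1" using m True unfolding G_def by (intro prod.neutral) (auto simp: le_less)
    then show ?thesis using sum m(3) True \<open>m = n\<close> by (intro exI[of _ "Suc n"]) (auto simp: less_Suc_eq)
  next
    case False
    then have "G = 0" using m(1) unfolding G_def by (intro prod_zero) (auto intro!: bexI[of _ m])
    then show ?thesis using sum m(1,3) False by (intro exI[of _ m]) auto
  qed
qed simp

lemma ge_on_rationals_imp_ge:
  fixes D :: "real \<Rightarrow> real"
  assumes D: "continuous_on {0..} D" and q: "\<And>q. q \<in> \<rat> \<Longrightarrow> 0 \<le> q \<Longrightarrow> q \<le> t \<Longrightarrow> c \<le> D q"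
    and s: "0 \<le> s" "s \<le> t"
  shows "c \<le> D s"
proof (cases "t = 0")
  case True
  then show ?thesis using q[of 0] s by auto
next
  case False
  show ?thesis
  proof (rule ccontr)
    assume "\<not> c \<le> D s"
    then have "c - D s > 0" by simp
    then obtain d where d: "d > 0" "\<And>r. r \<in> {0..} \<Longrightarrow> dist r s < d \<Longrightarrow> dist (D r) (D s) < c - D s"
      using D s unfolding continuous_on_iff by (metis atLeast_iff)
    have "max 0 (s - d) < min t (s + d)" using s d False by auto
    then obtain r where r: "r \<in> \<rat>" "max 0 (s - d) < r" "r < min t (s + d)"
      using Rats_dense_in_real by blast
    then have "dist (D r) (D s) < c - D s" using d(2)[of r] by (auto simp: dist_real_def)
    moreover have "c \<le> D r" using r q[of r] by auto
    ultimately show False by (simp add: dist_real_def)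
  qed
qed

text \<open>A continuous function that is positive on a compact interval has a positive minimum,
  which yields the margin \<open>1 / Suc m\<close>. With rational times the left side is built from
  countably many conditions.\<close>

lemma positive_on_rationals_iff:
  fixes D :: "real \<Rightarrow> real"
  assumes D: "continuous_on {0..} D" and t: "0 \<le> t"
  shows "(\<exists>m :: nat. \<forall>q\<in>\<rat> \<inter> {0..}. q \<le> t \<longrightarrow> 1 / real (Suc m) \<le> D q) \<longleftrightarrow> (\<forall>s\<in>{0..t}. 0 < D s)"
proof
  assume "\<exists>m :: nat. \<forall>q\<in>\<rat> \<inter> {0..}. q \<le> t \<longrightarrow> 1 / real (Suc m) \<le> D q"
  then obtain m :: nat where m: "\<And>q. q \<in> \<rat> \<Longrightarrow> 0 \<le> q \<Longrightarrow> q \<le> t \<Longrightarrow> 1 / real (Suc m) \<le> D q" by auto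
  show "\<forall>s\<in>{0..t}. 0 < D s"
  proof
    fix s assume "s \<in> {0..t}"
    then have "1 / real (Suc m) \<le> D s" using ge_on_rationals_imp_ge[OF D m, of t s] by simp
    moreover have "0 < 1 / real (Suc m)" by simp
    ultimately show "0 < D s" by linarith
  qed
next
  assume pos: "\<forall>s\<in>{0..t}. 0 < D s"
  have "continuous_on {0..t} D" using D by (rule continuous_on_subset) auto
  then obtain s where s: "s \<in> {0..t}" "\<And>r. r \<in> {0..t} \<Longrightarrow> D s \<le> D r"
    using continuous_attains_inf[of "{0..t}" D] t by auto
  obtain m where "inverse (real (Suc m)) < D s" using reals_Archimedean pos s(1) by blast
  then have "\<forall>q\<in>\<rat> \<inter> {0..}. q \<le> t \<longrightarrow> 1 / real (Suc m) \<le> D q"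
    using s(2) by (force simp: inverse_eq_divide)
  then show "\<exists>m :: nat. \<forall>q\<in>\<rat> \<inter> {0..}. q \<le> t \<longrightarrow> 1 / real (Suc m) \<le> D q" by blast
qed

lemma measurable_alcove_value: "alcove_value k s \<in> borel_measurable (coordinate_measure k)"
proof -
  have "(\<lambda>y. pair_prod (pairs \<pi>) (heat k s) y) \<in> borel_measurable (coordinate_measure k)"
    if "\<pi> \<in> P2 k" for \<pi>
    using measurable_pair_prod[OF disjoint_pairs_pairs[OF that], of "\<lambda>_. heat k s"] borel_measurable_heat[of k s]
    by simp
  then have "(\<lambda>y. \<Sum>\<pi>\<in>P2 k. (- 1) ^ crossings \<pi> * pair_prod (pairs \<pi>) (heat k s) y)
      \<in> borel_measurable (coordinate_measure k)"
    by (intro borel_measurable_sum borel_measurable_times borel_measurable_const)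
  then show ?thesis by (simp add: alcove_value_def[abs_def])
qed

context brownian_alcove
begin

section \<open>Survival of a path and optional stopping on finer and finer grids\<close>

definition gap :: "real \<Rightarrow> 'a \<Rightarrow> real" where
  "gap s \<omega> = min_gap k (X s \<omega>)"

text \<open>For a continuous path this says that the path stays in the alcove up to time \<open>t\<close>; in this form it
  is visibly measurable.\<close>

definition survives :: "real \<Rightarrow> 'a \<Rightarrow> bool" where
  "survives t \<omega> \<longleftrightarrow> (\<exists>m :: nat. \<forall>q\<in>\<rat> \<inter> {0..}. q \<le> t \<longrightarrow> 1 / real (Suc m) \<le> gap q \<omega>)"

definition good_path :: "'a \<Rightarrow> bool" where
  "good_path \<omega> \<longleftrightarrow> X 0 \<omega> = x \<and> continuous_on {0..} (\<lambda>s. gap s \<omega>)"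

lemma AE_good_path:
  assumes "k \<ge> 1"
  shows "AE \<omega> in M. good_path \<omega>"
  using start continuous_paths
proof eventually_elim
  case (elim \<omega>)
  then show ?case
    unfolding good_path_def gap_def using assms by (intro conjI continuous_on_min_gap) auto
qed

lemma survives_iff: "good_path \<omega> \<Longrightarrow> 0 \<le> t \<Longrightarrow> survives t \<omega> \<longleftrightarrow> (\<forall>s\<in>{0..t}. 0 < gap s \<omega>)"
  unfolding survives_def good_path_def by (intro positive_on_rationals_iff) auto

lemma measurable_gap: "k \<ge> 1 \<Longrightarrow> 0 \<le> s \<Longrightarrow> gap s \<in> borel_measurable M"
  unfolding gap_def[abs_def] by (rule measurable_compose[OF random_vector measurable_min_gap])

lemma measurable_value: "0 \<le> r \<Longrightarrow> (\<lambda>\<omega>. alcove_value k s (X r \<omega>)) \<in> borel_measurable M"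
  by (rule measurable_compose[OF random_vector measurable_alcove_value])

lemma countable_Rats_nonneg: "countable (\<rat> \<inter> {0 :: real..})"
  using countable_rat by (rule countable_subset[rotated]) auto

lemma sets_survives:
  assumes "k \<ge> 1"
  shows "{\<omega> \<in> space M. survives t \<omega>} \<in> sets M"
proof -
  have "{\<omega> \<in> space M. 1 / real (Suc m) \<le> gap q \<omega>} \<in> sets M" if "q \<in> \<rat> \<inter> {0..}" for m :: nat and q
    using that measurable_gap[OF assms, of q] by (intro borel_measurable_le borel_measurable_const) auto
  then have "{\<omega> \<in> space M. \<forall>q\<in>\<rat> \<inter> {0..}. q \<le> t \<longrightarrow> 1 / real (Suc m) \<le> gap q \<omega>} \<in> sets M" for m :: nat
    by (intro sets.sets_Collect_countable_All' countable_Rats_nonneg sets.sets_Collect_imp sets.sets_Collect_const)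
  then show ?thesis
    unfolding survives_def by (intro sets.sets_Collect_countable_Ex)
qed

text \<open>A discrete martingale transform: each increment of \<open>W\<close> has mean zero
  against the product of the factors \<open>g\<close> up to its left end, by
  \<open>past_alcove_value_step\<close>. The extra \<open>e\<close> keeps the time to go positive up
  to the last grid point.\<close>

lemma stopped_expectation:
  fixes n :: nat
  assumes t: "t > 0" and e: "e > 0" and g: "g \<in> borel_measurable (coordinate_measure k)" "\<And>y. \<bar>g y\<bar> \<le> 1"
  defines "\<tau> \<equiv> \<lambda>j. real j * (t / real (Suc n))"
  defines "W \<equiv> \<lambda>j \<omega>. alcove_value k (t + e - \<tau> j) (X (\<tau> j) \<omega>)"
  defines "Z \<equiv> \<lambda>\<omega>. W 0 \<omega> + (\<Sum>j<Suc n. (\<Prod>i\<le>j. g (X (\<tau> i) \<omega>)) * (W (Suc j) \<omega> - W j \<omega>))"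
  shows "integrable M Z" "expectation Z = alcove_value k (t + e) x"
proof -
  have h: "0 < t / real (Suc n)" using t by simp
  have \<tau>: "\<tau> 0 = 0" "\<And>j. \<tau> j < \<tau> (Suc j)" "\<And>j. 0 \<le> \<tau> j"
  proof -
    show "\<tau> j < \<tau> (Suc j)" for j unfolding \<tau>_def by (intro mult_strict_right_mono h) simp
  qed (use t in \<open>simp_all add: \<tau>_def\<close>)
  note ctx = \<tau>(1,2) g
  have le: "\<tau> j \<le> t" if "j \<le> Suc n" for j
  proof -
    have "real j * t \<le> real (Suc n) * t" using that t by (intro mult_right_mono) auto
    then show ?thesis by (simp add: \<tau>_def field_simps)
  qed
  obtain K where K: "\<And>s y. e \<le> s \<Longrightarrow> \<bar>alcove_value k s y\<bar> \<le> K"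
    using alcove_value_bounded[OF e] by blast
  have WK: "\<bar>W j \<omega>\<bar> \<le> K" if "j \<le> Suc n" for j \<omega>
    unfolding W_def using le[OF that] by (intro K) simp
  have Wm: "W j \<in> borel_measurable M" for j
    unfolding W_def using measurable_value[OF \<tau>(3)] .
  let ?G = "\<lambda>j \<omega>. past \<tau> (\<lambda>_. g) j \<omega>"
  have G: "(\<Prod>i\<le>j. g (X (\<tau> i) \<omega>)) = ?G j \<omega>" for j \<omega>
    using past_def[OF ctx] by simp
  have int: "integrable M (\<lambda>\<omega>. ?G j \<omega> * W i \<omega>)" if "i \<le> Suc n" for i j
    by (rule integrable_past_mult[OF ctx Wm]) (rule WK[OF that])
  have intW: "integrable M (W 0)"
    using WK[of 0] Wm by (intro integrable_const_bound[of _ K]) auto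
  have Z: "Z \<omega> = W 0 \<omega> + (\<Sum>j<Suc n. ?G j \<omega> * W (Suc j) \<omega> - ?G j \<omega> * W j \<omega>)" for \<omega>
    by (simp only: Z_def G right_diff_distrib)
  have intd: "integrable M (\<lambda>\<omega>. \<Sum>j<Suc n. ?G j \<omega> * W (Suc j) \<omega> - ?G j \<omega> * W j \<omega>)"
    by (intro Bochner_Integration.integrable_sum Bochner_Integration.integrable_diff int) auto
  show "integrable M Z"
    unfolding Z using intW intd by (rule Bochner_Integration.integrable_add)
  have "expectation Z = expectation (W 0) + expectation (\<lambda>\<omega>. \<Sum>j<Suc n. ?G j \<omega> * W (Suc j) \<omega> - ?G j \<omega> * W j \<omega>)"
    unfolding Z using intW intd by (rule Bochner_Integration.integral_add)
  also have "expectation (\<lambda>\<omega>. \<Sum>j<Suc n. ?G j \<omega> * W (Suc j) \<omega> - ?G j \<omega> * W j \<omega>)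
    = (\<Sum>j<Suc n. expectation (\<lambda>\<omega>. ?G j \<omega> * W (Suc j) \<omega> - ?G j \<omega> * W j \<omega>))"
    by (intro Bochner_Integration.integral_sum Bochner_Integration.integrable_diff int) auto
  also have "\<dots> = 0"
  proof (intro sum.neutral ballI)
    fix j assume "j \<in> {..<Suc n}"
    then have j: "Suc j \<le> Suc n" by auto
    have "t + e - \<tau> (Suc j) > 0" using le[OF j] e by simp
    moreover have "t + e - \<tau> (Suc j) + (\<tau> (Suc j) - \<tau> j) = t + e - \<tau> j" by simp
    ultimately have "expectation (\<lambda>\<omega>. ?G j \<omega> * W (Suc j) \<omega>) = expectation (\<lambda>\<omega>. ?G j \<omega> * W j \<omega>)"
      unfolding W_def using past_alcove_value_step[OF ctx, of "t + e - \<tau> (Suc j)" j] by (simp only:)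
    then show "expectation (\<lambda>\<omega>. ?G j \<omega> * W (Suc j) \<omega> - ?G j \<omega> * W j \<omega>) = 0"
      using int[of "Suc j" j] int[of j j] j by simp
  qed
  also have "expectation (W 0) = alcove_value k (t + e) x"
  proof -
    have "expectation (W 0) = expectation (\<lambda>\<omega>. alcove_value k (t + e) x)"
      using start Wm[of 0] by (intro integral_cong_AE) (auto simp: W_def \<tau>(1))
    then show ?thesis by (simp add: prob_space)
  qed
  finally show "expectation Z = alcove_value k (t + e) x" by simp
qed

text \<open>Here \<open>\<delta>\<close> is fixed and the grid is refined. A path that leaves the
  alcove is eventually stopped while its gap is positive and at most \<open>\<delta>\<close>, so its
  value is small; a path whose gap stays at least \<open>2 * \<delta>\<close> is never stopped early
  and arrives with time \<open>e\<close> to go.\<close>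

lemma stopped_value_cases:
  assumes k: "k \<ge> 2" and t: "t > 0" and e: "e > 0" and \<delta>: "0 < \<delta>" "\<delta> < min_gap k x" and \<omega>: "good_path \<omega>"
    and C: "C \<ge> 0" "\<And>s y. e \<le> s \<Longrightarrow> 0 < min_gap k y \<Longrightarrow> min_gap k y \<le> \<delta> \<Longrightarrow> \<bar>alcove_value k s y\<bar> \<le> C * \<delta>"
    and K: "\<And>s y. e \<le> s \<Longrightarrow> \<bar>alcove_value k s y\<bar> \<le> K"
  defines "\<tau> \<equiv> \<lambda>n j. real j * (t / real (Suc n))"
  defines "W \<equiv> \<lambda>n j. alcove_value k (t + e - \<tau> n j) (X (\<tau> n j) \<omega>)"
  defines "Z \<equiv> \<lambda>n. W n 0 + (\<Sum>j<Suc n. (\<Prod>i\<le>j. if \<delta> < gap (\<tau> n i) \<omega> then 1 else 0) * (W n (Suc j) - W n j))"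
  shows "\<bar>Z n\<bar> \<le> K"
    and "\<not> survives t \<omega> \<Longrightarrow> \<forall>\<^sub>F n in sequentially. \<bar>Z n\<bar> \<le> C * \<delta>"
    and "survives t \<omega> \<Longrightarrow> (\<And>q. q \<in> \<rat> \<Longrightarrow> 0 \<le> q \<Longrightarrow> q \<le> t \<Longrightarrow> 2 * \<delta> \<le> gap q \<omega>) \<Longrightarrow>
      Z n = alcove_value k e (X t \<omega>)"
proof -
  have X0: "X 0 \<omega> = x" and cont: "continuous_on {0..} (\<lambda>s. gap s \<omega>)" using \<omega> by (auto simp: good_path_def)
  have \<tau>: "0 \<le> \<tau> n j" "\<tau> n 0 = 0" "\<tau> n (Suc n) = t" for n j using t by (auto simp: \<tau>_def)
  have le: "\<tau> n j \<le> t" if "j \<le> Suc n" for n j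
  proof -
    have "real j * t \<le> real (Suc n) * t" using that t by (intro mult_right_mono) auto
    then show ?thesis by (simp add: \<tau>_def field_simps)
  qed
  have cases: "\<exists>m\<le>Suc n. Z n = W n m \<and> (\<forall>i<m. \<delta> < gap (\<tau> n i) \<omega>) \<and> (m < Suc n \<longrightarrow> \<not> \<delta> < gap (\<tau> n m) \<omega>)" for n
    unfolding Z_def by (rule stopped_sum_cases)
  show "\<bar>Z n\<bar> \<le> K"
  proof -
    obtain m where "m \<le> Suc n" "Z n = W n m" using cases[of n] by blast
    then show ?thesis using le[of m n] unfolding W_def by (simp add: K)
  qed
  show "Z n = alcove_value k e (X t \<omega>)" if "survives t \<omega>" "\<And>q. q \<in> \<rat> \<Longrightarrow> 0 \<le> q \<Longrightarrow> q \<le> t \<Longrightarrow> 2 * \<delta> \<le> gap q \<omega>"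
  proof -
    obtain m where m: "m \<le> Suc n" "Z n = W n m" "m < Suc n \<longrightarrow> \<not> \<delta> < gap (\<tau> n m) \<omega>" using cases[of n] by blast
    have "2 * \<delta> \<le> gap (\<tau> n m) \<omega>" by (rule ge_on_rationals_imp_ge[OF cont that(2) \<tau>(1) le[OF m(1)]])
    then have "m = Suc n" using m \<delta> by auto
    then show ?thesis unfolding m(2) W_def by (simp only: \<tau>) simp
  qed
  show "\<forall>\<^sub>F n in sequentially. \<bar>Z n\<bar> \<le> C * \<delta>" if "\<not> survives t \<omega>"
  proof -
    have "\<not> (\<forall>s\<in>{0..t}. 0 < gap s \<omega>)"
      using that survives_iff[OF \<omega>, of t] t by simp
    then obtain s where s: "0 \<le> s" "s \<le> t" "gap s \<omega> \<le> 0" by (auto simp: not_less)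
    have "uniformly_continuous_on {0..t} (\<lambda>s. gap s \<omega>)"
      by (rule compact_uniformly_continuous[OF continuous_on_subset[OF cont]]) auto
    \<comment> \<open>On a grid finer than \<open>d\<close> the gap changes by less than
      \<open>\<delta>\<close> in one step.\<close>
    then obtain d where d: "d > 0" "\<And>r r'. r \<in> {0..t} \<Longrightarrow> r' \<in> {0..t} \<Longrightarrow> dist r' r < d \<Longrightarrow> dist (gap r' \<omega>) (gap r \<omega>) < \<delta>"
      using \<delta>(1) unfolding uniformly_continuous_on_def by metis
    obtain N :: nat where N: "t / d < real N" using reals_Archimedean2 by blast
    have "\<bar>Z n\<bar> \<le> C * \<delta>" if "n \<ge> N" for n
    proof -
      define h where "h = t / real (Suc n)"
      have \<tau>h: "\<tau> n i = real i * h" for i by (simp add: \<tau>_def h_def)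
      have h: "0 < h" "h < d"
      proof -
        have "t / d < real (Suc n)" using N that by simp
        then show "h < d" using d(1) by (simp add: field_simps h_def)
      qed (use t in \<open>simp add: h_def\<close>)
      \<comment> \<open>The last grid point not after \<open>s\<close>, a time at which the path is
        outside. The gap at this grid point is below \<open>\<delta>\<close>, so stopping occurs
        there or earlier.\<close>
      define j where "j = nat \<lfloor>s / h\<rfloor>"
      have "0 \<le> s / h" using s h by simp
      then have j: "real j \<le> s / h" "s / h < real j + 1" by (auto simp: j_def)
      have j1: "real j * h \<le> s" using j(1) h(1) by (simp only: pos_le_divide_eq)
      have "s < (real j + 1) * h" using j(2) h(1) by (simp only: pos_divide_less_eq)
      then have j2: "s < real j * h + h" by (simp add: distrib_right)
      have "real j * h \<le> real (Suc n) * h" using j1 s(2) t by (simp add: h_def)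
      then have jn: "j \<le> Suc n" using h(1) by (simp only: mult_le_cancel_right_pos of_nat_le_iff)
      have "dist (\<tau> n j) s < d" using j1 j2 h by (simp add: \<tau>h dist_real_def)
      then have "dist (gap (\<tau> n j) \<omega>) (gap s \<omega>) < \<delta>"
        using s le[OF jn] \<tau>(1) by (intro d(2)) auto
      then have gj: "gap (\<tau> n j) \<omega> < \<delta>" using s(3) by (simp add: dist_real_def)
      obtain m where m: "m \<le> Suc n" "Z n = W n m" "\<And>i. i < m \<Longrightarrow> \<delta> < gap (\<tau> n i) \<omega>"
        "m < Suc n \<longrightarrow> \<not> \<delta> < gap (\<tau> n m) \<omega>" using cases[of n] by blast
      have mj: "m \<le> j" using m(3)[of j] gj by (metis less_asym not_le)
      have gm: "gap (\<tau> n m) \<omega> \<le> \<delta>"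
      proof (cases "m < Suc n")
        case False
        then have "m = j" using m(1) mj jn by simp
        then show ?thesis using gj by simp
      qed (use m(4) in simp)
      \<comment> \<open>Stopping cannot occur at once, since \<open>\<delta>\<close> is below the
        initial gap. So a grid point precedes the stopping point; its gap exceeds
        \<open>\<delta>\<close>, and one step is too short to bring the gap down to 0.\<close>
      have "m \<noteq> 0"
      proof
        assume "m = 0"
        then have "gap 0 \<omega> \<le> \<delta>" using gm \<tau>(2) by simp
        then show False using \<delta>(2) X0 by (simp add: gap_def)
      qed
      then obtain m' where m': "m = Suc m'" by (cases m) auto
      have "dist (\<tau> n m) (\<tau> n m') < d" using h by (simp add: m' \<tau>h dist_real_def distrib_right)
      then have "dist (gap (\<tau> n m) \<omega>) (gap (\<tau> n m') \<omega>) < \<delta>"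
        using le[of m n] le[of m' n] m(1) m' \<tau>(1) by (intro d(2)) auto
      moreover have "\<delta> < gap (\<tau> n m') \<omega>" using m(3)[of m'] m' by simp
      ultimately have "0 < gap (\<tau> n m) \<omega>" by (simp add: dist_real_def)
      then show ?thesis
        unfolding m(2) W_def using gm le[OF m(1)] by (intro C(2)) (auto simp: gap_def)
    qed
    then show ?thesis by (auto simp: eventually_sequentially)
  qed
qed

lemma sets_survives_near:
  assumes "k \<ge> 1"
  shows "{\<omega> \<in> space M. survives t \<omega> \<and> (\<exists>q\<in>\<rat> \<inter> {0..}. q \<le> t \<and> gap q \<omega> < c)} \<in> sets M"
proof -
  have "{\<omega> \<in> space M. gap q \<omega> < c} \<in> sets M" if "q \<in> \<rat> \<inter> {0..}" for q
    using that measurable_gap[OF assms, of q] by (intro borel_measurable_less borel_measurable_const) auto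
  then have "{\<omega> \<in> space M. \<exists>q\<in>\<rat> \<inter> {0..}. q \<le> t \<and> gap q \<omega> < c} \<in> sets M"
    by (intro sets.sets_Collect_countable_Ex' countable_Rats_nonneg sets.sets_Collect_conj sets.sets_Collect_const)
  then show ?thesis by (intro sets.sets_Collect_conj sets_survives assms)
qed

text \<open>A path that survives but comes closer than \<open>2 * \<delta>\<close> to a wall may be
  stopped too early. On such paths only the crude bound \<open>2 * K\<close> is available, so their
  probability stays in the estimate.\<close>

lemma expectation_value_near:
  assumes k: "k \<ge> 2" and t: "t > 0" and e: "e > 0" and \<delta>: "0 < \<delta>" "\<delta> < min_gap k x"
    and C: "C \<ge> 0" "\<And>s y. e \<le> s \<Longrightarrow> 0 < min_gap k y \<Longrightarrow> min_gap k y \<le> \<delta> \<Longrightarrow> \<bar>alcove_value k s y\<bar> \<le> C * \<delta>"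
    and K: "\<And>s y. e \<le> s \<Longrightarrow> \<bar>alcove_value k s y\<bar> \<le> K"
  defines "f \<equiv> \<lambda>\<omega>. indicator {\<omega> \<in> space M. survives t \<omega>} \<omega> * alcove_value k e (X t \<omega>)"
  shows "\<bar>alcove_value k (t + e) x - expectation f\<bar> \<le>
    C * \<delta> + 2 * K * prob {\<omega> \<in> space M. survives t \<omega> \<and> (\<exists>q\<in>\<rat> \<inter> {0..}. q \<le> t \<and> gap q \<omega> < 2 * \<delta>)}"
proof -
  have k1: "k \<ge> 1" using k by simp
  define N where "N = {\<omega> \<in> space M. survives t \<omega> \<and> (\<exists>q\<in>\<rat> \<inter> {0..}. q \<le> t \<and> gap q \<omega> < 2 * \<delta>)}"
  have N: "N \<in> sets M" unfolding N_def by (rule sets_survives_near[OF k1])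
  have S: "{\<omega> \<in> space M. survives t \<omega>} \<in> sets M" by (rule sets_survives[OF k1])
  \<comment> \<open>The error allowed to each path: stopping near a wall costs
    \<open>C * \<delta>\<close>, belonging to \<open>N\<close> costs \<open>2 * K\<close>.\<close>
  define c where "c \<omega> = C * \<delta> + 2 * K * indicator N \<omega>" for \<omega>
  define \<tau> where "\<tau> n j = real j * (t / real (Suc n))" for n j
  define W where "W n j \<omega> = alcove_value k (t + e - \<tau> n j) (X (\<tau> n j) \<omega>)" for n j \<omega>
  define Z where "Z n \<omega> = W n 0 \<omega> + (\<Sum>j<Suc n. (\<Prod>i\<le>j. if \<delta> < gap (\<tau> n i) \<omega> then 1 else 0) * (W n (Suc j) \<omega> - W n j \<omega>))" for n \<omega>
  have K0: "0 \<le> K" using K[of e "\<lambda>_. 0"] by (rule order_trans[OF abs_ge_zero]) simp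
  have fm: "f \<in> borel_measurable M"
    unfolding f_def using measurable_value[of t e] t S by (intro borel_measurable_times borel_measurable_indicator) auto
  have fK: "\<bar>f \<omega>\<bar> \<le> K" for \<omega>
    using K[of e "X t \<omega>"] K0 by (auto simp: f_def indicator_def)
  have fi: "integrable M f" using fm fK by (intro integrable_const_bound[of _ K]) auto
  have cm: "c \<in> borel_measurable M" unfolding c_def[abs_def] using N by measurable
  have ci: "integrable M c" unfolding c_def[abs_def] using N by (intro Bochner_Integration.integrable_add integrable_mult_right) (auto simp: less_top[symmetric])
  have g: "(\<lambda>y. if \<delta> < min_gap k y then 1 else 0 :: real) \<in> borel_measurable (coordinate_measure k)"
    using measurable_min_gap[OF k1] by measurable
  have Z: "integrable M (Z n)" "expectation (Z n) = alcove_value k (t + e) x" for n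
    using stopped_expectation[OF t e g, of n] by (simp_all add: Z_def[abs_def] W_def \<tau>_def gap_def)
  have near: "\<bar>alcove_value k (t + e) x - expectation f\<bar> \<le> expectation c + expectation (\<lambda>\<omega>. max (\<bar>Z n \<omega> - f \<omega>\<bar> - c \<omega>) 0)" for n
  proof -
    have i: "integrable M (\<lambda>\<omega>. \<bar>Z n \<omega> - f \<omega>\<bar>)" using Z(1) fi by simp
    have i2: "integrable M (\<lambda>\<omega>. max (\<bar>Z n \<omega> - f \<omega>\<bar> - c \<omega>) 0)" using i ci by (intro integrable_max) auto
    have "alcove_value k (t + e) x - expectation f = expectation (\<lambda>\<omega>. Z n \<omega> - f \<omega>)"
      using Z fi by simp
    also have "\<bar>\<dots>\<bar> \<le> expectation (\<lambda>\<omega>. \<bar>Z n \<omega> - f \<omega>\<bar>)" by (rule integral_abs_bound)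
    also have "\<dots> \<le> expectation (\<lambda>\<omega>. c \<omega> + max (\<bar>Z n \<omega> - f \<omega>\<bar> - c \<omega>) 0)"
      using i i2 ci by (intro integral_mono) auto
    also have "\<dots> = expectation c + expectation (\<lambda>\<omega>. max (\<bar>Z n \<omega> - f \<omega>\<bar> - c \<omega>) 0)"
      using i2 ci by simp
    finally show ?thesis .
  qed
  \<comment> \<open>How fine the grid has to be depends on the path. The excess over
    \<open>c\<close> vanishes eventually on each path, and dominated convergence carries this over
    to the mean.\<close>
  have "(\<lambda>n. expectation (\<lambda>\<omega>. max (\<bar>Z n \<omega> - f \<omega>\<bar> - c \<omega>) 0)) \<longlonglongrightarrow> expectation (\<lambda>\<omega>. 0)"
  proof (rule integral_dominated_convergence[where w = "\<lambda>_. 2 * K"])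
    show "(\<lambda>\<omega>. max (\<bar>Z n \<omega> - f \<omega>\<bar> - c \<omega>) 0) \<in> borel_measurable M" for n
      using borel_measurable_integrable[OF Z(1)[of n]] fm cm by measurable
    have c0: "c \<omega> \<ge> 0" for \<omega> unfolding c_def using C(1) \<delta> K0 by (intro add_nonneg_nonneg mult_nonneg_nonneg) auto
    show "AE \<omega> in M. norm (max (\<bar>Z n \<omega> - f \<omega>\<bar> - c \<omega>) 0) \<le> 2 * K" for n
      using AE_good_path[OF k1]
    proof eventually_elim
      case (elim \<omega>)
      have "\<bar>Z n \<omega>\<bar> \<le> K"
        unfolding Z_def W_def \<tau>_def by (rule stopped_value_cases(1)[OF k t e \<delta> elim C K])
      then show ?case using fK[of \<omega>] c0[of \<omega>] by auto
    qed
    show "AE \<omega> in M. (\<lambda>n. max (\<bar>Z n \<omega> - f \<omega>\<bar> - c \<omega>) 0) \<longlonglongrightarrow> 0"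
      using AE_good_path[OF k1] AE_space
    proof eventually_elim
      case (elim \<omega>)
      note good = elim(1)
      have "\<forall>\<^sub>F n in sequentially. \<bar>Z n \<omega> - f \<omega>\<bar> \<le> c \<omega>"
      proof (cases "survives t \<omega>")
        case False
        then have "f \<omega> = 0" by (simp add: f_def)
        moreover have "\<forall>\<^sub>F n in sequentially. \<bar>Z n \<omega>\<bar> \<le> C * \<delta>"
          unfolding Z_def W_def \<tau>_def by (rule stopped_value_cases(2)[OF k t e \<delta> good C K False])
        moreover have "C * \<delta> \<le> c \<omega>" unfolding c_def using K0 by (simp add: indicator_def)
        ultimately show ?thesis by (auto elim: eventually_mono)
      next
        case True
        then have f: "f \<omega> = alcove_value k e (X t \<omega>)" using elim(2) by (simp add: f_def)
        have "\<bar>Z n \<omega> - f \<omega>\<bar> \<le> c \<omega>" for n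
        proof (cases "\<omega> \<in> N")
          case True
          have "\<bar>Z n \<omega>\<bar> \<le> K"
            unfolding Z_def W_def \<tau>_def by (rule stopped_value_cases(1)[OF k t e \<delta> good C K])
          moreover have "0 \<le> C * \<delta>" using C(1) \<delta>(1) by simp
          ultimately show ?thesis using fK[of \<omega>] True by (simp add: c_def)
        next
          case False
          have far: "2 * \<delta> \<le> gap q \<omega>" if "q \<in> \<rat>" "0 \<le> q" "q \<le> t" for q
          proof (rule ccontr)
            assume "\<not> 2 * \<delta> \<le> gap q \<omega>"
            then have "\<exists>q\<in>\<rat> \<inter> {0..}. q \<le> t \<and> gap q \<omega> < 2 * \<delta>" using that by (intro bexI[of _ q]) auto
            with False True elim(2) show False by (simp add: N_def)
          qed
          have "Z n \<omega> = alcove_value k e (X t \<omega>)"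
            unfolding Z_def W_def \<tau>_def by (rule stopped_value_cases(3)[OF k t e \<delta> good C K True far])
          then show ?thesis using c0 by (simp add: f)
        qed
        then show ?thesis by simp
      qed
      then have "\<forall>\<^sub>F n in sequentially. max (\<bar>Z n \<omega> - f \<omega>\<bar> - c \<omega>) 0 = 0"
        by eventually_elim simp
      then show ?case by (rule tendsto_eventually)
    qed
  qed simp_all
  then have "(\<lambda>n. expectation c + expectation (\<lambda>\<omega>. max (\<bar>Z n \<omega> - f \<omega>\<bar> - c \<omega>) 0)) \<longlonglongrightarrow> expectation c + 0"
    by (intro tendsto_add tendsto_const) simp
  then have "\<bar>alcove_value k (t + e) x - expectation f\<bar> \<le> expectation c + 0"
    by (rule LIMSEQ_le_const) (use near in blast)
  also have "expectation c = C * \<delta> + 2 * K * prob N"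
    unfolding c_def[abs_def] using N by (subst Bochner_Integration.integral_add) (auto simp: prob_space less_top[symmetric])
  finally show ?thesis by (simp add: N_def)
qed

text \<open>As \<open>\<delta>\<close> tends to 0 the exceptional events disappear in the limit,
  because the gap of a surviving path has a positive lower bound.\<close>

lemma expectation_value:
  assumes k: "k \<ge> 2" and x: "0 < min_gap k x" and t: "t > 0" and e: "e > 0"
  shows "expectation (\<lambda>\<omega>. indicator {\<omega> \<in> space M. survives t \<omega>} \<omega> * alcove_value k e (X t \<omega>)) = alcove_value k (t + e) x"
    (is "?E = ?v")
proof -
  have k1: "k \<ge> 1" using k by simp
  obtain K where K: "\<And>s y. e \<le> s \<Longrightarrow> \<bar>alcove_value k s y\<bar> \<le> K"
    using alcove_value_bounded[OF e] by blast
  obtain C where C: "C \<ge> 0" "\<And>s y \<delta>. e \<le> s \<Longrightarrow> 0 < min_gap k y \<Longrightarrow> min_gap k y \<le> \<delta> \<Longrightarrow> \<bar>alcove_value k s y\<bar> \<le> C * \<delta>"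
    using alcove_value_near_wall[OF e k] by blast
  \<comment> \<open>The denominator \<open>m + 2\<close> makes \<open>\<delta> m\<close> strictly
    smaller than the initial gap already for \<open>m = 0\<close>.\<close>
  define \<delta> where "\<delta> m = min_gap k x / real (m + 2)" for m
  define N where "N m = {\<omega> \<in> space M. survives t \<omega> \<and> (\<exists>q\<in>\<rat> \<inter> {0..}. q \<le> t \<and> gap q \<omega> < 2 * \<delta> m)}" for m
  have \<delta>: "0 < \<delta> m" "\<delta> m < min_gap k x" for m
  proof -
    show "0 < \<delta> m" using x by (simp add: \<delta>_def)
    have "min_gap k x / real (m + 2) < min_gap k x / 1" using x by (intro divide_strict_left_mono) auto
    then show "\<delta> m < min_gap k x" by (simp add: \<delta>_def)
  qed
  have \<delta>0: "\<delta> \<longlonglongrightarrow> 0"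
    unfolding \<delta>_def by (rule LIMSEQ_ignore_initial_segment) (rule lim_const_over_n)
  have Nm: "N m \<in> sets M" for m unfolding N_def by (rule sets_survives_near[OF k1])
  have bound: "\<bar>?v - ?E\<bar> \<le> C * \<delta> m + 2 * K * prob (N m)" for m
    unfolding N_def by (rule expectation_value_near[OF k t e \<delta> C K])
  have "(\<lambda>m. expectation (indicator (N m))) \<longlonglongrightarrow> expectation (\<lambda>\<omega>. 0 :: real)"
  proof (rule integral_dominated_convergence[where w = "\<lambda>_. 1"])
    show "AE \<omega> in M. (\<lambda>m. indicator (N m) \<omega> :: real) \<longlonglongrightarrow> 0"
    proof (rule AE_I2)
      fix \<omega> assume "\<omega> \<in> space M"
      have "\<forall>\<^sub>F m in sequentially. \<omega> \<notin> N m"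
      proof (cases "survives t \<omega>")
        case True
        then obtain r :: nat where r: "\<And>q. q \<in> \<rat> \<inter> {0..} \<Longrightarrow> q \<le> t \<Longrightarrow> 1 / real (Suc r) \<le> gap q \<omega>"
          by (auto simp: survives_def)
        define c where "c = 1 / real (Suc r)"
        have "\<forall>\<^sub>F m in sequentially. \<delta> m < c / 2"
          by (rule order_tendstoD(2)[OF \<delta>0]) (simp add: c_def)
        then show ?thesis
        proof eventually_elim
          case (elim m)
          then have "2 * \<delta> m < 1 / real (Suc r)" unfolding c_def[symmetric] by simp
          then show ?case using r by (force simp: N_def)
        qed
      qed (simp add: N_def)
      then show "(\<lambda>m. indicator (N m) \<omega> :: real) \<longlonglongrightarrow> 0"
        by (intro tendsto_eventually) (auto elim: eventually_mono)
    qed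
  qed (use Nm in \<open>auto simp: indicator_def\<close>)
  then have "(\<lambda>m. prob (N m)) \<longlonglongrightarrow> 0" using Nm by (simp add: sets.Int_space_eq2)
  then have "(\<lambda>m. C * \<delta> m + 2 * K * prob (N m)) \<longlonglongrightarrow> C * 0 + 2 * K * 0"
    by (intro tendsto_intros \<delta>0)
  then have "\<bar>?v - ?E\<bar> \<le> C * 0 + 2 * K * 0"
    by (rule LIMSEQ_le_const) (use bound in blast)
  then show ?thesis by simp
qed

text \<open>The remaining time \<open>e\<close> tends to 0 on both sides: at the end the value tends
  boundedly to 1 on surviving paths, and at the start it is right continuous in time.\<close>

theorem prob_survives:
  assumes k: "k \<ge> 2" and x: "0 < min_gap k x" and t: "t > 0"
  shows "prob {\<omega> \<in> space M. survives t \<omega>} = alcove_value k t x"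
proof -
  have k1: "k \<ge> 1" using k by simp
  let ?S = "{\<omega> \<in> space M. survives t \<omega>}"
  have S: "?S \<in> sets M" by (rule sets_survives[OF k1])
  obtain K where K: "\<And>(s :: real) y. 0 < s \<Longrightarrow> 0 < min_gap k y \<Longrightarrow> \<bar>alcove_value k s y\<bar> \<le> K"
    using alcove_value_bounded_alcove[OF k1] by blast
  have K0: "0 \<le> K" using K[of 1 x] x by linarith
  define e where "e m = 1 / real (Suc m)" for m
  have e: "filterlim e (at_right 0) sequentially"
    unfolding e_def filterlim_at
  proof
    show "\<forall>\<^sub>F m in sequentially. 1 / real (Suc m) \<in> {0<..} \<and> 1 / real (Suc m) \<noteq> 0" by simp
    show "(\<lambda>m. 1 / real (Suc m)) \<longlonglongrightarrow> 0" by (rule LIMSEQ_Suc[OF lim_const_over_n])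
  qed
  have e0: "e m > 0" for m by (simp add: e_def)
  have gt: "0 < min_gap k (X t \<omega>)" if "good_path \<omega>" "survives t \<omega>" for \<omega>
    using that survives_iff[OF that(1), of t] t by (simp add: gap_def)
  have "(\<lambda>m. expectation (\<lambda>\<omega>. indicator ?S \<omega> * alcove_value k (e m) (X t \<omega>))) \<longlonglongrightarrow> expectation (indicator ?S)"
  proof (rule integral_dominated_convergence[where w = "\<lambda>_. K"])
    show "(\<lambda>\<omega>. indicator ?S \<omega> * alcove_value k (e m) (X t \<omega>)) \<in> borel_measurable M" for m
      using measurable_value[of t "e m"] t S by (intro borel_measurable_times borel_measurable_indicator) auto
    show "AE \<omega> in M. (\<lambda>m. indicator ?S \<omega> * alcove_value k (e m) (X t \<omega>)) \<longlonglongrightarrow> indicator ?S \<omega>"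
      using AE_good_path[OF k1]
    proof eventually_elim
      case (elim \<omega>)
      show ?case
      proof (cases "\<omega> \<in> ?S")
        case True
        then have "0 < min_gap k (X t \<omega>)" using gt[OF elim] by simp
        then have "(\<lambda>m. alcove_value k (e m) (X t \<omega>)) \<longlonglongrightarrow> 1"
          by (intro filterlim_compose[OF tendsto_alcove_value e] k1)
        with True show ?thesis by simp
      qed simp
    qed
    show "AE \<omega> in M. norm (indicator ?S \<omega> * alcove_value k (e m) (X t \<omega>)) \<le> K" for m
      using AE_good_path[OF k1]
    proof eventually_elim
      case (elim \<omega>)
      then show ?case using gt[OF elim] K[of "e m" "X t \<omega>"] e0[of m] K0 by (auto simp: indicator_def)
    qed
  qed (use S in auto)
  moreover have "expectation (indicator ?S) = prob ?S" using S by (simp add: sets.Int_space_eq2)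
  moreover have "(\<lambda>m. alcove_value k (t + e m) x) \<longlonglongrightarrow> alcove_value k t x"
    by (rule filterlim_compose[OF alcove_value_right_continuous[OF t] e])
  ultimately show ?thesis
    unfolding expectation_value[OF k x t e0] using LIMSEQ_unique by metis
qed

end

section \<open>From survival probabilities to the mean exit time\<close>

context brownian_alcove
begin

text \<open>The exit time is the length of the set of survived times. By continuity the times spent
  outside form a closed set, so its infimum \<open>t0\<close> belongs to it and survival up to
  \<open>t\<close> means \<open>t < t0\<close>; if the set is empty, both sides are
  infinite.\<close>

lemma exit_time_eq_integral:
  assumes k: "k \<ge> 1" and \<omega>: "good_path \<omega>" "\<omega> \<in> space M"
  shows "exit_time (alcove k V) X \<omega> = (\<integral>\<^sup>+ t. indicator {t. 0 < t \<and> survives t \<omega>} t \<partial>lborel)"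
proof -
  define H where "H = {t. 0 \<le> t \<and> gap t \<omega> \<le> 0}"
  have cont: "continuous_on {0..} (\<lambda>s. gap s \<omega>)" using \<omega>(1) by (simp add: good_path_def)
  have H: "{t. 0 \<le> t \<and> X t \<omega> \<notin> alcove k V} = H"
    using alcove_iff[OF k state_space[OF _ \<omega>(2)]] by (auto simp: H_def gap_def not_less)
  have surv: "survives t \<omega> \<longleftrightarrow> (\<forall>s\<in>H. t < s)" if "0 < t" for t
  proof -
    have "survives t \<omega> \<longleftrightarrow> (\<forall>s\<in>{0..t}. 0 < gap s \<omega>)" using that by (intro survives_iff \<omega>(1)) simp
    also have "\<dots> \<longleftrightarrow> (\<forall>s\<in>H. t < s)"
    proof (intro iffI ballI)
      fix s assume "\<forall>s\<in>{0..t}. 0 < gap s \<omega>" "s \<in> H"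
      then have "s \<in> {0..t} \<Longrightarrow> 0 < gap s \<omega>" "0 \<le> s" "gap s \<omega> \<le> 0" by (auto simp: H_def)
      then show "t < s" by (cases "s \<le> t") auto
    next
      fix s assume "\<forall>s\<in>H. t < s" "s \<in> {0..t}"
      then show "0 < gap s \<omega>" by (cases "0 < gap s \<omega>") (auto simp: H_def)
    qed
    finally show ?thesis .
  qed
  show ?thesis
  proof (cases "H = {}")
    case True
    have "{t. 0 < t \<and> survives t \<omega>} = {0<..}" using surv True by auto
    moreover have "emeasure lborel {0 :: real<..} = \<infinity>"
    proof (rule ccontr)
      assume "emeasure lborel {0 :: real<..} \<noteq> \<infinity>"
      then obtain r where r: "r \<ge> 0" "emeasure lborel {0 :: real<..} = ennreal r"
        by (cases "emeasure lborel {0 :: real<..}") auto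
      have "emeasure lborel {0<..<r + 1} \<le> emeasure lborel {0 :: real<..}"
        by (rule emeasure_mono) auto
      then show False using r by simp
    qed
    ultimately show ?thesis unfolding exit_time_def H True by simp
  next
    case False
    define t0 where "t0 = Inf H"
    have bdd: "bdd_below H" unfolding H_def by (rule bdd_belowI[of _ 0]) auto
    have "H = {0..} \<inter> (\<lambda>s. gap s \<omega>) -` {..0}" by (auto simp: H_def)
    then have "closed H" using continuous_closed_preimage[OF cont, of "{..0}"] by simp
    then have t0: "t0 \<in> H" unfolding t0_def by (rule closed_contains_Inf[OF False bdd])
    have low: "t0 \<le> s" if "s \<in> H" for s unfolding t0_def using that bdd by (rule cInf_lower)
    have "{t. 0 < t \<and> survives t \<omega>} = {0<..<t0}"
    proof (intro set_eqI iffI)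
      fix t assume "t \<in> {t. 0 < t \<and> survives t \<omega>}"
      then show "t \<in> {0<..<t0}" using surv[of t] t0 by auto
    next
      fix t assume "t \<in> {0<..<t0}"
      then show "t \<in> {t. 0 < t \<and> survives t \<omega>}" using surv[of t] low by fastforce
    qed
    moreover have "0 \<le> t0" using t0 by (simp add: H_def)
    moreover have "(INF t\<in>H. ennreal t) = ennreal t0"
      by (intro antisym INF_lower t0 INF_greatest ennreal_leI low)
    ultimately show ?thesis unfolding exit_time_def H by simp
  qed
qed

text \<open>Tonelli's theorem exchanges path and time. Joint measurability comes from the
  description of \<open>survives\<close> by rational times.\<close>

lemma expected_exit_time:
  assumes k: "k \<ge> 2" and x: "0 < min_gap k x"
  shows "(\<integral>\<^sup>+ \<omega>. exit_time (alcove k V) X \<omega> \<partial>M)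
    = (\<integral>\<^sup>+ t. ennreal (alcove_value k t x) * indicator {0<..} t \<partial>lborel)"
proof -
  have k1: "k \<ge> 1" using k by simp
  interpret P: pair_sigma_finite M lborel ..
  let ?J = "{p \<in> space (M \<Otimes>\<^sub>M lborel). 0 < snd p \<and> survives (snd p) (fst p)}"
  have J: "?J \<in> sets (M \<Otimes>\<^sub>M lborel)"
  proof -
    have "{p \<in> space (M \<Otimes>\<^sub>M lborel). q \<le> snd p} \<in> sets (M \<Otimes>\<^sub>M lborel)" for q :: real
      by (intro borel_measurable_le borel_measurable_const) simp
    moreover have "{p \<in> space (M \<Otimes>\<^sub>M lborel). 1 / real (Suc m) \<le> gap q (fst p)} \<in> sets (M \<Otimes>\<^sub>M lborel)"
      if "q \<in> \<rat> \<inter> {0..}" for m :: nat and q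
      using that measurable_compose[OF measurable_fst measurable_gap[OF k1, of q]]
      by (intro borel_measurable_le borel_measurable_const) auto
    ultimately have "{p \<in> space (M \<Otimes>\<^sub>M lborel). \<forall>q\<in>\<rat> \<inter> {0..}. q \<le> snd p \<longrightarrow> 1 / real (Suc m) \<le> gap q (fst p)}
        \<in> sets (M \<Otimes>\<^sub>M lborel)" for m :: nat
      by (intro sets.sets_Collect_countable_All' countable_Rats_nonneg sets.sets_Collect_imp)
    then have "{p \<in> space (M \<Otimes>\<^sub>M lborel). survives (snd p) (fst p)} \<in> sets (M \<Otimes>\<^sub>M lborel)"
      unfolding survives_def by (intro sets.sets_Collect_countable_Ex)
    moreover have "{p \<in> space (M \<Otimes>\<^sub>M lborel). (0 :: real) < snd p} \<in> sets (M \<Otimes>\<^sub>M lborel)"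
      by (intro borel_measurable_less borel_measurable_const) simp
    ultimately show ?thesis by (intro sets.sets_Collect_conj)
  qed
  have "(\<integral>\<^sup>+ \<omega>. exit_time (alcove k V) X \<omega> \<partial>M)
    = (\<integral>\<^sup>+ \<omega>. (\<integral>\<^sup>+ t. indicator {t. 0 < t \<and> survives t \<omega>} t \<partial>lborel) \<partial>M)"
    using AE_good_path[OF k1] AE_space
    by (intro nn_integral_cong_AE, eventually_elim) (rule exit_time_eq_integral[OF k1])
  also have "\<dots> = (\<integral>\<^sup>+ \<omega>. (\<integral>\<^sup>+ t. indicator ?J (\<omega>, t) \<partial>lborel) \<partial>M)"
    by (intro nn_integral_cong) (auto simp: indicator_def space_pair_measure)
  also have "\<dots> = (\<integral>\<^sup>+ t. (\<integral>\<^sup>+ \<omega>. indicator ?J (\<omega>, t) \<partial>M) \<partial>lborel)"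
    by (rule P.Fubini'[symmetric]) (use J in simp)
  also have "\<dots> = (\<integral>\<^sup>+ t. ennreal (alcove_value k t x) * indicator {0<..} t \<partial>lborel)"
  proof (intro nn_integral_cong)
    fix t :: real
    show "(\<integral>\<^sup>+ \<omega>. indicator ?J (\<omega>, t) \<partial>M) = ennreal (alcove_value k t x) * indicator {0<..} t"
    proof (cases "0 < t")
      case True
      have "(\<integral>\<^sup>+ \<omega>. indicator ?J (\<omega>, t) \<partial>M) = (\<integral>\<^sup>+ \<omega>. indicator {\<omega> \<in> space M. survives t \<omega>} \<omega> \<partial>M)"
        using True by (intro nn_integral_cong) (auto simp: indicator_def space_pair_measure)
      also have "\<dots> = ennreal (alcove_value k t x)"
        using sets_survives[OF k1, of t] prob_survives[OF k x True] by (simp add: emeasure_eq_measure)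
      finally show ?thesis using True by simp
    qed (simp add: indicator_def)
  qed
  finally show ?thesis .
qed

lemma alcove_value_nonneg: "k \<ge> 2 \<Longrightarrow> 0 < min_gap k x \<Longrightarrow> 0 < t \<Longrightarrow> 0 \<le> alcove_value k t x"
  using prob_survives[of t] by (metis measure_nonneg)

end

section \<open>The multiple sine series\<close>

text \<open>At frequency 0 the convention for \<open>sine_factor\<close> gives
  \<open>4 / pi * (pi * y / 2) = 2 * y\<close>, while the mode of \<open>heat\<close> is 0 there. So
  for odd \<open>k\<close> the convention amounts to adding \<open>2 * y\<close> to the
  solution.\<close>

lemma sums_frequencies:
  fixes y t :: real and k :: nat
  assumes t: "t > 0"
  defines "F \<equiv> \<lambda>l :: nat. 4 / pi * exp (- (pi\<^sup>2 * t * (real l)\<^sup>2)) * sine_factor l y"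
  shows "(\<lambda>l. norm (F l)) summable_on frequencies k"
    and "infsum F (frequencies k) = heat k t y + (if odd k then 2 * y else 0)"
proof -
  define h where "h l = fourier_weight k l * exp (- (pi\<^sup>2 * t * (real l)\<^sup>2)) * (sin (pi * real l * y) / real l)" for l
  define d where "d l = (if l = 0 then if odd k then 2 * y else 0 else 0)" for l :: nat
  have dF: "h l + d l = F l" if "l \<in> frequencies k" for l
    using that by (cases "l = 0") (auto simp: h_def d_def F_def fourier_weight_def frequencies_def sine_factor_def split: if_splits)
  have d0: "h l + d l = 0" if "l \<notin> frequencies k" for l
    using that by (cases "l = 0") (auto simp: h_def d_def fourier_weight_def frequencies_def split: if_splits)
  have "d sums (if odd k then 2 * y else 0)"
    unfolding d_def using sums_single[of 0 "\<lambda>_. if odd k then 2 * y else 0"] by simp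
  moreover have "h sums heat k t y"
    unfolding h_def heat_def by (rule summable_sums[OF summable_heat[OF t]])
  ultimately have sums: "(\<lambda>l. h l + d l) sums (heat k t y + (if odd k then 2 * y else 0))"
    by (intro sums_add)
  have "summable (\<lambda>l. norm (h l + d l))"
  proof (rule summable_comparison_test')
    have "summable (\<lambda>l. if l = 0 then \<bar>2 * y\<bar> else 0 :: real)"
      using sums_single[of 0 "\<lambda>_. \<bar>2 * y\<bar>"] by (simp add: sums_iff)
    then show "summable (\<lambda>l. 4 * exp (- (pi\<^sup>2 * t * (real l)\<^sup>2)) + (if l = 0 then \<bar>2 * y\<bar> else 0))"
      by (intro summable_add summable_heat_bound t)
    show "norm (norm (h l + d l)) \<le> 4 * exp (- (pi\<^sup>2 * t * (real l)\<^sup>2)) + (if l = 0 then \<bar>2 * y\<bar> else 0)" for l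
    proof -
      have "\<bar>h l\<bar> \<le> 4 * exp (- (pi\<^sup>2 * t * (real l)\<^sup>2))" unfolding h_def by (rule heat_term_le) simp
      moreover have "\<bar>d l\<bar> \<le> (if l = 0 then \<bar>2 * y\<bar> else 0)" by (simp add: d_def)
      ultimately show ?thesis using abs_triangle_ineq[of "h l" "d l"] by simp
    qed
  qed
  then have n: "(\<lambda>l. norm (h l + d l)) summable_on UNIV"
    by (intro norm_summable_imp_summable_on) simp
  have "(\<lambda>l. norm (F l)) summable_on frequencies k \<longleftrightarrow> (\<lambda>l. norm (h l + d l)) summable_on UNIV"
    by (rule summable_on_cong_neutral) (use dF d0 in auto)
  with n show "(\<lambda>l. norm (F l)) summable_on frequencies k" by (simp only:)
  have "((\<lambda>l. h l + d l) has_sum (heat k t y + (if odd k then 2 * y else 0))) UNIV"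
    using \<open>summable (\<lambda>l. norm (h l + d l))\<close> sums by (rule norm_summable_imp_has_sum)
  moreover have "(F has_sum (heat k t y + (if odd k then 2 * y else 0))) (frequencies k) \<longleftrightarrow>
      ((\<lambda>l. h l + d l) has_sum (heat k t y + (if odd k then 2 * y else 0))) UNIV"
    by (rule has_sum_cong_neutral) (use dF d0 in auto)
  ultimately have "(F has_sum (heat k t y + (if odd k then 2 * y else 0))) (frequencies k)" by (simp only:)
  then show "infsum F (frequencies k) = heat k t y + (if odd k then 2 * y else 0)"
    by (rule infsumI)
qed

lemma frequency_tuple_norm_pos:
  assumes "finite S" "l \<in> (S \<rightarrow>\<^sub>E frequencies k) - {\<lambda>s\<in>S. 0}"
  shows "1 \<le> (\<Sum>s\<in>S. (real (l s))\<^sup>2)"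
proof -
  obtain s where s: "s \<in> S" "l s \<noteq> 0"
  proof (rule ccontr)
    assume "\<not> thesis"
    then have "\<forall>s\<in>S. l s = 0" using that by blast
    then have "l = (\<lambda>s\<in>S. 0)" using assms(2) by (auto simp: fun_eq_iff PiE_def extensional_def)
    then show False using assms(2) by simp
  qed
  have "1 \<le> real (l s)" using s(2) by simp
  then have "1 \<le> (real (l s))\<^sup>2" by (rule one_le_power)
  also have "\<dots> \<le> (\<Sum>s\<in>S. (real (l s))\<^sup>2)" using assms(1) s(1) by (intro member_le_sum) auto
  finally show ?thesis .
qed

lemma summable_max_powr:
  fixes e :: real
  assumes "e < - 1"
  shows "summable (\<lambda>n. real (max n 1) powr e)"
proof -
  have "summable (\<lambda>n. real n powr e)" using assms by (simp add: summable_real_powr_iff)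
  then have "summable (\<lambda>n. real (Suc n) powr e)" by (subst summable_Suc_iff)
  moreover have "(\<lambda>n. real (max (Suc n) 1) powr e) = (\<lambda>n. real (Suc n) powr e)" by (simp add: fun_eq_iff max_def)
  ultimately show ?thesis by (subst summable_Suc_iff[symmetric]) simp
qed

text \<open>As \<open>\<bar>l\<bar>\<^sup>2\<close> dominates every \<open>(max l\<^sub>s 1)\<^sup>2\<close>, it dominates their geometric mean, and this makes
  the multiple series a product of convergent ones.\<close>

lemma F_tilde_abs_summable:
  fixes y :: "'i \<Rightarrow> real"
  assumes S: "finite S" "S \<noteq> {}"
  shows "Infinite_Set_Sum.abs_summable_on
    (\<lambda>l. 1 / (\<Sum>s\<in>S. (real (l s))\<^sup>2) * (\<Prod>s\<in>S. sine_factor (l s) (y s))) ((S \<rightarrow>\<^sub>E frequencies k) - {\<lambda>s\<in>S. 0})"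
proof -
  define p where "p = real (card S)"
  have p: "p > 0" using S by (simp add: p_def card_gt_0_iff)
  define m where "m n = real (max n 1)" for n :: nat
  define C where "C s = 1 + \<bar>pi * y s / 2\<bar>" for s
  define b where "b s n = C s * m n powr (- 1 - 2 / p)" for s n
  have m1: "1 \<le> m n" for n by (simp add: m_def)
  have bs: "Infinite_Set_Sum.abs_summable_on (b s) (frequencies k)" for s
  proof (rule abs_summable_on_subset[OF _ subset_UNIV])
    have "summable (\<lambda>n. C s * m n powr (- 1 - 2 / p))"
      unfolding m_def using p by (intro summable_mult summable_max_powr) simp
    then show "Infinite_Set_Sum.abs_summable_on (b s) UNIV"
      unfolding abs_summable_on_nat_iff' b_def by (simp add: abs_mult C_def)
  qed
  have "Infinite_Set_Sum.abs_summable_on (\<lambda>l. \<Prod>s\<in>S. b s (l s)) (S \<rightarrow>\<^sub>E frequencies k)"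
    by (rule abs_summable_on_prod_PiE[OF S(1) _ bs]) auto
  then have "Infinite_Set_Sum.abs_summable_on (\<lambda>l. \<Prod>s\<in>S. b s (l s)) ((S \<rightarrow>\<^sub>E frequencies k) - {\<lambda>s\<in>S. 0})"
    by (rule abs_summable_on_subset) auto
  then show ?thesis
  proof (rule abs_summable_on_comparison_test')
    fix l assume l: "l \<in> (S \<rightarrow>\<^sub>E frequencies k) - {\<lambda>s\<in>S. 0}"
    define N where "N = (\<Sum>s\<in>S. (real (l s))\<^sup>2)"
    have N1: "1 \<le> N" unfolding N_def by (rule frequency_tuple_norm_pos[OF S(1) l])
    have mN: "(m (l s))\<^sup>2 \<le> N" if "s \<in> S" for s
    proof (cases "l s = 0")
      case False
      then have "m (l s) = real (l s)" by (simp add: m_def max_def)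
      then show ?thesis unfolding N_def using S(1) that by (simp, intro member_le_sum) auto
    qed (use N1 in \<open>simp add: m_def\<close>)
    have "(\<Prod>s\<in>S. m (l s) powr (2 / p)) \<le> (\<Prod>s\<in>S. N powr (1 / p))"
    proof (intro prod_mono conjI)
      fix s assume "s \<in> S"
      have "m (l s) powr (2 / p) = ((m (l s))\<^sup>2) powr (1 / p)"
        using m1[of "l s"] by (simp add: powr_powr flip: powr_numeral)
      also have "\<dots> \<le> N powr (1 / p)" using mN[OF \<open>s \<in> S\<close>] p by (intro powr_mono2) auto
      finally show "m (l s) powr (2 / p) \<le> N powr (1 / p)" .
    qed simp
    also have "\<dots> = N"
      using p N1 by (simp add: powr_powr flip: powr_realpow) (simp add: p_def powr_powr)
    finally have PN: "(\<Prod>s\<in>S. m (l s) powr (2 / p)) \<le> N" .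
    have Ppos: "0 < (\<Prod>s\<in>S. m (l s) powr (2 / p))"
      using m1 by (intro prod_pos) (metis powr_gt_zero less_irrefl not_one_le_zero)
    have sf: "\<bar>sine_factor n (y s)\<bar> \<le> C s * m n powr (- 1)" for s n
    proof (cases "n = 0")
      case True
      then show ?thesis by (simp add: sine_factor_def m_def C_def)
    next
      case False
      then have "m n = real n" by (simp add: m_def max_def)
      have "\<bar>sine_factor n (y s)\<bar> = \<bar>sin (pi * real n * y s)\<bar> / real n"
        using False by (simp add: sine_factor_def abs_mult)
      also have "\<dots> \<le> 1 / real n" by (intro divide_right_mono) auto
      also have "\<dots> \<le> C s / real n" by (intro divide_right_mono) (auto simp: C_def)
      finally show ?thesis using False \<open>m n = real n\<close> by (simp add: powr_minus_divide)
    qed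
    have "norm (1 / N * (\<Prod>s\<in>S. sine_factor (l s) (y s))) = 1 / N * (\<Prod>s\<in>S. \<bar>sine_factor (l s) (y s)\<bar>)"
      using N1 by (simp add: abs_mult abs_prod)
    also have "\<dots> \<le> 1 / (\<Prod>s\<in>S. m (l s) powr (2 / p)) * (\<Prod>s\<in>S. C s * m (l s) powr (- 1))"
      using PN Ppos sf by (intro mult_mono divide_left_mono prod_mono) (auto intro!: prod_nonneg mult_pos_pos simp: less_le_trans[OF Ppos PN])
    also have "\<dots> = (\<Prod>s\<in>S. C s * m (l s) powr (- 1) / m (l s) powr (2 / p))"
      by (simp only: prod_dividef times_divide_eq_left mult_1)
    also have "\<dots> = (\<Prod>s\<in>S. b s (l s))"
      unfolding b_def by (simp add: powr_diff)
    finally show "norm (1 / (\<Sum>s\<in>S. (real (l s))\<^sup>2) * (\<Prod>s\<in>S. sine_factor (l s) (y s))) \<le> (\<Prod>s\<in>S. b s (l s))"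
      by (simp only: N_def)
  qed
qed

lemma integral_exp_decay:
  fixes u :: real
  assumes "u > 0"
  shows "integrable lborel (\<lambda>t. indicator {0<..} t * exp (- (t * u)))"
    and "(\<integral>t. indicator {0<..} t * exp (- (t * u)) \<partial>lborel) = 1 / u"
  using integrable_I0i_exp_mscale[OF assms] LBINT_I0i_exp_mscale[OF assms]
  by (simp_all add: set_integrable_def interval_lebesgue_integral_0_infty set_lebesgue_integral_def)

text \<open>The expanded product has one exponential in time for each frequency tuple, and its
  integral produces the reciprocal of the sum of squares. The subtracted product is the term of the
  zero tuple, which does not decay.\<close>

lemma F_tilde_integral:
  fixes y :: "'i \<Rightarrow> real" and k :: nat
  assumes S: "finite S" "S \<noteq> {}"
  defines "G \<equiv> \<lambda>t. (\<Prod>s\<in>S. heat k t (y s) + (if odd k then 2 * y s else 0)) - (if odd k then \<Prod>s\<in>S. 2 * y s else 0)"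
  shows "integrable lborel (\<lambda>t. indicator {0<..} t * G t)"
    and "(\<integral>t. indicator {0<..} t * G t \<partial>lborel) = F_tilde k S y"
proof -
  let ?z = "\<lambda>s\<in>S. 0 :: nat"
  let ?A = "S \<rightarrow>\<^sub>E frequencies k"
  define \<Lambda> where "\<Lambda> = ?A - {?z}"
  \<comment> \<open>After division by \<open>u l\<close> the constant is
    \<open>(4 / pi) ^ p / pi^2 = 2 ^ (2 * p) / pi ^ (p + 2)\<close> for \<open>p = card S\<close>,
    as in \<open>F_tilde\<close>.\<close>
  define q where "q l = (4 / pi) ^ card S * (\<Prod>s\<in>S. sine_factor (l s) (y s))" for l
  define u where "u l = pi\<^sup>2 * (\<Sum>s\<in>S. (real (l s))\<^sup>2)" for l :: "'i \<Rightarrow> nat"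
  define a where "a t s n = 4 / pi * exp (- (pi\<^sup>2 * t * (real n)\<^sup>2)) * sine_factor n (y s)" for t s n
  have upos: "u l > 0" if "l \<in> \<Lambda>" for l
    using frequency_tuple_norm_pos[OF S(1), of l k] that by (simp add: u_def \<Lambda>_def)
  have prod: "(\<Prod>s\<in>S. a t s (l s)) = q l * exp (- (t * u l))" for t l
  proof -
    have e: "exp (- (t * u l)) = (\<Prod>s\<in>S. exp (- (pi\<^sup>2 * t * (real (l s))\<^sup>2)))"
      unfolding exp_sum[OF S(1), symmetric] u_def sum_negf sum_distrib_left by (simp add: mult_ac)
    show ?thesis unfolding a_def prod.distrib prod_constant e q_def by simp
  qed
  have cA: "countable ?A" using S(1) by (intro countable_PiE) auto
  have c\<Lambda>: "countable \<Lambda>" unfolding \<Lambda>_def using cA by (rule countable_subset[rotated]) auto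
  have base: "Infinite_Set_Sum.abs_summable_on (\<lambda>l. 1 / (\<Sum>s\<in>S. (real (l s))\<^sup>2) * (\<Prod>s\<in>S. sine_factor (l s) (y s))) \<Lambda>"
    unfolding \<Lambda>_def by (rule F_tilde_abs_summable[OF S])
  have qu: "q l / u l = (4 / pi) ^ card S / pi\<^sup>2 * (1 / (\<Sum>s\<in>S. (real (l s))\<^sup>2) * (\<Prod>s\<in>S. sine_factor (l s) (y s)))" for l
    by (simp add: q_def u_def)
  have qs: "Infinite_Set_Sum.abs_summable_on (\<lambda>l. q l / u l) \<Lambda>"
    unfolding qu by (rule abs_summable_on_cmult_right) (rule base)
  have q_sum: "infsetsum (\<lambda>l. q l / u l) \<Lambda> = F_tilde k S y"
  proof -
    have "infsetsum (\<lambda>l. q l / u l) \<Lambda> = (4 / pi) ^ card S / pi\<^sup>2 *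
        infsetsum (\<lambda>l. 1 / (\<Sum>s\<in>S. (real (l s))\<^sup>2) * (\<Prod>s\<in>S. sine_factor (l s) (y s))) \<Lambda>"
      unfolding qu by (rule infsetsum_cmult_right) (use base in simp)
    also have "(4 / pi) ^ card S / pi\<^sup>2 = 2 ^ (2 * card S) / pi ^ (card S + 2)"
      by (simp add: power_divide power_add power_mult power2_eq_square)
    finally show ?thesis
      unfolding infsetsum_infsum[OF base] by (simp add: F_tilde_def \<Lambda>_def)
  qed
  have pw: "Infinite_Set_Sum.abs_summable_on (\<lambda>l. q l * exp (- (t * u l))) \<Lambda>"
    "infsetsum (\<lambda>l. q l * exp (- (t * u l))) \<Lambda> = G t" if t: "t > 0" for t
  proof -
    have as: "Infinite_Set_Sum.abs_summable_on (a t s) (frequencies k)" for s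
      unfolding a_def using sums_frequencies(1)[OF t, of "y s" k] by (subst abs_summable_equivalent[symmetric])
    have fA: "Infinite_Set_Sum.abs_summable_on (\<lambda>l. \<Prod>s\<in>S. a t s (l s)) ?A"
      by (rule abs_summable_on_prod_PiE[OF S(1) _ as]) auto
    then show 1: "Infinite_Set_Sum.abs_summable_on (\<lambda>l. q l * exp (- (t * u l))) \<Lambda>"
      unfolding prod \<Lambda>_def by (rule abs_summable_on_subset) auto
    have tot: "infsum (\<lambda>l. \<Prod>s\<in>S. a t s (l s)) ?A = (\<Prod>s\<in>S. heat k t (y s) + (if odd k then 2 * y s else 0))"
    proof -
      have "infsum (\<lambda>l. \<Prod>s\<in>S. a t s (l s)) ?A = (\<Prod>s\<in>S. infsum (a t s) (frequencies k))"
        by (rule infsum_prod_PiE_abs[OF S(1)]) (rule abs_summable_equivalent[THEN iffD2, OF as])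
      then show ?thesis unfolding a_def sums_frequencies(2)[OF t] .
    qed
    have sA: "(\<lambda>l. \<Prod>s\<in>S. a t s (l s)) summable_on ?A"
      by (rule abs_summable_summable[OF abs_summable_equivalent[THEN iffD2, OF fA]])
    have "infsum (\<lambda>l. \<Prod>s\<in>S. a t s (l s)) \<Lambda> = G t"
    proof (cases "odd k")
      case True
      then have z: "?z \<in> ?A" by (auto simp: frequencies_def)
      have "infsum (\<lambda>l. \<Prod>s\<in>S. a t s (l s)) \<Lambda> = infsum (\<lambda>l. \<Prod>s\<in>S. a t s (l s)) ?A - infsum (\<lambda>l. \<Prod>s\<in>S. a t s (l s)) {?z}"
        unfolding \<Lambda>_def using sA z by (intro infsum_Diff) auto
      also have "infsum (\<lambda>l. \<Prod>s\<in>S. a t s (l s)) {?z} = (\<Prod>s\<in>S. 2 * y s)"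
        by (simp add: a_def sine_factor_def)
      finally show ?thesis using True by (simp add: tot G_def)
    next
      case False
      \<comment> \<open>For even \<open>k\<close> the zero tuple has an entry outside
        \<open>frequencies k\<close>, as \<open>S\<close> is nonempty; so nothing is removed from
        the index set.\<close>
      obtain s where "s \<in> S" using S(2) by blast
      then have "?z \<notin> ?A" using False by (auto simp: frequencies_def PiE_def Pi_def)
      then have "\<Lambda> = ?A" by (auto simp: \<Lambda>_def)
      then show ?thesis using False by (simp add: tot G_def)
    qed
    then show "infsetsum (\<lambda>l. q l * exp (- (t * u l))) \<Lambda> = G t"
      unfolding infsetsum_infsum[OF 1] prod .
  qed
  \<comment> \<open>As the sum over tuples is an integral for the counting measure, the exchange
    with the time integral is Fubini's theorem. Its integrability condition is the absolute
    convergence of the series in \<open>F_tilde\<close>.\<close>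
  interpret C: sigma_finite_measure "count_space \<Lambda>" by (rule sigma_finite_measure_count_space_countable[OF c\<Lambda>])
  interpret P: pair_sigma_finite "count_space \<Lambda>" lborel ..
  let ?f = "\<lambda>l t. indicator {0<..} t * (q l * exp (- (t * u l)))"
  have fm: "case_prod ?f \<in> borel_measurable (count_space \<Lambda> \<Otimes>\<^sub>M lborel)"
    using c\<Lambda> by (intro measurable_pair_measure_countable1) auto
  have int_l: "integrable lborel (?f l)" "(\<integral>t. ?f l t \<partial>lborel) = q l / u l" "(\<integral>t. norm (?f l t) \<partial>lborel) = norm (q l / u l)"
    if "l \<in> \<Lambda>" for l
  proof -
    note E = integral_exp_decay[OF upos[OF that]]
    have eq: "?f l = (\<lambda>t. q l * (indicator {0<..} t * exp (- (t * u l))))" by (simp add: fun_eq_iff)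
    show "integrable lborel (?f l)" unfolding eq using E(1) by (rule integrable_mult_right)
    show "(\<integral>t. ?f l t \<partial>lborel) = q l / u l" unfolding eq using E by simp
    have "norm (?f l t) = \<bar>q l\<bar> * (indicator {0<..} t * exp (- (t * u l)))" for t
      by (simp add: abs_mult indicator_def)
    then show "(\<integral>t. norm (?f l t) \<partial>lborel) = norm (q l / u l)"
      using E upos[OF that] by simp
  qed
  have fint: "integrable (count_space \<Lambda> \<Otimes>\<^sub>M lborel) (case_prod ?f)"
  proof (rule P.Fubini_integrable[OF fm])
    have "integrable (count_space \<Lambda>) (\<lambda>l. norm (q l / u l))"
      using qs unfolding abs_summable_on_def by (rule integrable_norm)
    then show "integrable (count_space \<Lambda>) (\<lambda>l. \<integral>t. norm (case_prod ?f (l, t)) \<partial>lborel)"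
      by (rule Bochner_Integration.integrable_cong[THEN iffD1, rotated -1]) (use int_l(3) in auto)
    show "AE l in count_space \<Lambda>. integrable lborel (\<lambda>t. case_prod ?f (l, t))"
      using int_l(1) by (simp add: AE_count_space)
  qed
  have inner: "(\<integral>l. ?f l t \<partial>count_space \<Lambda>) = indicator {0<..} t * G t" for t
  proof (cases "t > 0")
    case True
    then show ?thesis using pw(2)[OF True] by (simp add: infsetsum_def)
  qed (simp add: indicator_def)
  show "integrable lborel (\<lambda>t. indicator {0<..} t * G t)"
    using P.integrable_snd[OF fint] unfolding inner .
  have "(\<integral>t. indicator {0<..} t * G t \<partial>lborel) = (\<integral>t. (\<integral>l. ?f l t \<partial>count_space \<Lambda>) \<partial>lborel)"
    unfolding inner ..
  also have "\<dots> = (\<integral>l. (\<integral>t. ?f l t \<partial>lborel) \<partial>count_space \<Lambda>)"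
    unfolding P.integral_snd[OF fint] P.integral_fst[OF fint] ..
  also have "\<dots> = (\<integral>l. q l / u l \<partial>count_space \<Lambda>)"
    using int_l(2) by (intro Bochner_Integration.integral_cong) auto
  also have "\<dots> = F_tilde k S y" using q_sum by (simp add: infsetsum_def)
  finally show "(\<integral>t. indicator {0<..} t * G t \<partial>lborel) = F_tilde k S y" .
qed

text \<open>Otherwise the points 1 and 2 would both be joined to \<open>0\<close>.\<close>

lemma pairs_nonempty:
  assumes \<pi>: "\<pi> \<in> P2 k" and k: "k \<ge> 2"
  shows "pairs \<pi> \<noteq> {}"
proof
  assume empty: "pairs \<pi> = {}"
  have m: "arcs \<pi> \<in> matchings (arc_points k)" using bij_betw_apply[OF bij_betw_arcs \<pi>] .
  have zero: "fst p = 0" if "p \<in> arcs \<pi>" for p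
    using that empty by (auto simp: arcs_def)
  have "1 \<in> arc_points k" "2 \<in> arc_points k" using k by (auto simp: arc_points_def)
  then obtain p q where p: "p \<in> arcs \<pi>" "1 = fst p \<or> 1 = snd p" and q: "q \<in> arcs \<pi>" "2 = fst q \<or> 2 = snd q"
    using matchings_ex[OF m] by meson
  have "{fst p, snd p} \<inter> {fst q, snd q} \<noteq> {}" using zero[OF p(1)] zero[OF q(1)] by auto
  then have "p = q" by (rule matchings_unique[OF m p(1) q(1)])
  then show False using p q zero[OF p(1)] by auto
qed

text \<open>For odd \<open>k\<close> the shift by \<open>2 * (x i - x j)\<close> is absorbed twice.
  Added to the wave it changes nothing, and added to the zero matrix it shows that the zero-tuple
  terms cancel in the signed sum; there \<open>pairs_nonempty\<close> ensures that the products of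
  zeros are 0.\<close>

lemma alcove_value_eq_sum:
  assumes k: "k \<ge> 2" and t: "t > 0"
  shows "alcove_value k t x = (\<Sum>\<pi>\<in>P2 k. (- 1) ^ crossings \<pi> *
    ((\<Prod>(i, j)\<in>pairs \<pi>. heat k t (x i - x j) + (if odd k then 2 * (x i - x j) else 0))
      - (if odd k then \<Prod>(i, j)\<in>pairs \<pi>. 2 * (x i - x j) else 0)))"
proof (cases "odd k")
  case True
  have "(\<Sum>\<pi>\<in>P2 k. (- 1) ^ crossings \<pi> * (\<Prod>(i, j)\<in>pairs \<pi>. heat k t (x i - x j) + (2 * x i - 2 * x j)))
    = alcove_value k t x"
    unfolding alcove_value_def by (rule sum_P2_shift[OF heat_antisym[OF t] True])
  moreover have "(\<Sum>\<pi>\<in>P2 k. (- 1) ^ crossings \<pi> * (\<Prod>(i, j)\<in>pairs \<pi>. 0 + (2 * x i - 2 * x j)))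
      = (\<Sum>\<pi>\<in>P2 k. (- 1) ^ crossings \<pi> * (\<Prod>(i, j)\<in>pairs \<pi>. 0))"
    by (rule sum_P2_shift[OF _ True]) simp
  moreover have "\<dots> = 0"
    using pairs_nonempty[OF _ k] finite_pairs by (intro sum.neutral) (auto simp: case_prod_unfold card_gt_0_iff)
  ultimately show ?thesis using True by (simp add: right_diff_distrib sum_subtractf case_prod_unfold)
qed (simp add: alcove_value_def)

theorem proposition11:
  fixes M :: "'w measure" and k :: nat and V :: "(nat \<Rightarrow> real) set"
    and x :: "nat \<Rightarrow> real" and X :: "real \<Rightarrow> 'w \<Rightarrow> nat \<Rightarrow> real"
  assumes "k \<ge> 2"
    and "V = full_space k \<or> V = zero_sum_space k"
    and "x \<in> alcove k V"
    and "brownian_motion M k V x X"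
  shows "enn2ereal (\<integral>\<^sup>+\<omega>. exit_time (alcove k V) X \<omega> \<partial>M) =
         ereal (\<Sum>\<pi>\<in>P2 k. (- 1) ^ crossings \<pi> * F_tilde k (pairs \<pi>) (\<lambda>(i, j). x i - x j))"
proof -
  interpret brownian_alcove M k V x X
    using assms(2,4) by (intro brownian_alcove.intro brownian_alcove_axioms.intro)
  have "x \<in> V" using assms(3) by (simp add: alcove_def)
  then have x: "0 < min_gap k x" using alcove_iff[of k x V] assms(1,3) by simp
  define G where "G \<pi> t = indicator {0<..} t *
    ((\<Prod>p\<in>pairs \<pi>. heat k t (case p of (i, j) \<Rightarrow> x i - x j) + (if odd k then 2 * (case p of (i, j) \<Rightarrow> x i - x j) else 0))
      - (if odd k then \<Prod>p\<in>pairs \<pi>. 2 * (case p of (i, j) \<Rightarrow> x i - x j) else 0))" for \<pi> t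
  have G: "integrable lborel (G \<pi>)" "(\<integral>t. G \<pi> t \<partial>lborel) = F_tilde k (pairs \<pi>) (\<lambda>(i, j). x i - x j)"
    if "\<pi> \<in> P2 k" for \<pi>
    using F_tilde_integral[OF finite_pairs[OF that] pairs_nonempty[OF that assms(1)], of k "\<lambda>(i, j). x i - x j"]
    by (simp_all add: G_def[abs_def])
  have val: "indicator {0<..} t * alcove_value k t x = (\<Sum>\<pi>\<in>P2 k. (- 1) ^ crossings \<pi> * G \<pi> t)" for t
  proof (cases "t > 0")
    case True
    then show ?thesis
      unfolding alcove_value_eq_sum[OF assms(1) True] G_def case_prod_unfold by simp
  qed (simp add: G_def)
  have int: "integrable lborel (\<lambda>t. indicator {0<..} t * alcove_value k t x)"
    unfolding val using G(1) by (intro Bochner_Integration.integrable_sum integrable_mult_right)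
  have "(\<integral>\<^sup>+\<omega>. exit_time (alcove k V) X \<omega> \<partial>M) = (\<integral>\<^sup>+ t. ennreal (alcove_value k t x) * indicator {0<..} t \<partial>lborel)"
    by (rule expected_exit_time[OF assms(1) x])
  also have "\<dots> = (\<integral>\<^sup>+ t. ennreal (indicator {0<..} t * alcove_value k t x) \<partial>lborel)"
    by (intro nn_integral_cong) (simp add: indicator_def)
  also have "\<dots> = ennreal (\<integral>t. indicator {0<..} t * alcove_value k t x \<partial>lborel)"
    using int alcove_value_nonneg[OF assms(1) x] by (intro nn_integral_eq_integral AE_I2) (auto simp: indicator_def)
  also have "(\<integral>t. indicator {0<..} t * alcove_value k t x \<partial>lborel)
    = (\<Sum>\<pi>\<in>P2 k. (- 1) ^ crossings \<pi> * F_tilde k (pairs \<pi>) (\<lambda>(i, j). x i - x j))"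
    unfolding val using G by (simp add: Bochner_Integration.integral_sum)
  finally have eq: "(\<integral>\<^sup>+\<omega>. exit_time (alcove k V) X \<omega> \<partial>M)
    = ennreal (\<Sum>\<pi>\<in>P2 k. (- 1) ^ crossings \<pi> * F_tilde k (pairs \<pi>) (\<lambda>(i, j). x i - x j))" .
  \<comment> \<open>Since \<open>ennreal\<close> sends negative reals to 0, the passage to
    \<open>ereal\<close> requires the sum to be nonnegative; it is an integral of
    probabilities.\<close>
  have "0 \<le> (\<integral>t. indicator {0<..} t * alcove_value k t x \<partial>lborel)"
    using alcove_value_nonneg[OF assms(1) x] by (intro integral_nonneg_AE AE_I2) (auto simp: indicator_def)
  then have "0 \<le> (\<Sum>\<pi>\<in>P2 k. (- 1) ^ crossings \<pi> * F_tilde k (pairs \<pi>) (\<lambda>(i, j). x i - x j))"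
    unfolding val using G by (simp add: Bochner_Integration.integral_sum)
  with eq show ?thesis by simp
qed

end
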